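(* Let $\alpha$ be $S^+$-admissible, $(a,b)$ be an $\alpha$-compatible pair, $N=N(\alpha,a,b)$ and $r\in\mathbb{N}^*$. The connected components of the fibre $\Phi_{\alpha,r}^{-1}([(a,b)])$ are biholomorphic to either $\mathbb{C}^*$ or $\mathbb{C}$. The connected component associated with an orbit $\mathcal{G}_{(a,b)}[c]_{ab}$, where $[c]_{ab}\in\mathscr{C}_{a,b,r}$, is biholomorphic to $\mathbb{C}$ if and only if, putting $p=p(a,b,c,r)$, the following condition is satisfied: there exists $L\in Z^+_{\mathrm{GL}(2,\mathbb{Z})}(N)$ such that $\varepsilon_L=-1$ and $(I_2-\varepsilon_LL)p\in r\mathbb{Z}^2+(I_2-N)\mathbb{Z}^2$, where $\varepsilon_L=\det(L)$.
   Context: $\mathbb{N}^*=\{1,2,\dots\}$. For $x,y\in\mathbb{R}^2$, $x\wedge y=x_1y_2-x_2y_1$. Elements of $\mathbb{R}^2$ are columns; $k=(k_1,k_2)\in\mathbb{Z}^2$ in the action (ii) below is treated as a row, so $ka=k_1a_1+k_2a_2$. $\alpha$ is $S^+$-admissible if $\alpha=\frac{\theta+\sqrt{\theta^2-4}}{2}$ with $\theta\in\mathbb{Z}$, $\theta\ge3$. Put $d=\theta-2$, $\mathbb{Z}_d=\mathbb{Z}/d\mathbb{Z}$. $\mathcal{P}_\alpha$ is the set of linearly independent pairs $(a,b)\in\mathbb{R}^2\times\mathbb{R}^2$ that are $\alpha$-compatible, i.e. such that $N=(n_{ij})=N(\alpha,a,b):=Q\,\mathrm{diag}(\alpha,\alpha^{-1})Q^{-1}\in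 M_2(\mathbb{Z})$, $Q$ being the matrix with columns $a,b$. For $(a,b)\in\mathcal{P}_\alpha$, $r\in\mathbb{N}^*$, $\mathcal{C}_{a,b,r}$ is the set of $c\in\mathbb{R}^2$ for which there is $p=p(a,b,c,r)\in\mathbb{Z}^2$ with $$(I_2-N)\Big(c-\tfrac12\begin{pmatrix}a_1b_1\\ a_2b_2\end{pmatrix}\Big)-\tfrac{b\wedge a}{2}\begin{pmatrix}n_{11}n_{12}\\ n_{21}n_{22}\end{pmatrix}=\tfrac{b\wedge a}{r}\,p(a,b,c,r).$$ $\mathcal{T}_{\alpha,r}$ is the set of triples $(a,b,c)$ with $(a,b)\in\mathcal{P}_\alpha$, $c\in\mathcal{C}_{a,b,r}$, with the coarsest topology making $(a,b,c)\mapsto N(\alpha,a,b)\in\mathrm{SL}(2,\mathbb{Z})$, $(a,b,c)\mapsto p(a,b,c,r)\in\mathbb{Z}^2$ (discrete targets) and $(a,b,c)\mapsto(a,b)$ continuous; $\mathcal{A}_{\alpha,r}=\mathcal{T}_{\alpha,r}\times\mathbb{C}$ has the product topology. Put $[c]_{ab}=c+\frac{b\wedge a}{r}\mathbb{Z}^2$, $[t]_{ab}=t+\frac{b\wedge a}{r}\mathbb{Z}$, $\mathscr{C}_{a,b,r}=\mathcal{C}_{a,b,r}/\frac{b\wedge a}{r}\mathbb{Z}^2$, and let $\mathscr{A}_{\alpha,r}$ be the set of all $(a,b,[c]_{ab},[t]_{ab})$ with $(a,b,c,t)\in\mathcal{A}_{\alpha,r}$, with the quotient topology. Actions on $\mathscr{A}_{\alpha,r}$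 (all well defined): (i) $K=(k_{ij})\in\mathrm{GL}(2,\mathbb{Z})$: $K\cdot(a,b,[c]_{ab},[t]_{ab})=(A,B,[C]_{AB},[t]_{AB})$, $A=Ka$, $B=Kb$, $C=\tfrac12\begin{pmatrix}A_1B_1\\ A_2B_2\end{pmatrix}+K\big(c-\tfrac12\begin{pmatrix}a_1b_1\\ a_2b_2\end{pmatrix}\big)+\tfrac{b\wedge a}{2}\begin{pmatrix}k_{11}k_{12}\\ k_{21}k_{22}\end{pmatrix}$. (ii) $k\in\mathbb{Z}^2$: $k\cdot(a,b,[c]_{ab},[t]_{ab})=(a,b,[k\cdot c]_{ab},[k\cdot_ct]_{ab})$, $k\cdot c=c-\tfrac{\alpha(ka)}{\alpha-1}b-\tfrac{kb}{\alpha-1}a$, $k\cdot_ct=t+\tfrac{\alpha(ka)(kb)}{1-\alpha}+kc+\tfrac{k_1(k_1-1)a_1b_1+k_2(k_2-1)a_2b_2}{2}+k_1k_2b_1a_2$; this descends to an action of $\mathbb{Z}_d^2=\mathbb{Z}^2/d\mathbb{Z}^2$. (iii) $(\mu,\rho)\in\mathbb{R}^*_+\times\mathbb{R}^*$: $(a,b,[c]_{ab},[t]_{ab})\mapsto(\mu a,\rho b,[\mu\rho c]_{\mu a,\rho b},[\mu\rho t]_{\mu a,\rho b})$. Let $\mathcal{G}=(\mathbb{R}^*_+\times\mathbb{R}^* )\times(\mathrm{GL}(2,\mathbb{Z})\ltimes_\psi\mathbb{Z}_d^2)$, where the semidirect product has the law $(K,[k])*(K',[k'])=(KK',[kK'+k'])$.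 $\mathcal{G}$ acts on $\mathscr{A}_{\alpha,r}$ by $((\mu,\rho),(K,[k]))\cdot x=K\cdot(k\cdot((\mu,\rho)\cdot x))$ and on $\mathcal{P}_\alpha$ by $(a,b)\mapsto(\mu Ka,\rho Kb)$. $\mathscr{Q}_{\alpha,r}=\mathscr{A}_{\alpha,r}/\mathcal{G}$ has the quotient topology, and $\Phi_{\alpha,r}:\mathscr{Q}_{\alpha,r}\to\mathcal{P}_\alpha/\mathcal{G}$ is induced by $(a,b,[c]_{ab},[t]_{ab})\mapsto(a,b)$. $\mathcal{G}_{(a,b)}$ is the stabiliser of $(a,b)\in\mathcal{P}_\alpha$; it acts on $\mathscr{C}_{a,b,r}\times(\mathbb{C}/\frac{b\wedge a}{r}\mathbb{Z})$ through its action on elements $(a,b,[c]_{ab},[t]_{ab})$, and on $\mathscr{C}_{a,b,r}$ so that the first projection is equivariant. The connected components of $\Phi_{\alpha,r}^{-1}([(a,b)])$ are parameterised by $\mathscr{C}_{a,b,r}/\mathcal{G}_{(a,b)}$: the component associated with $\mathcal{G}_{(a,b)}[c]_{ab}$ consists of the classes of the elements $(a,b,[c]_{ab},[t]_{ab})$, $t\in\mathbb{C}$, and is canonically identified with the quotient of the Riemann surface $\mathbb{C}/\frac{b\wedge a}{r}\mathbb{Z}$ by the stabiliser $\mathcal{G}_{(a,b),[c]_{ab}}$ of $[c]_{ab}$ in $\mathcal{G}_{(a,b)}$, which acts on it through a finite group of holomorphic automorphisms; this identification gives the component its complex structure. The positive centraliser is $Z^+_{\mathrm{GL}(2,\mathbb{Z})}(N)=\{K\in\mathrm{GL}(2,\mathbb{Z})\mid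 KN=NK,\ Ka\in\mathbb{R}^*_+a\}$. *)

theory Defs
  imports "HOL-Complex_Analysis.Complex_Analysis" "HOL-Algebra.Group_Action"
begin

section \<open>Quotient topologies\<close>

definition quotient_topology :: "'a topology \<Rightarrow> ('a \<Rightarrow> 'b) \<Rightarrow> 'b topology" where
  "quotient_topology X f =
     topology (\<lambda>U. U \<subseteq> f ` topspace X \<and> openin X {x \<in> topspace X. f x \<in> U})"

lemma openin_quotient_topology:
  "openin (quotient_topology X f) U \<longleftrightarrow>
     U \<subseteq> f ` topspace X \<and> openin X {x \<in> topspace X. f x \<in> U}"
proof -
  have "istopology (\<lambda>U. U \<subseteq> f ` topspace X \<and> openin X {x \<in> topspace X. f x \<in> U})"
    unfolding istopology_def
  proof (rule conjI, intro allI impI, goal_cases)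
    case (1 S T)
    have "{x \<in> topspace X. f x \<in> S \<inter> T} =
            {x \<in> topspace X. f x \<in> S} \<inter> {x \<in> topspace X. f x \<in> T}"
      by auto
    with 1 show ?case by auto
  next
    case 2
    show ?case
    proof (intro allI impI conjI)
      fix \<K>
      assume K: "\<forall>U\<in>\<K>. U \<subseteq> f ` topspace X \<and> openin X {x \<in> topspace X. f x \<in> U}"
      then show "\<Union>\<K> \<subseteq> f ` topspace X" by blast
      have "{x \<in> topspace X. f x \<in> \<Union>\<K>} = \<Union>((\<lambda>U. {x \<in> topspace X. f x \<in> U}) ` \<K>)"
        by auto
      with K show "openin X {x \<in> topspace X. f x \<in> \<Union>\<K>}" by auto
    qed
  qed
  then show ?thesis
    by (simp add: quotient_topology_def)
qed

lemma topspace_quotient_topology [simp]: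
  "topspace (quotient_topology X f) = f ` topspace X"
proof -
  have "{x \<in> topspace X. f x \<in> f ` topspace X} = topspace X"
    by auto
  then have "openin (quotient_topology X f) (f ` topspace X)"
    by (simp add: openin_quotient_topology)
  then show ?thesis
    by (metis openin_quotient_topology openin_subset openin_topspace subset_antisym)
qed

lemma quotient_map_quotient_topology: "quotient_map X (quotient_topology X f) f"
  unfolding quotient_map_def by (simp add: openin_quotient_topology)


section \<open>Riemann surfaces\<close>

text \<open>A chart is a pair of a domain and a complex-valued function, of which only the values
  on the domain matter.\<close>

record 'a surface =
  underlying :: "'a topology"
  charts :: "('a set \<times> ('a \<Rightarrow> complex)) set"

definition complex_chart :: "'a topology \<Rightarrow> 'a set \<Rightarrow> ('a \<Rightarrow> complex) \<Rightarrow> bool" where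
  "complex_chart X U \<phi> \<longleftrightarrow>
     openin X U \<and> open (\<phi> ` U) \<and>
     homeomorphic_map (subtopology X U) (top_of_set (\<phi> ` U)) \<phi>"

definition riemann_surface :: "'a surface \<Rightarrow> bool" where
  "riemann_surface S \<longleftrightarrow>
     Hausdorff_space (underlying S) \<and> connected_space (underlying S) \<and>
     (\<forall>(U, \<phi>) \<in> charts S. complex_chart (underlying S) U \<phi>) \<and>
     \<Union>(fst ` charts S) = topspace (underlying S) \<and>
     (\<forall>(U, \<phi>) \<in> charts S. \<forall>(V, \<psi>) \<in> charts S.
        (\<psi> \<circ> inv_into U \<phi>) holomorphic_on \<phi> ` (U \<inter> V))"

definition holomorphic_map :: "'a surface \<Rightarrow> 'b surface \<Rightarrow> ('a \<Rightarrow> 'b) \<Rightarrow> bool" where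
  "holomorphic_map S T f \<longleftrightarrow>
     continuous_map (underlying S) (underlying T) f \<and>
     (\<forall>(U, \<phi>) \<in> charts S. \<forall>(V, \<psi>) \<in> charts T.
        (\<psi> \<circ> f \<circ> inv_into U \<phi>) holomorphic_on \<phi> ` {x \<in> U. f x \<in> V})"

definition biholomorphic :: "'a surface \<Rightarrow> 'b surface \<Rightarrow> bool" where
  "biholomorphic S T \<longleftrightarrow>
     riemann_surface S \<and> riemann_surface T \<and>
     (\<exists>f g. holomorphic_map S T f \<and> holomorphic_map T S g \<and>
        (\<forall>x \<in> topspace (underlying S). g (f x) = x) \<and>
        (\<forall>y \<in> topspace (underlying T). f (g y) = y))"

definition plane_surface :: "complex set \<Rightarrow> complex surface" where
  "plane_surface W = \<lparr>underlying = top_of_set W, charts = {(W, id)}\<rparr>"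

text \<open>The quotient of a Riemann surface by the fibres of \<open>\<pi>\<close>, which below is always the
  projection to the orbit space of a group of holomorphic automorphisms that is finite or acts
  by translations of a lattice. The complex structure on the quotient is the unique one for which
  \<open>\<pi>\<close> is holomorphic, and the charts below form its maximal atlas: a homeomorphism \<open>\<phi>\<close> from an
  open set onto an open subset of the complex plane is a chart iff \<open>\<phi> \<circ> \<pi>\<close> is holomorphic.\<close>

definition quotient_surface :: "'a surface \<Rightarrow> ('a \<Rightarrow> 'b) \<Rightarrow> 'b surface" where
  "quotient_surface S \<pi> =
     \<lparr>underlying = quotient_topology (underlying S) \<pi>,
      charts = {(U, \<phi>). complex_chart (quotient_topology (underlying S) \<pi>) U \<phi> \<and>
        (\<forall>(V, \<psi>) \<in> charts S.
           (\<phi> \<circ> \<pi> \<circ> inv_into V \<psi>) holomorphic_on \<psi> ` {x \<in> V. \<pi> x \<in> U})}\<rparr>"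

text \<open>The complex structure on a topological space \<open>X\<close> that comes from a Riemann surface \<open>S\<close>
  through a bijection \<open>\<iota>\<close> from \<open>S\<close> to \<open>X\<close>. The topology is that of \<open>X\<close>, so that the result is a
  Riemann surface only if \<open>\<iota>\<close> is a homeomorphism.\<close>

definition transport_surface :: "'a surface \<Rightarrow> ('a \<Rightarrow> 'b) \<Rightarrow> 'b topology \<Rightarrow> 'b surface" where
  "transport_surface S \<iota> X =
     \<lparr>underlying = X,
      charts = {(U, \<phi>). U \<subseteq> topspace X \<and>
        ({x \<in> topspace (underlying S). \<iota> x \<in> U}, \<phi> \<circ> \<iota>) \<in> charts S}\<rparr>"


section \<open>Compatible pairs\<close>

abbreviation rvec :: "int^2 \<Rightarrow> real^2" where
  "rvec k \<equiv> (\<chi> i. real_of_int (k $ i))"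

abbreviation rmat :: "int^2^2 \<Rightarrow> real^2^2" where
  "rmat M \<equiv> map_matrix real_of_int M"

definition wedge :: "real^2 \<Rightarrow> real^2 \<Rightarrow> real" where
  "wedge x y = x $ 1 * y $ 2 - x $ 2 * y $ 1"

definition S_plus_admissible :: "real \<Rightarrow> bool" where
  "S_plus_admissible \<alpha> \<longleftrightarrow>
     (\<exists>\<theta>::int. \<theta> \<ge> 3 \<and> \<alpha> = (real_of_int \<theta> + sqrt ((real_of_int \<theta>)\<^sup>2 - 4)) / 2)"

definition theta :: "real \<Rightarrow> int" where
  "theta \<alpha> = (THE \<theta>::int. \<theta> \<ge> 3 \<and> \<alpha> = (real_of_int \<theta> + sqrt ((real_of_int \<theta>)\<^sup>2 - 4)) / 2)"

definition dd :: "real \<Rightarrow> int" where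
  "dd \<alpha> = theta \<alpha> - 2"

definition QDQ :: "real \<Rightarrow> real^2 \<Rightarrow> real^2 \<Rightarrow> real^2^2" where
  "QDQ \<alpha> a b =
     (let Q = transpose (vector [a, b] :: real^2^2);
          D = (vector [vector [\<alpha>, 0] :: real^2, vector [0, inverse \<alpha>]] :: real^2^2)
      in Q ** D ** matrix_inv Q)"

definition compatible_pairs :: "real \<Rightarrow> ((real^2) \<times> (real^2)) set" where
  "compatible_pairs \<alpha> =
     {(a, b). a \<noteq> b \<and> independent {a, b} \<and> (\<exists>M::int^2^2. rmat M = QDQ \<alpha> a b)}"

definition NN :: "real \<Rightarrow> real^2 \<Rightarrow> real^2 \<Rightarrow> int^2^2" where
  "NN \<alpha> a b = (THE M. rmat M = QDQ \<alpha> a b)"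

definition half_diag :: "real^2 \<Rightarrow> real^2 \<Rightarrow> real^2" where
  "half_diag a b = (1/2) *\<^sub>R vector [a $ 1 * b $ 1, a $ 2 * b $ 2]"

definition row_prods :: "int^2^2 \<Rightarrow> real^2" where
  "row_prods M = rvec (vector [M $ 1 $ 1 * M $ 1 $ 2, M $ 2 $ 1 * M $ 2 $ 2])"

definition is_p :: "real \<Rightarrow> nat \<Rightarrow> real^2 \<Rightarrow> real^2 \<Rightarrow> real^2 \<Rightarrow> int^2 \<Rightarrow> bool" where
  "is_p \<alpha> r a b c p \<longleftrightarrow>
     rmat (mat 1 - NN \<alpha> a b) *v (c - half_diag a b)
       - (wedge b a / 2) *\<^sub>R row_prods (NN \<alpha> a b)
     = (wedge b a / real r) *\<^sub>R rvec p"

definition CC :: "real \<Rightarrow> nat \<Rightarrow> real^2 \<Rightarrow> real^2 \<Rightarrow> (real^2) set" where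
  "CC \<alpha> r a b = {c. \<exists>p. is_p \<alpha> r a b c p}"

definition pp :: "real \<Rightarrow> nat \<Rightarrow> real^2 \<Rightarrow> real^2 \<Rightarrow> real^2 \<Rightarrow> int^2" where
  "pp \<alpha> r a b c = (THE p. is_p \<alpha> r a b c p)"


section \<open>The spaces of parameters\<close>

definition TT :: "real \<Rightarrow> nat \<Rightarrow> ((real^2) \<times> (real^2) \<times> (real^2)) set" where
  "TT \<alpha> r = {(a, b, c). (a, b) \<in> compatible_pairs \<alpha> \<and> c \<in> CC \<alpha> r a b}"

text \<open>The coarsest topology making several maps continuous is the pullback of the product
  topology along the tuple of these maps. The discrete topology on all integer matrices induces
  the discrete topology on \<open>SL(2, \<int>)\<close>.\<close>

definition TT_topology :: "real \<Rightarrow> nat \<Rightarrow> ((real^2) \<times> (real^2) \<times> (real^2)) topology" where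
  "TT_topology \<alpha> r =
     pullback_topology (TT \<alpha> r) (\<lambda>(a, b, c). (NN \<alpha> a b, pp \<alpha> r a b c, (a, b)))
       (prod_topology (discrete_topology UNIV) (prod_topology (discrete_topology UNIV) euclidean))"

definition AA_topology :: "real \<Rightarrow> nat \<Rightarrow> (((real^2) \<times> (real^2) \<times> (real^2)) \<times> complex) topology" where
  "AA_topology \<alpha> r = prod_topology (TT_topology \<alpha> r) euclidean"

definition c_class :: "nat \<Rightarrow> real^2 \<Rightarrow> real^2 \<Rightarrow> real^2 \<Rightarrow> (real^2) set" where
  "c_class r a b c = {c + (wedge b a / real r) *\<^sub>R rvec m | m. True}"

definition t_class :: "nat \<Rightarrow> real^2 \<Rightarrow> real^2 \<Rightarrow> complex \<Rightarrow> complex set" where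
  "t_class r a b t = {t + of_real (wedge b a / real r) * of_int n | n. True}"

type_synonym point = "(real^2) \<times> (real^2) \<times> (real^2) set \<times> complex set"

definition point_of :: "nat \<Rightarrow> ((real^2) \<times> (real^2) \<times> (real^2)) \<times> complex \<Rightarrow> point" where
  "point_of r = (\<lambda>((a, b, c), t). (a, b, c_class r a b c, t_class r a b t))"

definition scriptC :: "real \<Rightarrow> nat \<Rightarrow> real^2 \<Rightarrow> real^2 \<Rightarrow> (real^2) set set" where
  "scriptC \<alpha> r a b = c_class r a b ` CC \<alpha> r a b"

definition scriptA_topology :: "real \<Rightarrow> nat \<Rightarrow> point topology" where
  "scriptA_topology \<alpha> r = quotient_topology (AA_topology \<alpha> r) (point_of r)"


section \<open>The group and its actions\<close>

text \<open>The actions are given by formulas on representatives that induce well-defined maps on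
  classes: the image of a class under such a formula is a singleton, and \<open>the_elem\<close> extracts its
  element.\<close>

definition GL2Z :: "(int^2^2) set" where
  "GL2Z = {K. invertible K}"

definition act_GL :: "nat \<Rightarrow> int^2^2 \<Rightarrow> point \<Rightarrow> point" where
  "act_GL r K = (\<lambda>(a, b, X, T). the_elem ((\<lambda>(c, t).
     let A = rmat K *v a; B = rmat K *v b;
         C = half_diag A B + rmat K *v (c - half_diag a b) + (wedge b a / 2) *\<^sub>R row_prods K
     in point_of r ((A, B, C), t)) ` (X \<times> T)))"

definition act_Z2_c :: "real \<Rightarrow> real^2 \<Rightarrow> real^2 \<Rightarrow> int^2 \<Rightarrow> real^2 \<Rightarrow> real^2" where
  "act_Z2_c \<alpha> a b k c =
     c - (\<alpha> * (rvec k \<bullet> a) / (\<alpha> - 1)) *\<^sub>R b - ((rvec k \<bullet> b) / (\<alpha> - 1)) *\<^sub>R a"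

definition act_Z2_t :: "real \<Rightarrow> real^2 \<Rightarrow> real^2 \<Rightarrow> int^2 \<Rightarrow> real^2 \<Rightarrow> complex \<Rightarrow> complex" where
  "act_Z2_t \<alpha> a b k c t =
     (let k1 = real_of_int (k $ 1); k2 = real_of_int (k $ 2) in
      t + of_real (\<alpha> * (rvec k \<bullet> a) * (rvec k \<bullet> b) / (1 - \<alpha>) + rvec k \<bullet> c
        + (k1 * (k1 - 1) * a $ 1 * b $ 1 + k2 * (k2 - 1) * a $ 2 * b $ 2) / 2
        + k1 * k2 * b $ 1 * a $ 2))"

definition act_Z2 :: "real \<Rightarrow> nat \<Rightarrow> int^2 \<Rightarrow> point \<Rightarrow> point" where
  "act_Z2 \<alpha> r k = (\<lambda>(a, b, X, T). the_elem ((\<lambda>(c, t).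
     point_of r ((a, b, act_Z2_c \<alpha> a b k c), act_Z2_t \<alpha> a b k c t)) ` (X \<times> T)))"

definition Zd_class :: "real \<Rightarrow> int^2 \<Rightarrow> (int^2) set" where
  "Zd_class \<alpha> k = {k + dd \<alpha> *s m | m. True}"

definition act_Zd :: "real \<Rightarrow> nat \<Rightarrow> (int^2) set \<Rightarrow> point \<Rightarrow> point" where
  "act_Zd \<alpha> r \<kappa> x = the_elem ((\<lambda>k. act_Z2 \<alpha> r k x) ` \<kappa>)"

definition act_scale :: "nat \<Rightarrow> real \<times> real \<Rightarrow> point \<Rightarrow> point" where
  "act_scale r = (\<lambda>(\<mu>, \<rho>) (a, b, X, T). the_elem ((\<lambda>(c, t).
     point_of r ((\<mu> *\<^sub>R a, \<rho> *\<^sub>R b, (\<mu> * \<rho>) *\<^sub>R c), of_real (\<mu> * \<rho>) * t)) ` (X \<times> T)))"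

definition semidirect_GL_Zd :: "real \<Rightarrow> ((int^2^2) \<times> (int^2) set) monoid" where
  "semidirect_GL_Zd \<alpha> =
     \<lparr>carrier = GL2Z \<times> range (Zd_class \<alpha>),
      mult = (\<lambda>(K, \<kappa>) (K', \<kappa>').
        (K ** K', the_elem ((\<lambda>(k, k'). Zd_class \<alpha> (k v* K' + k')) ` (\<kappa> \<times> \<kappa>')))),
      one = (mat 1, Zd_class \<alpha> 0)\<rparr>"

type_synonym calG_elem = "(real \<times> real) \<times> (int^2^2) \<times> (int^2) set"

definition calG :: "real \<Rightarrow> calG_elem monoid" where
  "calG \<alpha> =
     (\<lparr>carrier = {0<..}, mult = (*), one = 1\<rparr> \<times>\<times> \<lparr>carrier = UNIV - {0}, mult = (*), one = 1\<rparr>)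
     \<times>\<times> semidirect_GL_Zd \<alpha>"

definition calG_act :: "real \<Rightarrow> nat \<Rightarrow> calG_elem \<Rightarrow> point \<Rightarrow> point" where
  "calG_act \<alpha> r = (\<lambda>(s, K, \<kappa>) x. act_GL r K (act_Zd \<alpha> r \<kappa> (act_scale r s x)))"

definition pair_act :: "calG_elem \<Rightarrow> (real^2) \<times> (real^2) \<Rightarrow> (real^2) \<times> (real^2)" where
  "pair_act = (\<lambda>((\<mu>, \<rho>), K, \<kappa>) (a, b). (\<mu> *\<^sub>R (rmat K *v a), \<rho> *\<^sub>R (rmat K *v b)))"


section \<open>The orbit space, the projection to classes of pairs and its fibres\<close>

definition scriptQ_topology :: "real \<Rightarrow> nat \<Rightarrow> point set topology" where
  "scriptQ_topology \<alpha> r =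
     quotient_topology (scriptA_topology \<alpha> r) (orbit (calG \<alpha>) (calG_act \<alpha> r))"

definition Phi :: "real \<Rightarrow> point set \<Rightarrow> ((real^2) \<times> (real^2)) set" where
  "Phi \<alpha> \<omega> = the_elem ((\<lambda>(a, b, X, T). orbit (calG \<alpha>) pair_act (a, b)) ` \<omega>)"

definition Phi_fibre :: "real \<Rightarrow> nat \<Rightarrow> real^2 \<Rightarrow> real^2 \<Rightarrow> point set set" where
  "Phi_fibre \<alpha> r a b =
     {\<omega> \<in> topspace (scriptQ_topology \<alpha> r). Phi \<alpha> \<omega> = orbit (calG \<alpha>) pair_act (a, b)}"

definition stab_pair :: "real \<Rightarrow> real^2 \<Rightarrow> real^2 \<Rightarrow> calG_elem monoid" where
  "stab_pair \<alpha> a b = (calG \<alpha>)\<lparr>carrier := stabilizer (calG \<alpha>) pair_act (a, b)\<rparr>"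

definition c_act :: "real \<Rightarrow> nat \<Rightarrow> real^2 \<Rightarrow> real^2 \<Rightarrow> calG_elem \<Rightarrow> (real^2) set \<Rightarrow> (real^2) set" where
  "c_act \<alpha> r a b g X =
     the_elem ((\<lambda>t. fst (snd (snd (calG_act \<alpha> r g (a, b, X, t_class r a b t))))) ` UNIV)"

definition t_act ::
    "real \<Rightarrow> nat \<Rightarrow> real^2 \<Rightarrow> real^2 \<Rightarrow> (real^2) set \<Rightarrow> calG_elem \<Rightarrow> complex set \<Rightarrow> complex set" where
  "t_act \<alpha> r a b X g T = snd (snd (snd (calG_act \<alpha> r g (a, b, X, T))))"

definition stab_c :: "real \<Rightarrow> nat \<Rightarrow> real^2 \<Rightarrow> real^2 \<Rightarrow> (real^2) set \<Rightarrow> calG_elem monoid" where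
  "stab_c \<alpha> r a b X =
     (stab_pair \<alpha> a b)\<lparr>carrier := stabilizer (stab_pair \<alpha> a b) (c_act \<alpha> r a b) X\<rparr>"

definition c_orbit :: "real \<Rightarrow> nat \<Rightarrow> real^2 \<Rightarrow> real^2 \<Rightarrow> (real^2) set \<Rightarrow> (real^2) set set" where
  "c_orbit \<alpha> r a b X = orbit (stab_pair \<alpha> a b) (c_act \<alpha> r a b) X"

definition c_orbits :: "real \<Rightarrow> nat \<Rightarrow> real^2 \<Rightarrow> real^2 \<Rightarrow> (real^2) set set set" where
  "c_orbits \<alpha> r a b = orbits (stab_pair \<alpha> a b) (scriptC \<alpha> r a b) (c_act \<alpha> r a b)"

definition component :: "real \<Rightarrow> nat \<Rightarrow> real^2 \<Rightarrow> real^2 \<Rightarrow> (real^2) set set \<Rightarrow> point set set" where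
  "component \<alpha> r a b \<O> =
     {orbit (calG \<alpha>) (calG_act \<alpha> r) (a, b, X, t_class r a b t) | X t. X \<in> \<O>}"

definition cylinder :: "nat \<Rightarrow> real^2 \<Rightarrow> real^2 \<Rightarrow> complex set surface" where
  "cylinder r a b = quotient_surface (plane_surface UNIV) (t_class r a b)"

text \<open>\<open>component_surface \<alpha> r a b X\<close> is the component associated with the orbit of \<open>X\<close>, with the
  subspace topology of the orbit space and the complex structure of the quotient of the cylinder by
  the stabiliser of \<open>X\<close>.\<close>

definition component_surface ::
    "real \<Rightarrow> nat \<Rightarrow> real^2 \<Rightarrow> real^2 \<Rightarrow> (real^2) set \<Rightarrow> point set surface" where
  "component_surface \<alpha> r a b X =
     transport_surface
       (quotient_surface (cylinder r a b) (orbit (stab_c \<alpha> r a b X) (t_act \<alpha> r a b X)))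
       (\<lambda>\<tau>. the_elem ((\<lambda>T. orbit (calG \<alpha>) (calG_act \<alpha> r) (a, b, X, T)) ` \<tau>))
       (subtopology (scriptQ_topology \<alpha> r) (component \<alpha> r a b (c_orbit \<alpha> r a b X)))"

definition pos_centraliser :: "int^2^2 \<Rightarrow> real^2 \<Rightarrow> (int^2^2) set" where
  "pos_centraliser N a =
     {K \<in> GL2Z. K ** N = N ** K \<and> (\<exists>\<mu>>0. rmat K *v a = \<mu> *\<^sub>R a)}"

end

theory Submission
  imports Defs
begin

text \<open>An element of the stabiliser of \<open>(a, b)\<close> acts on the coordinate \<open>s = t / (b \<and> a)\<close> by
  \<open>s \<mapsto> (det K) s + u\<close> with \<open>u\<close> real, and \<open>u\<close> lies in the discrete group generated by \<open>1 / (2 r d)\<close>.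
  So the translations among the elements that fix \<open>[c]\<close> form a lattice \<open>l \<int>\<close>, and a component is
  uniformised by \<open>exp (2 \<pi> i s / l)\<close> if there are no others and by \<open>cos (2 \<pi> (s - u\<^sub>0 / 2) / l)\<close> if some
  element acts by \<open>s \<mapsto> u\<^sub>0 - s\<close>. The latter means that some \<open>L\<close> of determinant \<open>-1\<close> and some \<open>k\<close> fix
  \<open>[c]\<close>. Translating \<open>[c]\<close> changes \<open>p\<close> by \<open>(1 - N) \<int>\<^sup>2\<close>, acting by \<open>k\<close> changes it by \<open>r \<int>\<^sup>2\<close>, and \<open>L\<close>
  sends it to \<open>(det L) L p\<close> modulo \<open>r\<close>, which is the stated criterion. For the topology, an orbit
  determines \<open>(a, b)\<close> up to scaling once \<open>N\<close> is fixed, so the map from \<open>\<complex>\<close> to the orbit space given by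
  \<open>s\<close> is open and the components are exactly its images.\<close>

text \<open>The constant \<open>2 r d\<close> has three sources: \<open>s\<close> is taken modulo
  \<open>1 / r\<close>, halves come from \<open>row_prods\<close> and \<open>shift_t\<close>, and
  \<open>d\<close> comes from solving for \<open>e\<close> with \<open>1 - N\<close>, whose
  determinant is \<open>2 - trace N = - d\<close>. By definition a component gets its structure in
  two quotient steps, cylinder and then stabiliser, followed by a transport to the orbit space,
  whereas the answer is read off from one entire function of \<open>s\<close>. The obstacle is that
  a reflection \<open>s \<mapsto> u - s\<close> has a fixed point, near which the projection is not
  injective and local sections do not exist; holomorphy at the image of such a point is recovered
  from continuity, by removing an isolated singularity. For openness the discrete value of
  \<open>p\<close> matters as much as that of \<open>N\<close>: together they determine
  \<open>e\<close>, so that near a given point only the scalings and \<open>s\<close> can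
  vary.\<close>

no_notation fps_nth (infixl \<open>$\<close> 75)

section \<open>Integer matrices of size two\<close>

lemma vec2_eq_iff: "x = (y :: 'a^2) \<longleftrightarrow> x $ 1 = y $ 1 \<and> x $ 2 = y $ 2"
  by (simp add: vec_eq_iff forall_2)

lemma mat_vec_nth2: "(M *v x) $ i = M $ i $ 1 * x $ 1 + M $ i $ 2 * x $ 2"
  for M :: "'a::semiring_1^2^2"
  by (simp add: matrix_vector_mult_def sum_2)

lemma vec_mat_nth2: "(x v* M) $ i = M $ 1 $ i * x $ 1 + M $ 2 $ i * x $ 2"
  for M :: "'a::comm_semiring_1^2^2"
  by (simp add: vector_matrix_mult_def sum_2 mult.commute)

lemma mat_mat_nth2: "(M ** L) $ i $ j = M $ i $ 1 * L $ 1 $ j + M $ i $ 2 * L $ 2 $ j"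
  for M :: "'a::semiring_1^2^2"
  by (simp add: matrix_matrix_mult_def sum_2)

lemma inner2: "x \<bullet> y = x $ 1 * y $ 1 + x $ 2 * y $ 2" for x y :: "real^2"
  by (simp add: inner_vec_def sum_2)

lemma mat_nth2: "(mat c :: 'a::zero^2^2) $ 1 $ 1 = c" "(mat c :: 'a::zero^2^2) $ 2 $ 2 = c"
   "(mat c :: 'a::zero^2^2) $ 1 $ 2 = 0" "(mat c :: 'a::zero^2^2) $ 2 $ 1 = 0"
  by (simp_all add: mat_def)

lemmas coords2 = vec2_eq_iff mat_vec_nth2 vec_mat_nth2 mat_mat_nth2 inner2 mat_nth2 det_2 wedge_def
  half_diag_def row_prods_def

lemma rmat_mult: "rmat (K ** L) = rmat K ** rmat L"
  by (simp add: coords2)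

lemma rmat_mat1 [simp]: "rmat (mat 1) = mat 1"
  by (simp add: coords2)

lemma rmat_diff: "rmat (K - L) = rmat K - rmat L"
  by (simp add: coords2)

lemma det_rmat: "det (rmat K) = of_int (det K)" for K :: "int^2^2"
  by (simp add: det_2)

lemma rvec_vec_mat: "rvec (k v* K) \<bullet> x = rvec k \<bullet> (rmat K *v x)"
  by (simp add: coords2 algebra_simps)

lemma wedge_rmat: "wedge (rmat K *v a) (rmat K *v b) = of_int (det K) * wedge a b"
  by (simp add: coords2 algebra_simps)

lemma GL2Z_det: assumes "K \<in> GL2Z" shows "det K = 1 \<or> det K = -1"
proof -
  from assms obtain L where "K ** L = mat 1"
    by (auto simp: GL2Z_def invertible_def)
  then have "det K * det L = 1"
    by (metis det_I det_mul)
  then show ?thesis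
    by (simp add: zmult_eq_1_iff) blast
qed

text \<open>Squares are replaced by first powers modulo 2. The quotient \<open>u\<close> is named
  because such congruences are later used as equations between reals.\<close>

lemma even_prod_pred:
  fixes x :: int
  obtains u where "x * x = x + 2 * u"
proof -
  have "even (x * x - x)" by simp
  then obtain u where "x * x - x = 2 * u" ..
  then show ?thesis by (intro that[of u]) simp
qed

text \<open>The quadratic form \<open>k\<^sub>1 k\<^sub>2\<close> is additive modulo 2 up to the wedge product.\<close>

lemma row_prods_parity:
  fixes k :: "int^2" and M :: "int^2^2"
  obtains u :: int where
    "real_of_int ((k v* M) $ 1 * (k v* M) $ 2) =
       rvec k \<bullet> row_prods M + of_int (det M * (k $ 1 * k $ 2)) + 2 * of_int u"
proof -
  obtain u1 where u1: "k$1 * k$1 = k$1 + 2 * u1" by (rule even_prod_pred)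
  obtain u2 where u2: "k$2 * k$2 = k$2 + 2 * u2" by (rule even_prod_pred)
  have "(k v* M) $ 1 * (k v* M) $ 2 = (k$1 * k$1) * (M$1$1 * M$1$2) + (k$2 * k$2) * (M$2$1 * M$2$2)
     + k$1 * k$2 * (M$1$1 * M$2$2 + M$1$2 * M$2$1)"
    by (simp add: coords2 algebra_simps)
  also have "\<dots> = (k$1 * (M$1$1 * M$1$2) + k$2 * (M$2$1 * M$2$2)) + det M * (k$1 * k$2)
     + 2 * (u1 * (M$1$1 * M$1$2) + u2 * (M$2$1 * M$2$2) + k$1 * k$2 * (M$1$2 * M$2$1))"
    unfolding u1 u2 by (simp add: det_2 algebra_simps)
  finally show ?thesis
    by (intro that[of "u1 * (M$1$1 * M$1$2) + u2 * (M$2$1 * M$2$2) + k$1 * k$2 * (M$1$2 * M$2$1)"])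
       (simp add: coords2)
qed

text \<open>This is the parity statement row by row, since a row of \<open>K ** M\<close> is the row
  of \<open>K\<close> times \<open>M\<close>. Half of \<open>row_prods\<close> is thus a twisted
  cocycle modulo integer vectors, which makes the action on \<open>e\<close> compose correctly
  modulo \<open>1 / r\<close>.\<close>

lemma row_prods_mult:
  fixes K M :: "int^2^2"
  obtains w :: "int^2" where
    "row_prods (K ** M) = rmat K *v row_prods M + of_int (det M) *\<^sub>R row_prods K + 2 *\<^sub>R rvec w"
proof -
  obtain u1 where u1: "real_of_int ((K$1 v* M) $ 1 * (K$1 v* M) $ 2) =
       rvec (K$1) \<bullet> row_prods M + of_int (det M * (K$1 $ 1 * K$1 $ 2)) + 2 * of_int u1"
    by (rule row_prods_parity)
  obtain u2 where u2: "real_of_int ((K$2 v* M) $ 1 * (K$2 v* M) $ 2) =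
       rvec (K$2) \<bullet> row_prods M + of_int (det M * (K$2 $ 1 * K$2 $ 2)) + 2 * of_int u2"
    by (rule row_prods_parity)
  show ?thesis
    using u1 u2 by (intro that[of "vector [u1, u2]"]) (simp add: coords2 algebra_simps)
qed

section \<open>Compatible pairs\<close>

text \<open>\<open>\<alpha>\<close> is the larger root of \<open>x\<^sup>2 - \<theta> x + 1\<close>,
  so \<open>\<theta>\<close> can be recovered as \<open>\<alpha> + inverse \<alpha>\<close>; this
  gives the definite description in \<open>theta\<close> its meaning.\<close>

lemma S_plus_admissible_facts:
  assumes "S_plus_admissible \<alpha>"
  shows "\<alpha> > 1" "\<alpha> + inverse \<alpha> = real_of_int (theta \<alpha>)" "theta \<alpha> \<ge> 3"
proof -
  have *: "\<alpha> > 1 \<and> \<alpha> + inverse \<alpha> = real_of_int \<theta>"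
    if "\<theta> \<ge> 3" "\<alpha> = (real_of_int \<theta> + sqrt ((real_of_int \<theta>)\<^sup>2 - 4)) / 2" for \<theta>
  proof -
    have "real_of_int \<theta> \<ge> 3" using that by simp
    then have pos: "(real_of_int \<theta>)\<^sup>2 - 4 > 0"
      using power_mono[of 3 "real_of_int \<theta>" 2] by simp
    have "2 * \<alpha> > 3 + 0"
      unfolding that(2) using add_le_less_mono[OF \<open>real_of_int \<theta> \<ge> 3\<close> real_sqrt_gt_zero[OF pos]]
      by simp
    then have gt: "\<alpha> > 1" by simp
    have "2 * \<alpha> - \<theta> = sqrt ((real_of_int \<theta>)\<^sup>2 - 4)"
      unfolding that(2) by (simp add: field_simps)
    then have "(2 * \<alpha> - \<theta>)\<^sup>2 = (real_of_int \<theta>)\<^sup>2 - 4"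
      using pos by simp
    then have "\<alpha> * \<alpha> + 1 = \<theta> * \<alpha>"
      by (simp add: power2_eq_square algebra_simps)
    with gt show ?thesis by (simp add: field_simps)
  qed
  obtain \<theta> :: int where \<theta>: "\<theta> \<ge> 3" "\<alpha> = (real_of_int \<theta> + sqrt ((real_of_int \<theta>)\<^sup>2 - 4)) / 2"
    using assms by (auto simp: S_plus_admissible_def)
  have "theta \<alpha> = \<theta>"
    unfolding theta_def
  proof (rule the_equality)
    show "\<theta> \<ge> 3 \<and> \<alpha> = (real_of_int \<theta> + sqrt ((real_of_int \<theta>)\<^sup>2 - 4)) / 2"
      using \<theta> by blast
    show "\<theta>' = \<theta>" if "\<theta>' \<ge> 3 \<and> \<alpha> = (real_of_int \<theta>' + sqrt ((real_of_int \<theta>')\<^sup>2 - 4)) / 2" for \<theta>'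
      using *[of \<theta>] *[of \<theta>'] \<theta> that by linarith
  qed
  then show "\<alpha> > 1" "\<alpha> + inverse \<alpha> = real_of_int (theta \<alpha>)" "theta \<alpha> \<ge> 3"
    using *[OF \<theta>] \<theta>(1) by simp_all
qed

lemma wedge_commute: "wedge b a = - wedge a b"
  by (simp add: wedge_def)

lemma independent_wedge: "a \<noteq> b \<and> independent {a, b} \<longleftrightarrow> wedge a b \<noteq> 0"
proof -
  have "a \<in> range (\<lambda>k. k *\<^sub>R b) \<longleftrightarrow> wedge a b = 0" if "b \<noteq> 0"
  proof
    assume w: "wedge a b = 0"
    have "b \<bullet> b \<noteq> 0" using that by simp
    then have "a = ((a \<bullet> b) / (b \<bullet> b)) *\<^sub>R b"
      using w by (simp add: coords2 field_simps)
    then show "a \<in> range (\<lambda>k. k *\<^sub>R b)" by blast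
  qed (auto simp: wedge_def)
  moreover have "wedge a 0 = 0" "wedge b b = 0" by (simp_all add: wedge_def)
  ultimately show ?thesis
    by (auto simp: independent_insert span_singleton dependent_single)
qed

text \<open>Cramer's rule in the basis formed by \<open>a\<close> and \<open>b\<close>.\<close>

lemma wedge_basis:
  assumes "wedge a b \<noteq> 0"
  shows "x = (wedge x b / wedge a b) *\<^sub>R a + (wedge a x / wedge a b) *\<^sub>R b"
proof -
  have "wedge a b *\<^sub>R x = wedge x b *\<^sub>R a + wedge a x *\<^sub>R b"
    by (simp add: coords2 algebra_simps)
  then have "(1 / wedge a b) *\<^sub>R (wedge a b *\<^sub>R x) = (1 / wedge a b) *\<^sub>R (wedge x b *\<^sub>R a + wedge a x *\<^sub>R b)"
    by simp
  with assms show ?thesis by (simp add: scaleR_add_right)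
qed

lemma rmat_eqD: "rmat M = rmat M' \<Longrightarrow> M = M'"
  by (simp add: coords2)

text \<open>A conjugate of a diagonal matrix is characterised by its eigenvectors. Later arguments
  work with the eigenvector equations instead of \<open>Q\<close> and its inverse.\<close>

lemma eq_QDQ_iff:
  assumes "wedge a b \<noteq> 0"
  shows "M = QDQ \<alpha> a b \<longleftrightarrow> M *v a = \<alpha> *\<^sub>R a \<and> M *v b = inverse \<alpha> *\<^sub>R b"
proof -
  define Q where "Q = (transpose (vector [a, b]) :: real^2^2)"
  define D where "D = (vector [vector [\<alpha>, 0] :: real^2, vector [0, inverse \<alpha>]] :: real^2^2)"
  have "det Q = wedge a b"
    by (simp add: Q_def det_2 wedge_def transpose_def)
  then have "invertible Q" using assms by (simp add: invertible_det_nz)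
  then have "Q ** matrix_inv Q = mat 1 \<and> matrix_inv Q ** Q = mat 1"
    unfolding invertible_def matrix_inv_def by (rule someI_ex)
  then have inv: "Q ** matrix_inv Q = mat 1" "matrix_inv Q ** Q = mat 1"
    by blast+
  have "M = QDQ \<alpha> a b \<longleftrightarrow> M = Q ** D ** matrix_inv Q"
    by (simp add: QDQ_def Q_def D_def Let_def)
  also have "\<dots> \<longleftrightarrow> M ** Q = Q ** D"
    by (metis inv matrix_mul_assoc matrix_mul_rid)
  also have "\<dots> \<longleftrightarrow> M *v a = \<alpha> *\<^sub>R a \<and> M *v b = inverse \<alpha> *\<^sub>R b"
    by (auto simp: Q_def D_def coords2 transpose_def algebra_simps)
  finally show ?thesis .
qed

lemma compatible_pairs_iff:
  "(a, b) \<in> compatible_pairs \<alpha> \<longleftrightarrow>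
     wedge a b \<noteq> 0 \<and> (\<exists>M. rmat M *v a = \<alpha> *\<^sub>R a \<and> rmat M *v b = inverse \<alpha> *\<^sub>R b)"
  using independent_wedge[of a b] eq_QDQ_iff[of a b _ \<alpha>] by (auto simp: compatible_pairs_def)

lemma NN_eqI:
  assumes "wedge a b \<noteq> 0" "rmat M *v a = \<alpha> *\<^sub>R a" "rmat M *v b = inverse \<alpha> *\<^sub>R b"
  shows "NN \<alpha> a b = M"
proof -
  have "rmat M = QDQ \<alpha> a b" using assms by (simp add: eq_QDQ_iff)
  then show ?thesis unfolding NN_def by (metis (mono_tags, lifting) rmat_eqD the_equality)
qed

lemma compatible_NN:
  assumes "(a, b) \<in> compatible_pairs \<alpha>"
  shows "wedge a b \<noteq> 0" "wedge b a \<noteq> 0"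
    "rmat (NN \<alpha> a b) *v a = \<alpha> *\<^sub>R a" "rmat (NN \<alpha> a b) *v b = inverse \<alpha> *\<^sub>R b"
  using assms NN_eqI by (auto simp: compatible_pairs_iff wedge_commute[of b a])

text \<open>Both invariants are read off from the wedge product of the eigenvectors: the determinant
  from \<open>wedge (N a) (N b)\<close>, the trace from
  \<open>wedge (N a) b + wedge a (N b)\<close>.\<close>

lemma compatible_NN_det_trace:
  assumes "(a, b) \<in> compatible_pairs \<alpha>" and "S_plus_admissible \<alpha>"
  defines "N \<equiv> NN \<alpha> a b"
  shows "det N = 1" "N $ 1 $ 1 + N $ 2 $ 2 = theta \<alpha>"
proof -
  note N = compatible_NN[OF assms(1), folded N_def]
  have \<alpha>: "\<alpha> > 1" using assms(2) by (rule S_plus_admissible_facts)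
  have "of_int (det N) * wedge a b = wedge (\<alpha> *\<^sub>R a) (inverse \<alpha> *\<^sub>R b)"
    by (metis wedge_rmat N(3,4))
  also have "\<dots> = wedge a b" using \<alpha> by (simp add: wedge_def field_simps)
  finally have "real_of_int (det N) = 1" using N(1) by simp
  then show "det N = 1" by simp
  have "of_int (N $ 1 $ 1 + N $ 2 $ 2) * wedge a b
    = wedge (rmat N *v a) b + wedge a (rmat N *v b)"
    by (simp add: coords2 algebra_simps)
  also have "\<dots> = (\<alpha> + inverse \<alpha>) * wedge a b"
    unfolding N by (simp add: wedge_def algebra_simps)
  finally have "real_of_int (N $ 1 $ 1 + N $ 2 $ 2) = theta \<alpha>"
    using N(1) S_plus_admissible_facts(2)[OF assms(2)] by simp
  then show "N $ 1 $ 1 + N $ 2 $ 2 = theta \<alpha>" by linarith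
qed

text \<open>Conjugating \<open>N\<close> by \<open>K\<close> moves its eigenlines by
  \<open>K\<close> and keeps the eigenvalues, and rescaling does not change eigenlines. The second
  conclusion is an intertwining relation so that no inverse of \<open>K\<close> has to be
  named.\<close>

lemma compatible_pairs_act:
  assumes "(a, b) \<in> compatible_pairs \<alpha>" "K \<in> GL2Z" "\<mu> \<noteq> 0" "\<rho> \<noteq> 0"
  shows "(\<mu> *\<^sub>R (rmat K *v a), \<rho> *\<^sub>R (rmat K *v b)) \<in> compatible_pairs \<alpha>"
    and "NN \<alpha> (\<mu> *\<^sub>R (rmat K *v a)) (\<rho> *\<^sub>R (rmat K *v b)) ** K = K ** NN \<alpha> a b"
proof -
  let ?a = "\<mu> *\<^sub>R (rmat K *v a)" and ?b = "\<rho> *\<^sub>R (rmat K *v b)"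
  obtain L where L: "K ** L = mat 1" "L ** K = mat 1"
    using assms(2) by (auto simp: GL2Z_def invertible_def)
  have L': "rmat L ** rmat K = mat 1"
    by (metis L(2) rmat_mult rmat_mat1)
  note N = compatible_NN[OF assms(1)]
  have w: "wedge ?a ?b \<noteq> 0"
  proof -
    have "wedge ?a ?b = \<mu> * \<rho> * wedge (rmat K *v a) (rmat K *v b)"
      by (simp add: wedge_def algebra_simps)
    then show ?thesis using assms N GL2Z_det[OF assms(2)] by (auto simp: wedge_rmat)
  qed
  let ?M = "K ** NN \<alpha> a b ** L"
  have 1: "rmat ?M *v ?a = \<alpha> *\<^sub>R ?a" "rmat ?M *v ?b = inverse \<alpha> *\<^sub>R ?b"
  proof -
    have "rmat ?M *v (rmat K *v x) = rmat K *v (rmat (NN \<alpha> a b) *v x)" for x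
      by (metis (no_types, opaque_lifting) rmat_mult L' matrix_mul_assoc matrix_mul_rid matrix_vector_mul_assoc)
    then show "rmat ?M *v ?a = \<alpha> *\<^sub>R ?a" "rmat ?M *v ?b = inverse \<alpha> *\<^sub>R ?b"
      by (simp_all add: matrix_vector_mult_scaleR N)
  qed
  from w 1 show "(?a, ?b) \<in> compatible_pairs \<alpha>"
    unfolding compatible_pairs_iff by blast
  have "NN \<alpha> ?a ?b = ?M" using w 1 by (rule NN_eqI)
  then show "NN \<alpha> ?a ?b ** K = K ** NN \<alpha> a b"
    by (metis L(2) matrix_mul_assoc matrix_mul_rid)
qed

section \<open>The action in normalised coordinates\<close>

text \<open>With \<open>\<delta> = b \<and> a\<close>, points are written \<open>c = \<delta> e + half_diag a b\<close> and \<open>t = \<delta> s\<close>. In the coordinates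
  \<open>(e, s)\<close> scalings act trivially, \<open>K\<close> acts by \<open>e \<mapsto> det K (K e + row_prods K / 2)\<close>, \<open>s \<mapsto> (det K) s\<close>, and
  \<open>k\<close> acts by the translations \<open>shift\<close> and \<open>shift_t\<close>; both coordinates are taken modulo \<open>1 / r\<close>.\<close>

definition shift :: "real \<Rightarrow> real^2 \<Rightarrow> real^2 \<Rightarrow> int^2 \<Rightarrow> real^2" where
  "shift \<alpha> a b k =
     (1 / ((1 - \<alpha>) * wedge b a)) *\<^sub>R ((\<alpha> * (rvec k \<bullet> a)) *\<^sub>R b + (rvec k \<bullet> b) *\<^sub>R a)"

definition shift_t :: "real \<Rightarrow> real^2 \<Rightarrow> real^2 \<Rightarrow> int^2 \<Rightarrow> real^2 \<Rightarrow> real" where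
  "shift_t \<alpha> a b k e =
     (\<alpha> + 1) * (rvec k \<bullet> a) * (rvec k \<bullet> b) / 2 / ((1 - \<alpha>) * wedge b a)
     + rvec k \<bullet> e + of_int (k $ 1 * k $ 2) / 2"

text \<open>The image of \<open>CC\<close> in the coordinate \<open>e\<close>. Dividing the defining
  equation by \<open>wedge b a\<close> leaves a condition in which the pair enters only through
  \<open>N\<close>.\<close>

definition norm_C :: "nat \<Rightarrow> int^2^2 \<Rightarrow> (real^2) set" where
  "norm_C r N = {e. \<exists>p. rmat (mat 1 - N) *v e = (1 / 2) *\<^sub>R row_prods N + (1 / real r) *\<^sub>R rvec p}"

lemma rvec_add: "rvec (k + k') = rvec k + rvec k'"
  by (simp add: vec2_eq_iff)

lemma shift_add: "shift \<alpha> a b (k + k') = shift \<alpha> a b k + shift \<alpha> a b k'"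
  unfolding shift_def rvec_add inner_add_left by (simp add: algebra_simps add_divide_distrib)

lemma shift_0 [simp]: "shift \<alpha> a b 0 = 0"
  by (simp add: shift_def inner2)

lemma shift_t_0 [simp]: "shift_t \<alpha> a b 0 e = 0"
  by (simp add: shift_t_def inner2)

lemma wedge_scale: "wedge (\<rho> *\<^sub>R b) (\<mu> *\<^sub>R a) = \<mu> * \<rho> * wedge b a"
  by (simp add: wedge_def algebra_simps)

lemma shift_scale:
  assumes "\<mu> \<noteq> 0" "\<rho> \<noteq> 0"
  shows "shift \<alpha> (\<mu> *\<^sub>R a) (\<rho> *\<^sub>R b) k = shift \<alpha> a b k"
proof -
  have "shift \<alpha> (\<mu> *\<^sub>R a) (\<rho> *\<^sub>R b) k = (1 / ((1 - \<alpha>) * (\<mu> * \<rho> * wedge b a))) *\<^sub>R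
     (\<mu> * \<rho>) *\<^sub>R ((\<alpha> * (rvec k \<bullet> a)) *\<^sub>R b + (rvec k \<bullet> b) *\<^sub>R a)"
    unfolding shift_def wedge_scale by (simp add: algebra_simps)
  also have "\<dots> = shift \<alpha> a b k"
    using assms unfolding shift_def scaleR_scaleR by simp
  finally show ?thesis .
qed

lemma shift_t_scale:
  assumes "\<mu> \<noteq> 0" "\<rho> \<noteq> 0"
  shows "shift_t \<alpha> (\<mu> *\<^sub>R a) (\<rho> *\<^sub>R b) k e = shift_t \<alpha> a b k e"
  using assms by (simp add: shift_t_def wedge_scale)

lemma shift_GL:
  assumes "K \<in> GL2Z"
  shows "shift \<alpha> (rmat K *v a) (rmat K *v b) k
       = of_int (det K) *\<^sub>R (rmat K *v shift \<alpha> a b (k v* K))"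
  using GL2Z_det[OF assms]
  by (auto simp: shift_def wedge_rmat rvec_vec_mat matrix_vector_mult_scaleR
      matrix_vector_right_distrib scaleR_add_right)

text \<open>\<open>1 - N\<close> scales \<open>a\<close> by \<open>1 - \<alpha>\<close> and
  \<open>b\<close> by \<open>1 - inverse \<alpha>\<close>, and the factor \<open>\<alpha>\<close> in
  \<open>shift\<close> makes both coefficients multiples of \<open>1 - \<alpha>\<close>; what
  remains is Cramer's expansion of the rotated vector. Hence acting by \<open>k\<close> adds to
  \<open>p\<close> the multiple by \<open>r\<close> of an integer vector, and every integer vector
  occurs.\<close>

lemma shift_eq:
  assumes "\<alpha> > 1" "wedge a b \<noteq> 0" "rmat N *v a = \<alpha> *\<^sub>R a" "rmat N *v b = inverse \<alpha> *\<^sub>R b"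
  shows "rmat (mat 1 - N) *v shift \<alpha> a b k = rvec (vector [- k $ 2, k $ 1])"
proof -
  have w: "wedge b a \<noteq> 0" using assms(2) by (simp add: wedge_commute[of b a])
  have Na: "rmat (mat 1 - N) *v a = (1 - \<alpha>) *\<^sub>R a"
    by (simp add: rmat_diff matrix_vector_mult_diff_rdistrib assms algebra_simps)
  have Nb: "rmat (mat 1 - N) *v b = (1 - inverse \<alpha>) *\<^sub>R b"
    by (simp add: rmat_diff matrix_vector_mult_diff_rdistrib assms algebra_simps)
  have "rmat (mat 1 - N) *v shift \<alpha> a b k = (1 / ((1 - \<alpha>) * wedge b a)) *\<^sub>R
     ((\<alpha> * (rvec k \<bullet> a) * (1 - inverse \<alpha>)) *\<^sub>R b + ((rvec k \<bullet> b) * (1 - \<alpha>)) *\<^sub>R a)"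
    by (simp add: shift_def matrix_vector_mult_scaleR matrix_vector_right_distrib Na Nb)
  also have "\<alpha> * (rvec k \<bullet> a) * (1 - inverse \<alpha>) = (1 - \<alpha>) * (- (rvec k \<bullet> a))"
    using assms(1) by (simp add: field_simps)
  also have "((1 - \<alpha>) * (- (rvec k \<bullet> a))) *\<^sub>R b + ((rvec k \<bullet> b) * (1 - \<alpha>)) *\<^sub>R a
     = ((1 - \<alpha>) * wedge b a) *\<^sub>R rvec (vector [- k $ 2, k $ 1])"
    by (simp add: coords2 algebra_simps)
  finally show ?thesis using w assms(1) by simp
qed

text \<open>The cross term of the quadratic part is symmetric in \<open>k\<close> and
  \<open>k'\<close>, while the one produced by moving \<open>e\<close> is not. Their difference is
  half of the determinant with rows \<open>k\<close> and \<open>k'\<close>, up to sign, and the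
  halves of \<open>k $ 1 * k $ 2\<close> complete it to an integer.\<close>

lemma shift_t_add:
  assumes "\<alpha> > 1" "wedge b a \<noteq> 0"
  shows "shift_t \<alpha> a b k' e + shift_t \<alpha> a b k (e + shift \<alpha> a b k')
    = shift_t \<alpha> a b (k + k') e - of_int (k $ 1 * k' $ 2)"
proof -
  define u v u' v' where uv: "u = rvec k \<bullet> a" "v = rvec k \<bullet> b" "u' = rvec k' \<bullet> a" "v' = rvec k' \<bullet> b"
  have sh: "rvec k \<bullet> shift \<alpha> a b k' = (\<alpha> * u' * v + v' * u) / ((1 - \<alpha>) * wedge b a)"
    by (simp add: shift_def inner_add_right uv add_divide_distrib mult.commute mult.left_commute)
  have w: "u * v' - u' * v = - of_int (k $ 1 * k' $ 2 - k $ 2 * k' $ 1) * wedge b a"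
    by (simp add: uv coords2 algebra_simps)
  define D where "D = (1 - \<alpha>) * wedge b a"
  have "(shift_t \<alpha> a b k' e + shift_t \<alpha> a b k (e + shift \<alpha> a b k') - shift_t \<alpha> a b (k + k') e)
     = ((\<alpha> + 1) * (u' * v' + u * v - (u + u') * (v + v')) / 2 + \<alpha> * u' * v + v' * u) / D
       - of_int (k $ 1 * k' $ 2 + k $ 2 * k' $ 1) / 2"
    unfolding shift_t_def inner_add_right sh rvec_add inner_add_left uv[symmetric] D_def[symmetric]
    by (simp add: add_divide_distrib diff_divide_distrib algebra_simps)
  also have "(\<alpha> + 1) * (u' * v' + u * v - (u + u') * (v + v')) / 2 + \<alpha> * u' * v + v' * u
     = (1 - \<alpha>) * (u * v' - u' * v) / 2"
    by (simp add: field_simps)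
  also have "\<dots> / D = - of_int (k $ 1 * k' $ 2 - k $ 2 * k' $ 1) / 2"
    unfolding w D_def using assms by simp
  finally show ?thesis by (simp add: field_simps)
qed

text \<open>The half of \<open>row_prods K\<close> added to \<open>e\<close> compensates the parity
  defect of the form \<open>k $ 1 * k $ 2\<close> under \<open>k \<mapsto> k v* K\<close>, so that
  only an integer is left over.\<close>

lemma shift_t_GL:
  assumes "K \<in> GL2Z"
  obtains n :: int where
    "shift_t \<alpha> (rmat K *v a) (rmat K *v b) k
        (of_int (det K) *\<^sub>R (rmat K *v e + (1 / 2) *\<^sub>R row_prods K))
     = of_int (det K) * shift_t \<alpha> a b (k v* K) e + of_int n"
proof -
  obtain u where u: "real_of_int ((k v* K) $ 1 * (k v* K) $ 2) =
       rvec k \<bullet> row_prods K + of_int (det K * (k $ 1 * k $ 2)) + 2 * of_int u"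
    by (rule row_prods_parity)
  have "shift_t \<alpha> (rmat K *v a) (rmat K *v b) k
        (of_int (det K) *\<^sub>R (rmat K *v e + (1 / 2) *\<^sub>R row_prods K))
     = of_int (det K) * shift_t \<alpha> a b (k v* K) e + of_int (- det K * u)"
  proof -
    define F where "F = (\<alpha> + 1) * (rvec (k v* K) \<bullet> a) * (rvec (k v* K) \<bullet> b) / 2 / ((1 - \<alpha>) * wedge b a)"
    have F: "(\<alpha> + 1) * (rvec k \<bullet> (rmat K *v a)) * (rvec k \<bullet> (rmat K *v b)) / 2
        / ((1 - \<alpha>) * wedge (rmat K *v b) (rmat K *v a)) = of_int (det K) * F"
      unfolding F_def wedge_rmat rvec_vec_mat using GL2Z_det[OF assms] by auto
    show ?thesis
      unfolding shift_t_def F F_def[symmetric]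
      unfolding u rvec_vec_mat inner_add_right inner_scaleR_right
      using GL2Z_det[OF assms] by (auto simp: field_simps)
  qed
  then show ?thesis by (rule that)
qed

text \<open>The multiples of \<open>d\<close> act trivially because \<open>d k = (k (1 - N\<^sup>-\<^sup>1)) (N - 1)\<close>.\<close>

lemma shift_trivial:
  assumes "\<alpha> > 1" "wedge a b \<noteq> 0" "rmat N *v a = \<alpha> *\<^sub>R a" "rmat N *v b = inverse \<alpha> *\<^sub>R b"
    and "det N = 1" "k = m v* (N - mat 1)"
  shows "shift \<alpha> a b k = rvec (vector [- (m v* N) $ 2, (m v* N) $ 1])"
    and "e \<in> norm_C r N \<Longrightarrow> r \<ge> 1 \<Longrightarrow> \<exists>n. shift_t \<alpha> a b k e = of_int n / real r"
proof -
  define v where "v = m v* N"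
  have w: "wedge b a \<noteq> 0" using assms(2) by (simp add: wedge_commute[of b a])
  have va: "rvec v \<bullet> x = rvec m \<bullet> (rmat N *v x)" for x
    by (simp add: v_def rvec_vec_mat)
  have k: "rvec k \<bullet> x = rvec v \<bullet> x - rvec m \<bullet> x" for x
    by (simp add: v_def assms(6) coords2 algebra_simps)
  have ka: "rvec k \<bullet> a = (\<alpha> - 1) * (rvec m \<bullet> a)" and kb: "rvec k \<bullet> b = (inverse \<alpha> - 1) * (rvec m \<bullet> b)"
    unfolding k va assms(3,4) by (simp_all add: algebra_simps)
  have ma: "\<alpha> * (rvec m \<bullet> a) = rvec v \<bullet> a" and mb: "inverse \<alpha> * (rvec m \<bullet> b) = rvec v \<bullet> b"
    by (simp_all add: va assms)
  have c: "\<alpha> * (rvec k \<bullet> a) = (1 - \<alpha>) * (- (rvec v \<bullet> a))"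
    unfolding ka ma[symmetric] by (simp add: algebra_simps)
  have d: "rvec k \<bullet> b = (1 - \<alpha>) * (rvec v \<bullet> b)"
    unfolding kb mb[symmetric] using assms(1) by (simp add: field_simps)
  have "shift \<alpha> a b k = (1 / ((1 - \<alpha>) * wedge b a)) *\<^sub>R (1 - \<alpha>) *\<^sub>R ((- (rvec v \<bullet> a)) *\<^sub>R b + (rvec v \<bullet> b) *\<^sub>R a)"
    unfolding shift_def c d by (simp add: algebra_simps)
  also have "(- (rvec v \<bullet> a)) *\<^sub>R b + (rvec v \<bullet> b) *\<^sub>R a = wedge b a *\<^sub>R rvec (vector [- v $ 2, v $ 1])"
    by (simp add: coords2 algebra_simps)
  finally show "shift \<alpha> a b k = rvec (vector [- (m v* N) $ 2, (m v* N) $ 1])"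
    using w assms(1) by (simp add: v_def)
  assume "e \<in> norm_C r N" "r \<ge> 1"
  then obtain p where p: "rmat (mat 1 - N) *v e = (1 / 2) *\<^sub>R row_prods N + (1 / real r) *\<^sub>R rvec p"
    by (auto simp: norm_C_def)
  have ke: "rvec k \<bullet> e = - (rvec m \<bullet> row_prods N / 2 + rvec m \<bullet> rvec p / real r)"
  proof -
    have "rvec k \<bullet> e = - (rvec m \<bullet> (rmat (mat 1 - N) *v e))"
      by (simp add: assms(6) coords2 algebra_simps)
    also have "\<dots> = - (rvec m \<bullet> row_prods N / 2 + rvec m \<bullet> rvec p / real r)"
      unfolding p by (simp add: inner_add_right)
    finally show ?thesis .
  qed
  have vm: "(\<alpha> + 1) * (rvec k \<bullet> a) * (rvec k \<bullet> b) / 2 / ((1 - \<alpha>) * wedge b a)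
      = of_int (m $ 1 * v $ 2 - m $ 2 * v $ 1) / 2"
  proof -
    have "(\<alpha> + 1) * (rvec k \<bullet> a) * (rvec k \<bullet> b)
       = (1 - \<alpha>) * ((\<alpha> - inverse \<alpha>) * (rvec m \<bullet> a) * (rvec m \<bullet> b))"
      unfolding ka kb using assms(1) by (simp add: field_simps)
    also have "(\<alpha> - inverse \<alpha>) * (rvec m \<bullet> a) * (rvec m \<bullet> b)
       = (rvec v \<bullet> a) * (rvec m \<bullet> b) - (rvec m \<bullet> a) * (rvec v \<bullet> b)"
      unfolding ma[symmetric] mb[symmetric] by (simp add: algebra_simps)
    also have "\<dots> = of_int (m $ 1 * v $ 2 - m $ 2 * v $ 1) * wedge b a"
      by (simp add: coords2 algebra_simps)
    finally show ?thesis using w assms(1) by simp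
  qed
  \<comment> \<open>Here \<open>k = v - m\<close>. The parity of \<open>v $ 1 * v $ 2\<close>
    produces half of \<open>rvec m \<bullet> row_prods N\<close>, which the equation of
    \<open>e\<close> contributes with the opposite sign. All halves cancel, leaving an integer and a
    multiple of \<open>1 / r\<close>.\<close>
  obtain u where u: "real_of_int (v $ 1 * v $ 2) = rvec m \<bullet> row_prods N + of_int (m $ 1 * m $ 2) + 2 * of_int u"
    using row_prods_parity[of m N] unfolding v_def assms(5) by auto
  have k1: "k $ 1 * k $ 2 = v $ 1 * v $ 2 + m $ 1 * m $ 2 - m $ 1 * v $ 2 - m $ 2 * v $ 1"
    by (simp add: assms(6) v_def coords2 algebra_simps)
  have "shift_t \<alpha> a b k e = of_int (m $ 1 * m $ 2 + u - m $ 2 * v $ 1) - rvec m \<bullet> rvec p / real r"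
    unfolding shift_t_def ke vm k1 of_int_diff of_int_add u by (simp add: field_simps)
  also have "rvec m \<bullet> rvec p = of_int (m $ 1 * p $ 1 + m $ 2 * p $ 2)"
    by (simp add: inner2)
  finally have "shift_t \<alpha> a b k e = of_int (int r * (m $ 1 * m $ 2 + u - m $ 2 * v $ 1) - (m $ 1 * p $ 1 + m $ 2 * p $ 2)) / real r"
    using \<open>r \<ge> 1\<close> by (simp add: field_simps)
  then show "\<exists>n. shift_t \<alpha> a b k e = of_int n / real r" by blast
qed

text \<open>The explicit matrix is the adjugate of \<open>N\<close>, which is its inverse because
  the determinant is 1. The product of the two factors is \<open>N + N\<^sup>-\<^sup>1 - 2\<close>,
  a scalar matrix by Cayley-Hamilton.\<close>

lemma dd_multiple:
  fixes N :: "int^2^2"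
  assumes "det N = 1" "N $ 1 $ 1 + N $ 2 $ 2 = theta \<alpha>"
  shows "dd \<alpha> *s k = (k v* (mat 1 - vector [vector [N $ 2 $ 2, - N $ 1 $ 2], vector [- N $ 2 $ 1, N $ 1 $ 1]])) v* (N - mat 1)"
proof -
  have 1: "N $ 1 $ 1 * N $ 2 $ 2 = 1 + N $ 1 $ 2 * N $ 2 $ 1" using assms(1) by (simp add: det_2)
  have 2: "dd \<alpha> = N $ 1 $ 1 + N $ 2 $ 2 - 2" using assms(2) by (simp add: dd_def)
  show ?thesis unfolding 2 using 1 by (simp add: coords2) algebra
qed

section \<open>Points and group actions in normalised coordinates\<close>

definition pt :: "nat \<Rightarrow> real^2 \<Rightarrow> real^2 \<Rightarrow> real^2 \<Rightarrow> complex \<Rightarrow> point" where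
  "pt r a b e s =
     point_of r ((a, b, wedge b a *\<^sub>R e + half_diag a b), of_real (wedge b a) * s)"

lemma c_class_eq_iff:
  "c_class r a b c' = c_class r a b c \<longleftrightarrow> (\<exists>m. c' = c + (wedge b a / real r) *\<^sub>R rvec m)"
proof
  assume "c_class r a b c' = c_class r a b c"
  moreover have "c' = c' + (wedge b a / real r) *\<^sub>R rvec 0"
    by (simp add: vec2_eq_iff)
  then have "c' \<in> c_class r a b c'" unfolding c_class_def by blast
  ultimately show "\<exists>m. c' = c + (wedge b a / real r) *\<^sub>R rvec m"
    by (auto simp: c_class_def)
next
  assume "\<exists>m. c' = c + (wedge b a / real r) *\<^sub>R rvec m"
  then obtain m where m: "c' = c + (wedge b a / real r) *\<^sub>R rvec m" ..
  have "\<exists>m'. c' + (wedge b a / real r) *\<^sub>R rvec n = c + (wedge b a / real r) *\<^sub>R rvec m'"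
    "\<exists>m'. c + (wedge b a / real r) *\<^sub>R rvec n = c' + (wedge b a / real r) *\<^sub>R rvec m'" for n
    by (rule exI[of _ "n + m"], simp add: m vec2_eq_iff algebra_simps)
      (rule exI[of _ "n - m"], simp add: m vec2_eq_iff algebra_simps)
  then show "c_class r a b c' = c_class r a b c"
    unfolding c_class_def by blast
qed

lemma t_class_eq_iff:
  "t_class r a b t' = t_class r a b t \<longleftrightarrow>
     (\<exists>n::int. t' = t + of_real (wedge b a / real r) * of_int n)"
proof
  assume "t_class r a b t' = t_class r a b t"
  moreover have "t' = t' + of_real (wedge b a / real r) * of_int 0"
    by simp
  then have "t' \<in> t_class r a b t'" unfolding t_class_def by blast
  ultimately show "\<exists>n::int. t' = t + of_real (wedge b a / real r) * of_int n"
    by (auto simp: t_class_def)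
next
  assume "\<exists>n::int. t' = t + of_real (wedge b a / real r) * of_int n"
  then obtain m where m: "t' = t + of_real (wedge b a / real r) * of_int m" ..
  have "\<exists>n'. t' + of_real (wedge b a / real r) * of_int n = t + of_real (wedge b a / real r) * of_int n'"
    "\<exists>n'. t + of_real (wedge b a / real r) * of_int n = t' + of_real (wedge b a / real r) * of_int n'" for n
    by (rule exI[of _ "n + m"], simp add: m distrib_left)
      (rule exI[of _ "n - m"], simp add: m right_diff_distrib)
  then show "t_class r a b t' = t_class r a b t"
    unfolding t_class_def by blast
qed

lemma pt_eq_iff:
  assumes "wedge b a \<noteq> 0"
  shows "pt r a b e' s' = pt r a b e s \<longleftrightarrow>
    (\<exists>m. e' = e + (1 / real r) *\<^sub>R rvec m) \<and> (\<exists>n::int. s' = s + of_int n / of_nat r)"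
proof -
  have "wedge b a *\<^sub>R e' + half_diag a b = wedge b a *\<^sub>R e + half_diag a b + (wedge b a / real r) *\<^sub>R rvec m
    \<longleftrightarrow> wedge b a *\<^sub>R e' = wedge b a *\<^sub>R (e + (1 / real r) *\<^sub>R rvec m)" for m
    by (simp add: scaleR_add_right algebra_simps)
  moreover have "complex_of_real (wedge b a) * s' = of_real (wedge b a) * s + of_real (wedge b a / real r) * of_int n
    \<longleftrightarrow> complex_of_real (wedge b a) * s' = of_real (wedge b a) * (s + of_int n / of_nat r)" for n
    by (simp add: algebra_simps)
  ultimately show ?thesis
    using assms by (simp add: pt_def point_of_def c_class_eq_iff t_class_eq_iff)
qed

lemma pt_eqI:
  assumes "e' = e + (1 / real r) *\<^sub>R rvec m" "s' = s + of_int n / of_nat r"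
  shows "pt r a b e' s' = pt r a b e s"
proof -
  have "wedge b a *\<^sub>R e' + half_diag a b = wedge b a *\<^sub>R e + half_diag a b + (wedge b a / real r) *\<^sub>R rvec m"
    by (simp add: assms algebra_simps)
  moreover have "complex_of_real (wedge b a) * s' = of_real (wedge b a) * s + of_real (wedge b a / real r) * of_int n"
    by (simp add: assms algebra_simps)
  ultimately show ?thesis
    unfolding pt_def point_of_def by (auto simp: c_class_eq_iff t_class_eq_iff)
qed

lemma fst_pt: "fst (pt r a b e s) = a" "fst (snd (pt r a b e s)) = b"
  by (simp_all add: pt_def point_of_def)

text \<open>All the actions on \<open>scriptA\<close> are \<open>the_elem\<close> of an image of a
  product of two classes. Checking the hypothesis for a given formula is the proof that the action
  is well defined.\<close>

lemma the_elem_class: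
  assumes "\<And>m n. F (wedge b a *\<^sub>R (e + (1 / real r) *\<^sub>R rvec m) + half_diag a b)
       (of_real (wedge b a) * (s + of_int n / of_nat r)) = y"
  shows "the_elem ((\<lambda>(c, t). F c t) `
     (c_class r a b (wedge b a *\<^sub>R e + half_diag a b) \<times> t_class r a b (of_real (wedge b a) * s))) = y"
proof -
  let ?X = "c_class r a b (wedge b a *\<^sub>R e + half_diag a b)"
  let ?T = "t_class r a b (of_real (wedge b a) * s)"
  have "F c t = y" if "c \<in> ?X" "t \<in> ?T" for c t
  proof -
    obtain m where m: "c = wedge b a *\<^sub>R e + half_diag a b + (wedge b a / real r) *\<^sub>R rvec m"
      using \<open>c \<in> ?X\<close> by (auto simp: c_class_def)
    obtain n where n: "t = of_real (wedge b a) * s + of_real (wedge b a / real r) * of_int n"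
      using \<open>t \<in> ?T\<close> by (auto simp: t_class_def)
    have "c = wedge b a *\<^sub>R (e + (1 / real r) *\<^sub>R rvec m) + half_diag a b"
      by (simp add: m algebra_simps)
    moreover have "t = of_real (wedge b a) * (s + of_int n / of_nat r)"
      by (simp add: n algebra_simps)
    ultimately show ?thesis using assms by simp
  qed
  moreover have "?X \<noteq> {}" "?T \<noteq> {}" by (auto simp: c_class_def t_class_def)
  ultimately have "(\<lambda>(c, t). F c t) ` (?X \<times> ?T) = {y}" by fast
  then show ?thesis by simp
qed

lemma act_scale_pt: "act_scale r (\<mu>, \<rho>) (pt r a b e s) = pt r (\<mu> *\<^sub>R a) (\<rho> *\<^sub>R b) e s"
proof -
  have "act_scale r (\<mu>, \<rho>) (pt r a b e s) = the_elem ((\<lambda>(c, t).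
      point_of r ((\<mu> *\<^sub>R a, \<rho> *\<^sub>R b, (\<mu> * \<rho>) *\<^sub>R c), of_real (\<mu> * \<rho>) * t)) `
     (c_class r a b (wedge b a *\<^sub>R e + half_diag a b) \<times> t_class r a b (of_real (wedge b a) * s)))"
    by (simp add: act_scale_def pt_def point_of_def)
  also have "\<dots> = pt r (\<mu> *\<^sub>R a) (\<rho> *\<^sub>R b) e s"
  proof (rule the_elem_class)
    fix m and n :: int
    let ?e = "e + (1 / real r) *\<^sub>R rvec m" and ?s = "s + of_int n / of_nat r"
    have "(\<mu> * \<rho>) *\<^sub>R (wedge b a *\<^sub>R ?e + half_diag a b)
       = wedge (\<rho> *\<^sub>R b) (\<mu> *\<^sub>R a) *\<^sub>R ?e + half_diag (\<mu> *\<^sub>R a) (\<rho> *\<^sub>R b)"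
      by (simp add: coords2 algebra_simps)
    moreover have "complex_of_real (\<mu> * \<rho>) * (of_real (wedge b a) * ?s)
       = of_real (wedge (\<rho> *\<^sub>R b) (\<mu> *\<^sub>R a)) * ?s"
      by (simp add: wedge_scale)
    moreover have "pt r (\<mu> *\<^sub>R a) (\<rho> *\<^sub>R b) ?e ?s = pt r (\<mu> *\<^sub>R a) (\<rho> *\<^sub>R b) e s"
      by (rule pt_eqI[OF refl refl])
    ultimately show "point_of r ((\<mu> *\<^sub>R a, \<rho> *\<^sub>R b, (\<mu> * \<rho>) *\<^sub>R (wedge b a *\<^sub>R ?e + half_diag a b)),
        of_real (\<mu> * \<rho>) * (of_real (wedge b a) * ?s)) = pt r (\<mu> *\<^sub>R a) (\<rho> *\<^sub>R b) e s"
      by (simp only: pt_def)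
  qed
  finally show ?thesis .
qed

lemma act_GL_pt:
  assumes "K \<in> GL2Z"
  shows "act_GL r K (pt r a b e s) = pt r (rmat K *v a) (rmat K *v b)
    (of_int (det K) *\<^sub>R (rmat K *v e + (1 / 2) *\<^sub>R row_prods K)) (of_int (det K) * s)"
proof -
  let ?A = "rmat K *v a" and ?B = "rmat K *v b"
  let ?C = "\<lambda>c. half_diag ?A ?B + rmat K *v (c - half_diag a b) + (wedge b a / 2) *\<^sub>R row_prods K"
  let ?E = "\<lambda>e. of_int (det K) *\<^sub>R (rmat K *v e + (1 / 2) *\<^sub>R row_prods K)"
  have "act_GL r K (pt r a b e s) = the_elem ((\<lambda>(c, t). point_of r ((?A, ?B, ?C c), t)) `
     (c_class r a b (wedge b a *\<^sub>R e + half_diag a b) \<times> t_class r a b (of_real (wedge b a) * s)))"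
    by (simp add: act_GL_def pt_def point_of_def Let_def)
  also have "\<dots> = pt r ?A ?B (?E e) (of_int (det K) * s)"
  proof (rule the_elem_class)
    fix m and n :: int
    let ?e = "e + (1 / real r) *\<^sub>R rvec m" and ?s = "s + of_int n / of_nat r"
    have \<epsilon>: "det K * det K = 1" using GL2Z_det[OF assms] by auto
    have \<epsilon>': "real_of_int (det K) * of_int (det K) = 1" "complex_of_int (det K) * of_int (det K) = 1"
      by (metis \<epsilon> of_int_mult of_int_1)+
    have "?C (wedge b a *\<^sub>R ?e + half_diag a b) = wedge ?B ?A *\<^sub>R ?E ?e + half_diag ?A ?B"
    proof -
      have "wedge ?B ?A *\<^sub>R ?E ?e = (wedge b a * (real_of_int (det K) * of_int (det K))) *\<^sub>R
         (rmat K *v ?e + (1 / 2) *\<^sub>R row_prods K)"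
        by (simp add: wedge_rmat algebra_simps)
      then show ?thesis unfolding \<epsilon>' add_diff_cancel_right' matrix_vector_mult_scaleR
        by (simp add: scaleR_add_right)
    qed
    moreover have "complex_of_real (wedge b a) * ?s = of_real (wedge ?B ?A) * (of_int (det K) * ?s)"
      using \<epsilon>'(2) by (simp add: wedge_rmat)
    ultimately have "point_of r ((?A, ?B, ?C (wedge b a *\<^sub>R ?e + half_diag a b)), of_real (wedge b a) * ?s)
      = pt r ?A ?B (?E ?e) (of_int (det K) * ?s)"
      by (simp only: pt_def)
    also have "\<dots> = pt r ?A ?B (?E e) (of_int (det K) * s)"
      by (rule pt_eqI[of _ _ _ "det K *s (K *v m)" _ _ "det K * n"],
          simp add: coords2 algebra_simps, simp add: distrib_left)
    finally show "point_of r ((?A, ?B, ?C (wedge b a *\<^sub>R ?e + half_diag a b)), of_real (wedge b a) * ?s)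
      = pt r ?A ?B (?E e) (of_int (det K) * s)" .
  qed
  finally show ?thesis .
qed

lemma act_Z2_pt:
  assumes "wedge b a \<noteq> 0" "\<alpha> > 1"
  shows "act_Z2 \<alpha> r k (pt r a b e s) =
    pt r a b (e + shift \<alpha> a b k) (s + of_real (shift_t \<alpha> a b k e))"
proof -
  have "act_Z2 \<alpha> r k (pt r a b e s) = the_elem ((\<lambda>(c, t).
      point_of r ((a, b, act_Z2_c \<alpha> a b k c), act_Z2_t \<alpha> a b k c t)) `
     (c_class r a b (wedge b a *\<^sub>R e + half_diag a b) \<times> t_class r a b (of_real (wedge b a) * s)))"
    by (simp add: act_Z2_def pt_def point_of_def)
  also have "\<dots> = pt r a b (e + shift \<alpha> a b k) (s + of_real (shift_t \<alpha> a b k e))"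
  proof (rule the_elem_class)
    fix m and n :: int
    let ?e = "e + (1 / real r) *\<^sub>R rvec m" and ?s = "s + of_int n / of_nat r"
    let ?c = "wedge b a *\<^sub>R ?e + half_diag a b"
    have sh: "wedge b a *\<^sub>R shift \<alpha> a b k
        = - ((\<alpha> * (rvec k \<bullet> a) / (\<alpha> - 1)) *\<^sub>R b) - ((rvec k \<bullet> b) / (\<alpha> - 1)) *\<^sub>R a"
    proof -
      have "wedge b a *\<^sub>R shift \<alpha> a b k
        = (1 / (1 - \<alpha>)) *\<^sub>R ((\<alpha> * (rvec k \<bullet> a)) *\<^sub>R b + (rvec k \<bullet> b) *\<^sub>R a)"
        using assms by (simp add: shift_def)
      also have "1 / (1 - \<alpha>) = - (1 / (\<alpha> - 1))" using assms by (simp add: field_simps)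
      finally show ?thesis
        by (simp add: vec2_eq_iff algebra_simps add_divide_distrib diff_divide_distrib)
    qed
    have C: "act_Z2_c \<alpha> a b k ?c = wedge b a *\<^sub>R (?e + shift \<alpha> a b k) + half_diag a b"
      unfolding act_Z2_c_def scaleR_add_right[of _ _ "shift \<alpha> a b k"] sh by simp
    \<comment> \<open>Rewriting the polynomial in \<open>k\<close> isolates three parts:
      \<open>half_diag\<close> is absorbed by passing from \<open>c\<close> to \<open>e\<close>, the
      last one is the half of \<open>k $ 1 * k $ 2\<close> in \<open>shift_t\<close>, and the half
      product turns \<open>\<alpha> / (1 - \<alpha>)\<close> into the symmetric coefficient
      \<open>(\<alpha> + 1) / (2 (1 - \<alpha>))\<close>.\<close>
    have q: "(of_int (k $ 1) * (of_int (k $ 1) - 1) * a $ 1 * b $ 1 + of_int (k $ 2) * (of_int (k $ 2) - 1) * a $ 2 * b $ 2) / 2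
        + of_int (k $ 1) * of_int (k $ 2) * b $ 1 * a $ 2
       = (rvec k \<bullet> a) * (rvec k \<bullet> b) / 2 - rvec k \<bullet> half_diag a b + wedge b a * (of_int (k $ 1 * k $ 2) / 2)"
      by (simp add: coords2 field_simps)
    have "\<alpha> * (rvec k \<bullet> a) * (rvec k \<bullet> b) / (1 - \<alpha>) + (rvec k \<bullet> a) * (rvec k \<bullet> b) / 2
       = wedge b a * ((\<alpha> + 1) * (rvec k \<bullet> a) * (rvec k \<bullet> b) / 2 / ((1 - \<alpha>) * wedge b a))"
      using assms by (simp add: field_simps)
    then have "\<alpha> * (rvec k \<bullet> a) * (rvec k \<bullet> b) / (1 - \<alpha>) + rvec k \<bullet> ?c
        + ((of_int (k $ 1) * (of_int (k $ 1) - 1) * a $ 1 * b $ 1 + of_int (k $ 2) * (of_int (k $ 2) - 1) * a $ 2 * b $ 2) / 2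
        + of_int (k $ 1) * of_int (k $ 2) * b $ 1 * a $ 2) = wedge b a * shift_t \<alpha> a b k ?e"
      unfolding q shift_t_def by (simp add: inner_add_right algebra_simps)
    then have T: "act_Z2_t \<alpha> a b k ?c (of_real (wedge b a) * ?s)
       = of_real (wedge b a) * (?s + of_real (shift_t \<alpha> a b k ?e))"
      unfolding act_Z2_t_def Let_def
      by (simp only: add.assoc of_real_mult distrib_left)
    \<comment> \<open>Another representative of \<open>e\<close> changes the translation of
      \<open>s\<close> by a multiple of \<open>1 / r\<close>, which its class does not see.\<close>
    have "shift_t \<alpha> a b k ?e = shift_t \<alpha> a b k e + of_int (k $ 1 * m $ 1 + k $ 2 * m $ 2) / real r"
      by (simp add: shift_t_def inner_add_right inner2 add_divide_distrib distrib_left)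
    then have "pt r a b (?e + shift \<alpha> a b k) (?s + of_real (shift_t \<alpha> a b k ?e))
      = pt r a b (e + shift \<alpha> a b k) (s + of_real (shift_t \<alpha> a b k e))"
      by (intro pt_eqI[of _ _ _ m _ _ "n + (k $ 1 * m $ 1 + k $ 2 * m $ 2)"])
        (simp_all add: add_divide_distrib)
    then show "point_of r ((a, b, act_Z2_c \<alpha> a b k ?c), act_Z2_t \<alpha> a b k ?c (of_real (wedge b a) * ?s))
       = pt r a b (e + shift \<alpha> a b k) (s + of_real (shift_t \<alpha> a b k e))"
      unfolding C T by (simp add: pt_def)
  qed
  finally show ?thesis .
qed

text \<open>The equation of \<open>p(a, b, c, r)\<close> divided by \<open>b \<and> a\<close>.\<close>

definition norm_rel :: "nat \<Rightarrow> int^2^2 \<Rightarrow> real^2 \<Rightarrow> int^2 \<Rightarrow> bool" where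
  "norm_rel r N e p \<longleftrightarrow>
     rmat (mat 1 - N) *v e = (1 / 2) *\<^sub>R row_prods N + (1 / real r) *\<^sub>R rvec p"

lemma norm_C_iff: "e \<in> norm_C r N \<longleftrightarrow> (\<exists>p. norm_rel r N e p)"
  by (simp add: norm_C_def norm_rel_def)

definition trans_e :: "real \<Rightarrow> real^2 \<Rightarrow> real^2 \<Rightarrow> int^2^2 \<Rightarrow> int^2 \<Rightarrow> real^2 \<Rightarrow> real^2" where
  "trans_e \<alpha> a b K k e =
     of_int (det K) *\<^sub>R (rmat K *v (e + shift \<alpha> a b k) + (1 / 2) *\<^sub>R row_prods K)"

lemma GL2Z_mult: "K \<in> GL2Z \<Longrightarrow> L \<in> GL2Z \<Longrightarrow> K ** L \<in> GL2Z"
  by (simp add: GL2Z_def invertible_mult)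

lemma GL2Z_mat1 [simp]: "mat 1 \<in> GL2Z"
  unfolding GL2Z_def invertible_def by (auto intro: exI[of _ "mat 1"])

lemma GL2Z_inverse:
  assumes "K \<in> GL2Z"
  obtains L where "L \<in> GL2Z" "K ** L = mat 1" "L ** K = mat 1"
  using assms unfolding GL2Z_def invertible_def by blast

lemma carrier_calG:
  "g \<in> carrier (calG \<alpha>) \<longleftrightarrow>
     (\<exists>\<mu> \<rho> K k. g = ((\<mu>, \<rho>), K, Zd_class \<alpha> k) \<and> \<mu> > 0 \<and> \<rho> \<noteq> 0 \<and> K \<in> GL2Z)"
  by (auto simp: calG_def semidirect_GL_Zd_def)

lemma row_prods_mat1 [simp]: "row_prods (mat 1) = 0"
  by (simp add: coords2)

text \<open>Expanding \<open>row_prods\<close> of the one matrix \<open>N' ** K = K ** N\<close> in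
  both ways compares the corrections on the two sides, and \<open>w\<close> is the resulting integer
  discrepancy. It depends on the matrices alone and is therefore fixed before \<open>e\<close>,
  \<open>p\<close> and the shift; the criterion for reflections relies on this when it chooses the
  shift in terms of \<open>w\<close>.\<close>

lemma norm_rel_act:
  assumes "K \<in> GL2Z" "det N = 1" "N' ** K = K ** N"
  obtains w where
    "\<And>e p v q. norm_rel r N e p \<Longrightarrow> rmat (mat 1 - N) *v v = rvec q \<Longrightarrow> r \<ge> 1 \<Longrightarrow>
       norm_rel r N' (of_int (det K) *\<^sub>R (rmat K *v (e + v) + (1 / 2) *\<^sub>R row_prods K))
         (det K *s (K *v (p + int r *s q)) + int r *s w)"
proof -
  obtain w1 where w1: "row_prods (K ** N) = rmat K *v row_prods N + of_int (det N) *\<^sub>R row_prods K + 2 *\<^sub>R rvec w1"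
    by (rule row_prods_mult)
  obtain w2 where w2: "row_prods (N' ** K) = rmat N' *v row_prods K + of_int (det K) *\<^sub>R row_prods N' + 2 *\<^sub>R rvec w2"
    by (rule row_prods_mult)
  have \<epsilon>: "real_of_int (det K) * of_int (det K) = 1"
    using GL2Z_det[OF assms(1)] by auto
  have comm: "rmat (mat 1 - N') ** rmat K = rmat K ** rmat (mat 1 - N)"
  proof -
    have "(mat 1 - N') ** K = K ** (mat 1 - N)"
      using assms(3) by (simp add: coords2 algebra_simps)
    then show ?thesis by (metis rmat_mult)
  qed
  have par: "rmat K *v row_prods N + row_prods K - rmat N' *v row_prods K
      = of_int (det K) *\<^sub>R row_prods N' + 2 *\<^sub>R rvec (w2 - w1)"
    using w1 w2 unfolding assms(2,3) by (simp add: vec2_eq_iff algebra_simps)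
  show ?thesis
  proof (rule that[of "det K *s (w2 - w1)"])
    fix e p v q
    assume e: "norm_rel r N e p" and v: "rmat (mat 1 - N) *v v = rvec q" and r: "r \<ge> 1"
    have "rmat (mat 1 - N') *v (of_int (det K) *\<^sub>R (rmat K *v (e + v) + (1 / 2) *\<^sub>R row_prods K))
      = of_int (det K) *\<^sub>R (rmat K *v (rmat (mat 1 - N) *v e + rmat (mat 1 - N) *v v)
          + (1 / 2) *\<^sub>R (row_prods K - rmat N' *v row_prods K))"
      by (simp add: matrix_vector_mult_scaleR matrix_vector_right_distrib matrix_vector_mul_assoc comm)
        (simp add: rmat_diff matrix_vector_mult_diff_rdistrib)
    also have "\<dots> = of_int (det K) *\<^sub>R ((1 / 2) *\<^sub>R (rmat K *v row_prods N + row_prods K - rmat N' *v row_prods K)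
        + (1 / real r) *\<^sub>R rvec (K *v (p + int r *s q)))"
    proof (rule arg_cong[of _ _ "\<lambda>x. of_int (det K) *\<^sub>R x"])
      show "rmat K *v (rmat (mat 1 - N) *v e + rmat (mat 1 - N) *v v)
          + (1 / 2) *\<^sub>R (row_prods K - rmat N' *v row_prods K) =
        (1 / 2) *\<^sub>R (rmat K *v row_prods N + row_prods K - rmat N' *v row_prods K)
          + (1 / real r) *\<^sub>R rvec (K *v (p + int r *s q))"
        using r unfolding e[unfolded norm_rel_def] v
        by (simp add: vec2_eq_iff mat_vec_nth2 field_simps)
    qed
    also have "\<dots> = (real_of_int (det K) * of_int (det K)) *\<^sub>R (1 / 2) *\<^sub>R row_prods N'
        + (1 / real r) *\<^sub>R rvec (det K *s (K *v (p + int r *s q)) + int r *s (det K *s (w2 - w1)))"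
      unfolding par using r by (simp add: vec2_eq_iff field_simps)
    finally show "norm_rel r N' (of_int (det K) *\<^sub>R (rmat K *v (e + v) + (1 / 2) *\<^sub>R row_prods K))
         (det K *s (K *v (p + int r *s q)) + int r *s (det K *s (w2 - w1)))"
      unfolding norm_rel_def \<epsilon> by simp
  qed
qed

context
  fixes \<alpha> :: real and r :: nat
  assumes adm: "S_plus_admissible \<alpha>" and r: "r \<ge> 1"
begin

lemma alpha_gt: "\<alpha> > 1"
  using adm by (rule S_plus_admissible_facts)

lemma trans_e_norm_C:
  assumes "(a, b) \<in> compatible_pairs \<alpha>" "e \<in> norm_C r (NN \<alpha> a b)" "K \<in> GL2Z" "\<mu> \<noteq> 0" "\<rho> \<noteq> 0"
  shows "trans_e \<alpha> a b K k e \<in> norm_C r (NN \<alpha> (\<mu> *\<^sub>R (rmat K *v a)) (\<rho> *\<^sub>R (rmat K *v b)))"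
proof -
  note N = compatible_NN[OF assms(1)]
  obtain p where p: "norm_rel r (NN \<alpha> a b) e p" using assms(2) norm_C_iff by blast
  have v: "rmat (mat 1 - NN \<alpha> a b) *v shift \<alpha> a b k = rvec (vector [- k $ 2, k $ 1])"
    using shift_eq alpha_gt N by blast
  show ?thesis
    using norm_rel_act[OF assms(3) compatible_NN_det_trace(1)[OF assms(1) adm] compatible_pairs_act(2)[OF assms(1,3-5)]] p v r
    unfolding norm_C_iff trans_e_def by metis
qed

text \<open>Two representatives of the class differ by some \<open>j\<close>, a multiple of
  \<open>d\<close>. By \<open>shift_trivial\<close> it moves \<open>e\<close> by an integer vector
  and \<open>s\<close> by a multiple of \<open>1 / r\<close>, and the cross terms between
  \<open>j\<close> and \<open>k\<close> are integers.\<close>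

lemma act_Zd_pt:
  assumes "(a, b) \<in> compatible_pairs \<alpha>" "e \<in> norm_C r (NN \<alpha> a b)"
  shows "act_Zd \<alpha> r (Zd_class \<alpha> k) (pt r a b e s)
    = pt r a b (e + shift \<alpha> a b k) (s + of_real (shift_t \<alpha> a b k e))"
proof -
  note N = compatible_NN[OF assms(1)]
  note dt = compatible_NN_det_trace[OF assms(1) adm]
  have "act_Z2 \<alpha> r k' (pt r a b e s) = pt r a b (e + shift \<alpha> a b k) (s + of_real (shift_t \<alpha> a b k e))"
    if "k' \<in> Zd_class \<alpha> k" for k'
  proof -
    obtain m where k': "k' = k + dd \<alpha> *s m" using \<open>k' \<in> Zd_class \<alpha> k\<close> unfolding Zd_class_def by blast
    obtain m' where m': "dd \<alpha> *s m = m' v* (NN \<alpha> a b - mat 1)"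
      using dd_multiple[OF dt] by metis
    define j where "j = dd \<alpha> *s m"
    obtain w where w: "shift \<alpha> a b j = rvec w"
      using shift_trivial(1)[OF alpha_gt N(1,3,4) dt(1) m'] unfolding j_def by metis
    obtain n :: int where n: "shift_t \<alpha> a b j e = of_int n / real r"
      using shift_trivial(2)[OF alpha_gt N(1,3,4) dt(1) m' assms(2) r] unfolding j_def by metis
    have kj: "shift_t \<alpha> a b k (e + shift \<alpha> a b j) = shift_t \<alpha> a b k e + of_int (k $ 1 * w $ 1 + k $ 2 * w $ 2)"
      unfolding w by (simp add: shift_t_def inner2 distrib_left)
    define l where "l = n + int r * (k $ 1 * w $ 1 + k $ 2 * w $ 2 + k $ 1 * j $ 2)"
    have t: "shift_t \<alpha> a b k' e = shift_t \<alpha> a b k e + of_int l / real r"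
      using shift_t_add[OF alpha_gt N(2), of j e k] r n kj
      unfolding k' j_def[symmetric] l_def
      by (simp add: field_simps)
    have e: "shift \<alpha> a b k' = shift \<alpha> a b k + (1 / real r) *\<^sub>R rvec (int r *s w)"
      using r unfolding k' shift_add j_def[symmetric] w by (simp add: vec2_eq_iff)
    show ?thesis
      unfolding act_Z2_pt[OF N(2) alpha_gt] t e add.assoc[symmetric] of_real_add
      by (rule pt_eqI[OF refl, where n = l]) simp
  qed
  note eq = this
  have k: "k \<in> Zd_class \<alpha> k"
    unfolding Zd_class_def by (auto intro!: exI[of _ 0])
  have "act_Zd \<alpha> r (Zd_class \<alpha> k) (pt r a b e s) = act_Z2 \<alpha> r k (pt r a b e s)"
    unfolding act_Zd_def by (rule the_elem_image_unique) (use k eq in auto)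
  then show ?thesis using eq[OF k] by simp
qed

text \<open>The scalings leave \<open>e\<close> and \<open>s\<close> alone because
  \<open>shift\<close> and \<open>shift_t\<close> are homogeneous of degree zero in \<open>a\<close>
  and in \<open>b\<close>. Later computations with group elements start from this formula.\<close>

lemma calG_act_pt:
  assumes "(a, b) \<in> compatible_pairs \<alpha>" "e \<in> norm_C r (NN \<alpha> a b)" "\<mu> > 0" "\<rho> \<noteq> 0" "K \<in> GL2Z"
  shows "calG_act \<alpha> r ((\<mu>, \<rho>), K, Zd_class \<alpha> k) (pt r a b e s)
    = pt r (\<mu> *\<^sub>R (rmat K *v a)) (\<rho> *\<^sub>R (rmat K *v b)) (trans_e \<alpha> a b K k e)
        (of_int (det K) * (s + of_real (shift_t \<alpha> a b k e)))"
proof -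
  have \<mu>: "\<mu> \<noteq> 0" using assms(3) by simp
  have c: "(\<mu> *\<^sub>R a, \<rho> *\<^sub>R b) \<in> compatible_pairs \<alpha>"
    and N: "NN \<alpha> (\<mu> *\<^sub>R a) (\<rho> *\<^sub>R b) = NN \<alpha> a b"
    using compatible_pairs_act[OF assms(1) GL2Z_mat1 \<mu> assms(4)] by simp_all
  show ?thesis
    using assms act_Zd_pt[OF c, unfolded N, OF assms(2)]
    by (simp add: calG_act_def act_scale_pt act_GL_pt trans_e_def shift_scale[OF \<mu> assms(4)]
        shift_t_scale[OF \<mu> assms(4)] matrix_vector_mult_scaleR)
qed

end

section \<open>The composition law and the orbits of points\<close>

abbreviation "orb \<alpha> r \<equiv> orbit (calG \<alpha>) (calG_act \<alpha> r)"

lemma is_p_iff_norm_rel: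
  assumes "wedge b a \<noteq> 0"
  shows "is_p \<alpha> r a b (wedge b a *\<^sub>R e + half_diag a b) p \<longleftrightarrow> norm_rel r (NN \<alpha> a b) e p"
proof -
  have "is_p \<alpha> r a b (wedge b a *\<^sub>R e + half_diag a b) p \<longleftrightarrow>
    wedge b a *\<^sub>R (rmat (mat 1 - NN \<alpha> a b) *v e) =
    wedge b a *\<^sub>R ((1 / 2) *\<^sub>R row_prods (NN \<alpha> a b) + (1 / real r) *\<^sub>R rvec p)"
    unfolding is_p_def add_diff_cancel_right' matrix_vector_mult_scaleR diff_eq_eq scaleR_add_right
    by (simp add: add.commute)
  then show ?thesis using assms by (simp add: norm_rel_def)
qed

lemma CC_iff_norm_C:
  assumes "wedge b a \<noteq> 0"
  shows "wedge b a *\<^sub>R e + half_diag a b \<in> CC \<alpha> r a b \<longleftrightarrow> e \<in> norm_C r (NN \<alpha> a b)"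
  unfolding CC_def norm_C_iff mem_Collect_eq is_p_iff_norm_rel[OF assms] ..

lemma norm_form:
  assumes "wedge b a \<noteq> 0"
  obtains e where "c = wedge b a *\<^sub>R e + half_diag a b"
  using assms by (intro that[of "(1 / wedge b a) *\<^sub>R (c - half_diag a b)"]) simp

lemma point_of_norm_form:
  assumes "wedge b a \<noteq> 0"
  shows "point_of r ((a, b, wedge b a *\<^sub>R e + half_diag a b), t) = pt r a b e (t / of_real (wedge b a))"
  using assms by (simp add: pt_def)

lemma topspace_AA: "topspace (AA_topology \<alpha> r) = TT \<alpha> r \<times> UNIV"
  by (simp add: AA_topology_def TT_topology_def topspace_pullback_topology)

lemma topspace_scriptA:
  "topspace (scriptA_topology \<alpha> r) =
     {pt r a b e s | a b e s. (a, b) \<in> compatible_pairs \<alpha> \<and> e \<in> norm_C r (NN \<alpha> a b)}"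
proof (intro subset_antisym subsetI)
  fix x assume "x \<in> topspace (scriptA_topology \<alpha> r)"
  then obtain a b c t where x: "x = point_of r ((a, b, c), t)" and c: "(a, b) \<in> compatible_pairs \<alpha>" "c \<in> CC \<alpha> r a b"
    by (auto simp: scriptA_topology_def topspace_AA TT_def)
  have w: "wedge b a \<noteq> 0" using c(1) by (rule compatible_NN)
  obtain e where e: "c = wedge b a *\<^sub>R e + half_diag a b" using norm_form[OF w] .
  have "e \<in> norm_C r (NN \<alpha> a b)" using c(2) CC_iff_norm_C[OF w] e by simp
  then show "x \<in> {pt r a b e s | a b e s. (a, b) \<in> compatible_pairs \<alpha> \<and> e \<in> norm_C r (NN \<alpha> a b)}"
    using c(1) x point_of_norm_form[OF w] e by blast
next
  fix x assume "x \<in> {pt r a b e s | a b e s. (a, b) \<in> compatible_pairs \<alpha> \<and> e \<in> norm_C r (NN \<alpha> a b)}"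
  then obtain a b e s where x: "x = pt r a b e s" and c: "(a, b) \<in> compatible_pairs \<alpha>" and e: "e \<in> norm_C r (NN \<alpha> a b)"
    by blast
  have "((a, b, wedge b a *\<^sub>R e + half_diag a b), of_real (wedge b a) * s) \<in> TT \<alpha> r \<times> UNIV"
    using c e CC_iff_norm_C[OF compatible_NN(2)[OF c]] by (simp add: TT_def)
  then show "x \<in> topspace (scriptA_topology \<alpha> r)"
    unfolding x pt_def scriptA_topology_def topspace_quotient_topology topspace_AA by (rule imageI)
qed

lemma scriptA_cases:
  assumes "x \<in> topspace (scriptA_topology \<alpha> r)"
  obtains a b e s where "x = pt r a b e s" "(a, b) \<in> compatible_pairs \<alpha>" "e \<in> norm_C r (NN \<alpha> a b)"
  using assms unfolding topspace_scriptA by blast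

lemma pt_in_scriptA:
  "(a, b) \<in> compatible_pairs \<alpha> \<Longrightarrow> e \<in> norm_C r (NN \<alpha> a b) \<Longrightarrow> pt r a b e s \<in> topspace (scriptA_topology \<alpha> r)"
  unfolding topspace_scriptA by blast

text \<open>The semidirect law appears because \<open>shift\<close> for the moved pair at
  \<open>k\<close> is the shift for the old pair at \<open>k v* K'\<close>, up to the matrix. The
  error \<open>m\<close> comes from the integer vector of \<open>row_prods_mult\<close> and
  disappears in the class of \<open>e\<close>.\<close>

lemma trans_e_compose:
  assumes "K' \<in> GL2Z" "\<mu> \<noteq> 0" "\<rho> \<noteq> 0" "r \<ge> 1"
  obtains m where "trans_e \<alpha> (\<mu> *\<^sub>R (rmat K' *v a)) (\<rho> *\<^sub>R (rmat K' *v b)) K k (trans_e \<alpha> a b K' k' e)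
     = trans_e \<alpha> a b (K ** K') (k v* K' + k') e + (1 / real r) *\<^sub>R rvec m"
proof -
  obtain w where w: "row_prods (K ** K') = rmat K *v row_prods K' + of_int (det K') *\<^sub>R row_prods K + 2 *\<^sub>R rvec w"
    by (rule row_prods_mult)
  have \<epsilon>: "real_of_int (det K') * of_int (det K') = 1"
    using GL2Z_det[OF assms(1)] by auto
  let ?V = "shift \<alpha> a b"
  have "trans_e \<alpha> (\<mu> *\<^sub>R (rmat K' *v a)) (\<rho> *\<^sub>R (rmat K' *v b)) K k (trans_e \<alpha> a b K' k' e)
     = of_int (det K) *\<^sub>R (of_int (det K') *\<^sub>R (rmat K *v (rmat K' *v (e + ?V k') + (1 / 2) *\<^sub>R row_prods K'
          + rmat K' *v ?V (k v* K'))) + (1 / 2) *\<^sub>R row_prods K)"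
    unfolding trans_e_def shift_scale[OF assms(2,3)] shift_GL[OF assms(1)] scaleR_add_right[symmetric]
      matrix_vector_mult_scaleR ..
  also have "\<dots> = of_int (det K) *\<^sub>R of_int (det K') *\<^sub>R (rmat K *v (rmat K' *v (e + ?V k') + (1 / 2) *\<^sub>R row_prods K'
          + rmat K' *v ?V (k v* K')) + (1 / 2) *\<^sub>R of_int (det K') *\<^sub>R row_prods K)"
    using \<epsilon> by (simp add: scaleR_add_right)
  also have "rmat K *v (rmat K' *v (e + ?V k') + (1 / 2) *\<^sub>R row_prods K' + rmat K' *v ?V (k v* K'))
       + (1 / 2) *\<^sub>R of_int (det K') *\<^sub>R row_prods K
     = rmat (K ** K') *v (e + ?V (k v* K' + k')) + (1 / 2) *\<^sub>R row_prods (K ** K') - rvec w"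
    unfolding w rmat_mult matrix_vector_mul_assoc[symmetric] shift_add
    by (simp add: matrix_vector_right_distrib matrix_vector_mult_scaleR scaleR_add_right)
  also have "real_of_int (det K) *\<^sub>R real_of_int (det K') *\<^sub>R (rmat (K ** K') *v (e + ?V (k v* K' + k'))
        + (1 / 2) *\<^sub>R row_prods (K ** K') - rvec w)
     = trans_e \<alpha> a b (K ** K') (k v* K' + k') e - (real_of_int (det K) * of_int (det K')) *\<^sub>R rvec w"
    unfolding trans_e_def det_mul of_int_mult by (simp add: scaleR_diff_right)
  also have "(real_of_int (det K) * of_int (det K')) *\<^sub>R rvec w
     = - ((1 / real r) *\<^sub>R rvec (- (int r * det K * det K') *s w))"
    using assms(4) by (simp add: vec2_eq_iff)
  finally show ?thesis
    by (intro that[of "- (int r * det K * det K') *s w"]) simp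
qed

lemma shift_t_compose:
  assumes "K' \<in> GL2Z" "\<mu> \<noteq> 0" "\<rho> \<noteq> 0" "\<alpha> > 1" "wedge b a \<noteq> 0"
  obtains n :: int where
    "of_int (det K') * shift_t \<alpha> a b k' e +
       shift_t \<alpha> (\<mu> *\<^sub>R (rmat K' *v a)) (\<rho> *\<^sub>R (rmat K' *v b)) k (trans_e \<alpha> a b K' k' e)
     = of_int (det K') * shift_t \<alpha> a b (k v* K' + k') e + of_int n"
proof -
  obtain n where n: "shift_t \<alpha> (rmat K' *v a) (rmat K' *v b) k (trans_e \<alpha> a b K' k' e)
     = of_int (det K') * shift_t \<alpha> a b (k v* K') (e + shift \<alpha> a b k') + of_int n"
    unfolding trans_e_def by (rule shift_t_GL[OF assms(1)])
  have "of_int (det K') * shift_t \<alpha> a b k' e +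
       shift_t \<alpha> (\<mu> *\<^sub>R (rmat K' *v a)) (\<rho> *\<^sub>R (rmat K' *v b)) k (trans_e \<alpha> a b K' k' e)
     = of_int (det K') * (shift_t \<alpha> a b k' e + shift_t \<alpha> a b (k v* K') (e + shift \<alpha> a b k')) + of_int n"
    unfolding shift_t_scale[OF assms(2,3)] n by (simp add: distrib_left)
  also have "\<dots> = of_int (det K') * shift_t \<alpha> a b (k v* K' + k') e + of_int (n - det K' * ((k v* K') $ 1 * k' $ 2))"
    unfolding shift_t_add[OF assms(4,5)] by (simp add: right_diff_distrib)
  finally show ?thesis by (rule that)
qed

context
  fixes \<alpha> :: real and r :: nat
  assumes adm: "S_plus_admissible \<alpha>" and r: "r \<ge> 1"
begin

lemma calG_act_compose:
  assumes "(a, b) \<in> compatible_pairs \<alpha>" "e \<in> norm_C r (NN \<alpha> a b)"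
    and "\<mu> > 0" "\<rho> \<noteq> 0" "K \<in> GL2Z" "\<mu>' > 0" "\<rho>' \<noteq> 0" "K' \<in> GL2Z"
  shows "calG_act \<alpha> r ((\<mu>, \<rho>), K, Zd_class \<alpha> k) (calG_act \<alpha> r ((\<mu>', \<rho>'), K', Zd_class \<alpha> k') (pt r a b e s))
    = calG_act \<alpha> r ((\<mu> * \<mu>', \<rho> * \<rho>'), K ** K', Zd_class \<alpha> (k v* K' + k')) (pt r a b e s)"
proof -
  let ?a = "\<mu>' *\<^sub>R (rmat K' *v a)" and ?b = "\<rho>' *\<^sub>R (rmat K' *v b)" and ?e = "trans_e \<alpha> a b K' k' e"
  have \<mu>': "\<mu>' \<noteq> 0" using assms(6) by simp
  note c = compatible_pairs_act(1)[OF assms(1,8) \<mu>' assms(7)]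
  note e = trans_e_norm_C[OF adm r assms(1,2,8) \<mu>' assms(7)]
  obtain m where m: "trans_e \<alpha> ?a ?b K k ?e = trans_e \<alpha> a b (K ** K') (k v* K' + k') e + (1 / real r) *\<^sub>R rvec m"
    using trans_e_compose[OF assms(8) \<mu>' assms(7) r] by metis
  obtain n :: int where n: "of_int (det K') * shift_t \<alpha> a b k' e + shift_t \<alpha> ?a ?b k ?e
     = of_int (det K') * shift_t \<alpha> a b (k v* K' + k') e + of_int n"
    using shift_t_compose[OF assms(8) \<mu>' assms(7) S_plus_admissible_facts(1)[OF adm] compatible_NN(2)[OF assms(1)]] by metis
  have "of_int (det K') * complex_of_real (shift_t \<alpha> a b k' e) + of_real (shift_t \<alpha> ?a ?b k ?e)
     = of_int (det K') * of_real (shift_t \<alpha> a b (k v* K' + k') e) + of_int n"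
    using arg_cong[OF n, of complex_of_real] by simp
  then have s0: "of_int (det K') * (s + of_real (shift_t \<alpha> a b k' e)) + of_real (shift_t \<alpha> ?a ?b k ?e)
     = of_int (det K') * (s + of_real (shift_t \<alpha> a b (k v* K' + k') e)) + of_int n"
    by (simp add: distrib_left add.assoc)
  have s: "of_int (det K) * (of_int (det K') * (s + of_real (shift_t \<alpha> a b k' e)) + of_real (shift_t \<alpha> ?a ?b k ?e))
     = of_int (det (K ** K')) * (s + of_real (shift_t \<alpha> a b (k v* K' + k') e)) + of_int (int r * (det K * n)) / of_nat r"
    unfolding s0 using r by (simp add: det_mul distrib_left mult.assoc)
  have "pt r (\<mu> *\<^sub>R (rmat K *v ?a)) (\<rho> *\<^sub>R (rmat K *v ?b)) (trans_e \<alpha> ?a ?b K k ?e)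
      (of_int (det K) * (of_int (det K') * (s + of_real (shift_t \<alpha> a b k' e)) + of_real (shift_t \<alpha> ?a ?b k ?e)))
    = pt r (\<mu> *\<^sub>R (rmat K *v ?a)) (\<rho> *\<^sub>R (rmat K *v ?b)) (trans_e \<alpha> a b (K ** K') (k v* K' + k') e)
      (of_int (det (K ** K')) * (s + of_real (shift_t \<alpha> a b (k v* K' + k') e)))"
    by (rule pt_eqI[OF m s])
  moreover have "\<mu> *\<^sub>R (rmat K *v ?a) = (\<mu> * \<mu>') *\<^sub>R (rmat (K ** K') *v a)"
    "\<rho> *\<^sub>R (rmat K *v ?b) = (\<rho> * \<rho>') *\<^sub>R (rmat (K ** K') *v b)"
    by (simp_all add: rmat_mult matrix_vector_mult_scaleR matrix_vector_mul_assoc)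
  ultimately show ?thesis
    using assms calG_act_pt[OF adm r c e assms(3-5)] calG_act_pt[OF adm r assms(1,2,6-8)]
      calG_act_pt[OF adm r assms(1,2) _ _ GL2Z_mult[OF assms(5,8)], of "\<mu> * \<mu>'" "\<rho> * \<rho>'"]
    by simp
qed

lemma calG_act_id:
  assumes "(a, b) \<in> compatible_pairs \<alpha>" "e \<in> norm_C r (NN \<alpha> a b)"
  shows "calG_act \<alpha> r ((1, 1), mat 1, Zd_class \<alpha> 0) (pt r a b e s) = pt r a b e s"
  by (subst calG_act_pt[OF adm r assms]) (simp_all add: trans_e_def)

lemma calG_act_closed:
  assumes "g \<in> carrier (calG \<alpha>)" "x \<in> topspace (scriptA_topology \<alpha> r)"
  shows "calG_act \<alpha> r g x \<in> topspace (scriptA_topology \<alpha> r)"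
proof -
  obtain \<mu> \<rho> K k where g: "g = ((\<mu>, \<rho>), K, Zd_class \<alpha> k)" "\<mu> > 0" "\<rho> \<noteq> 0" "K \<in> GL2Z"
    using assms(1) unfolding carrier_calG by blast
  obtain a b e s where x: "x = pt r a b e s" "(a, b) \<in> compatible_pairs \<alpha>" "e \<in> norm_C r (NN \<alpha> a b)"
    using assms(2) by (rule scriptA_cases)
  have \<mu>: "\<mu> \<noteq> 0" using g by simp
  show ?thesis
    unfolding g x calG_act_pt[OF adm r x(2,3) g(2-4)]
    using trans_e_norm_C[OF adm r x(2,3) g(4) \<mu> g(3)] compatible_pairs_act(1)[OF x(2) g(4) \<mu> g(3)]
    by (rule pt_in_scriptA[rotated])
qed

text \<open>Products and inverses are obtained as elements acting in the right way on points of
  \<open>scriptA\<close>, which is all that a theory of orbits requires.\<close>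

lemma calG_act_trans:
  assumes "g \<in> carrier (calG \<alpha>)" "h \<in> carrier (calG \<alpha>)"
  obtains gh where "gh \<in> carrier (calG \<alpha>)"
    "\<And>x. x \<in> topspace (scriptA_topology \<alpha> r) \<Longrightarrow> calG_act \<alpha> r g (calG_act \<alpha> r h x) = calG_act \<alpha> r gh x"
proof -
  obtain \<mu> \<rho> K k where g: "g = ((\<mu>, \<rho>), K, Zd_class \<alpha> k)" "\<mu> > 0" "\<rho> \<noteq> 0" "K \<in> GL2Z"
    using assms(1) unfolding carrier_calG by blast
  obtain \<mu>' \<rho>' K' k' where h: "h = ((\<mu>', \<rho>'), K', Zd_class \<alpha> k')" "\<mu>' > 0" "\<rho>' \<noteq> 0" "K' \<in> GL2Z"
    using assms(2) unfolding carrier_calG by blast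
  show ?thesis
  proof (rule that[of "((\<mu> * \<mu>', \<rho> * \<rho>'), K ** K', Zd_class \<alpha> (k v* K' + k'))"])
    show "((\<mu> * \<mu>', \<rho> * \<rho>'), K ** K', Zd_class \<alpha> (k v* K' + k')) \<in> carrier (calG \<alpha>)"
      unfolding carrier_calG using g h GL2Z_mult by (metis mult_eq_0_iff mult_pos_pos)
    fix x assume "x \<in> topspace (scriptA_topology \<alpha> r)"
    then obtain a b e s where x: "x = pt r a b e s" "(a, b) \<in> compatible_pairs \<alpha>" "e \<in> norm_C r (NN \<alpha> a b)"
      by (rule scriptA_cases)
    show "calG_act \<alpha> r g (calG_act \<alpha> r h x) = calG_act \<alpha> r ((\<mu> * \<mu>', \<rho> * \<rho>'), K ** K', Zd_class \<alpha> (k v* K' + k')) x"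
      unfolding g(1) h(1) x(1) by (rule calG_act_compose[OF x(2,3) g(2-4) h(2-4)])
  qed
qed

lemma calG_act_inverse:
  assumes "g \<in> carrier (calG \<alpha>)"
  obtains h where "h \<in> carrier (calG \<alpha>)"
    "\<And>x. x \<in> topspace (scriptA_topology \<alpha> r) \<Longrightarrow> calG_act \<alpha> r h (calG_act \<alpha> r g x) = x"
proof -
  obtain \<mu> \<rho> K k where g: "g = ((\<mu>, \<rho>), K, Zd_class \<alpha> k)" "\<mu> > 0" "\<rho> \<noteq> 0" "K \<in> GL2Z"
    using assms(1) unfolding carrier_calG by blast
  obtain L where L: "L \<in> GL2Z" "K ** L = mat 1" "L ** K = mat 1" using g(4) by (rule GL2Z_inverse)
  \<comment> \<open>The last component is forced by the semidirect law: it must represent a vector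
    \<open>x\<close> with \<open>x v* K + k = 0\<close>.\<close>
  let ?h = "((1 / \<mu>, 1 / \<rho>), L, Zd_class \<alpha> (- (k v* L)))"
  have h: "1 / \<mu> > 0" "1 / \<rho> \<noteq> 0" using g by simp_all
  have k: "- (k v* L) v* K + k = 0"
  proof -
    have "k v* L v* K = k" by (simp add: vector_matrix_mul_assoc L)
    moreover have "- (k v* L) v* K = - (k v* L v* K)" by (simp add: coords2 algebra_simps)
    ultimately show ?thesis by simp
  qed
  show ?thesis
  proof (rule that[of ?h])
    show "?h \<in> carrier (calG \<alpha>)" unfolding carrier_calG using h L(1) by blast
    fix x assume "x \<in> topspace (scriptA_topology \<alpha> r)"
    then obtain a b e s where x: "x = pt r a b e s" "(a, b) \<in> compatible_pairs \<alpha>" "e \<in> norm_C r (NN \<alpha> a b)"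
      by (rule scriptA_cases)
    show "calG_act \<alpha> r ?h (calG_act \<alpha> r g x) = x"
      unfolding g(1) x(1) calG_act_compose[OF x(2,3) h L(1) g(2-4)] k L(3)
      using calG_act_id[OF x(2,3)] g by simp
  qed
qed

lemma calG_unit: "((1, 1), mat 1, Zd_class \<alpha> 0) \<in> carrier (calG \<alpha>)"
  unfolding carrier_calG by (metis GL2Z_mat1 zero_less_one zero_neq_one)

lemma calG_act_unit:
  assumes "x \<in> topspace (scriptA_topology \<alpha> r)"
  shows "calG_act \<alpha> r ((1, 1), mat 1, Zd_class \<alpha> 0) x = x"
  using assms calG_act_id by (metis scriptA_cases)

lemma orb_refl: "x \<in> topspace (scriptA_topology \<alpha> r) \<Longrightarrow> x \<in> orb \<alpha> r x"
  unfolding orbit_def by (metis (mono_tags, lifting) CollectI calG_unit calG_act_unit)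

lemma orb_act:
  assumes "x \<in> topspace (scriptA_topology \<alpha> r)" "g \<in> carrier (calG \<alpha>)"
  shows "orb \<alpha> r (calG_act \<alpha> r g x) = orb \<alpha> r x"
proof
  show "orb \<alpha> r (calG_act \<alpha> r g x) \<subseteq> orb \<alpha> r x"
    unfolding orbit_def using calG_act_trans[OF _ assms(2)] assms(1) by (smt (verit) mem_Collect_eq subsetI)
  obtain h where h: "h \<in> carrier (calG \<alpha>)" "calG_act \<alpha> r h (calG_act \<alpha> r g x) = x"
    using calG_act_inverse[OF assms(2)] assms(1) by metis
  show "orb \<alpha> r x \<subseteq> orb \<alpha> r (calG_act \<alpha> r g x)"
  proof
    fix y assume "y \<in> orb \<alpha> r x"
    then obtain f where f: "f \<in> carrier (calG \<alpha>)" "y = calG_act \<alpha> r f x" unfolding orbit_def by blast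
    obtain fh where "fh \<in> carrier (calG \<alpha>)"
      "\<And>x. x \<in> topspace (scriptA_topology \<alpha> r) \<Longrightarrow> calG_act \<alpha> r f (calG_act \<alpha> r h x) = calG_act \<alpha> r fh x"
      using calG_act_trans[OF f(1) h(1)] by metis
    then show "y \<in> orb \<alpha> r (calG_act \<alpha> r g x)"
      unfolding orbit_def using f h(2) calG_act_closed[OF assms(2,1)] by (metis (mono_tags, lifting) mem_Collect_eq)
  qed
qed

lemma orb_eq_iff:
  assumes "x \<in> topspace (scriptA_topology \<alpha> r)" "y \<in> topspace (scriptA_topology \<alpha> r)"
  shows "orb \<alpha> r x = orb \<alpha> r y \<longleftrightarrow> (\<exists>g \<in> carrier (calG \<alpha>). y = calG_act \<alpha> r g x)"
proof
  assume "orb \<alpha> r x = orb \<alpha> r y"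
  then have "y \<in> orb \<alpha> r x" using orb_refl assms by blast
  then show "\<exists>g \<in> carrier (calG \<alpha>). y = calG_act \<alpha> r g x" unfolding orbit_def by blast
next
  assume "\<exists>g \<in> carrier (calG \<alpha>). y = calG_act \<alpha> r g x"
  then show "orb \<alpha> r x = orb \<alpha> r y" using orb_act[OF assms(1)] by metis
qed

end

section \<open>Topology of the orbit space\<close>

lemma norm_rel_unique:
  assumes "norm_rel r N e p" "norm_rel r N e p'" "r \<ge> 1"
  shows "p = p'"
  using assms by (auto simp: norm_rel_def vec_eq_iff)

lemma pp_norm_form:
  assumes "wedge b a \<noteq> 0" "norm_rel r (NN \<alpha> a b) e p" "r \<ge> 1"
  shows "pp \<alpha> r a b (wedge b a *\<^sub>R e + half_diag a b) = p"
  unfolding pp_def is_p_iff_norm_rel[OF assms(1)]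
  using assms norm_rel_unique by (intro the_equality) blast+

text \<open>For determinant 1 the characteristic polynomial at 1 is
  \<open>2 - trace N\<close>.\<close>

lemma mat1_minus_inj:
  fixes N :: "int^2^2"
  assumes "det N = 1" "N $ 1 $ 1 + N $ 2 $ 2 \<noteq> 2"
    and "rmat (mat 1 - N) *v e = rmat (mat 1 - N) *v e'"
  shows "e = e'"
proof -
  have "det (mat 1 - N) = 2 - (N $ 1 $ 1 + N $ 2 $ 2)"
    using assms(1) by (simp add: coords2 algebra_simps)
  then have "det (rmat (mat 1 - N)) \<noteq> 0"
    using assms(2) unfolding det_rmat by simp
  then have "inj ((*v) (rmat (mat 1 - N)))"
    by (simp add: inj_matrix_vector_mult invertible_det_nz)
  then show ?thesis using assms(3) by (simp add: inj_eq)
qed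

text \<open>The purpose is local constancy: \<open>N\<close> and \<open>p\<close> are discrete
  invariants by the choice of the topology on \<open>TT\<close>, and together they determine
  \<open>e\<close>.\<close>

lemma norm_rel_inj:
  assumes "(a, b) \<in> compatible_pairs \<alpha>" "S_plus_admissible \<alpha>"
    "norm_rel r (NN \<alpha> a b) e p" "norm_rel r (NN \<alpha> a b) e' p"
  shows "e = e'"
proof (rule mat1_minus_inj)
  show "det (NN \<alpha> a b) = 1" using assms(1,2) by (rule compatible_NN_det_trace)
  show "NN \<alpha> a b $ 1 $ 1 + NN \<alpha> a b $ 2 $ 2 \<noteq> 2"
    using compatible_NN_det_trace(2)[OF assms(1,2)] S_plus_admissible_facts(3)[OF assms(2)] by simp
  show "rmat (mat 1 - NN \<alpha> a b) *v e = rmat (mat 1 - NN \<alpha> a b) *v e'"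
    using assms(3,4) by (simp add: norm_rel_def)
qed

text \<open>A matrix of determinant 1 preserves the wedge product, but multiplies that of two
  eigenvectors for \<open>\<beta>\<close> by \<open>\<beta> * \<beta>\<close>. As neither eigenvalue
  has square 1, eigenvectors for the same eigenvalue are parallel.\<close>

lemma same_NN_proportional:
  assumes "(a, b) \<in> compatible_pairs \<alpha>" "(a', b') \<in> compatible_pairs \<alpha>" "NN \<alpha> a b = NN \<alpha> a' b'"
    and "S_plus_admissible \<alpha>"
  obtains \<mu> \<rho> where "\<mu> \<noteq> 0" "\<rho> \<noteq> 0" "a' = \<mu> *\<^sub>R a" "b' = \<rho> *\<^sub>R b"
proof -
  have \<alpha>: "\<alpha> > 1" using assms(4) by (rule S_plus_admissible_facts)
  note N = compatible_NN[OF assms(1)] and N' = compatible_NN[OF assms(2)]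
  have det: "det (NN \<alpha> a b) = 1" using compatible_NN_det_trace[OF assms(1,4)] by simp
  have eig: "wedge x x' = 0" if "rmat (NN \<alpha> a b) *v x = \<beta> *\<^sub>R x" "rmat (NN \<alpha> a b) *v x' = \<beta> *\<^sub>R x'" "\<beta> * \<beta> \<noteq> 1" for x x' \<beta>
  proof -
    have "wedge x x' = wedge (\<beta> *\<^sub>R x) (\<beta> *\<^sub>R x')"
      using wedge_rmat[of "NN \<alpha> a b" x x'] det that by simp
    also have "\<dots> = (\<beta> * \<beta>) * wedge x x'" by (simp add: wedge_scale)
    finally have "(\<beta> * \<beta> - 1) * wedge x x' = 0" by (simp add: algebra_simps)
    then show ?thesis using that(3) by simp
  qed
  have "\<alpha> * \<alpha> > 1 * 1" using \<alpha> by (intro mult_strict_mono) auto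
  then have "wedge a a' = 0" using eig[of a \<alpha> a'] N N' assms(3) by simp
  moreover have "inverse \<alpha> * inverse \<alpha> < 1 * 1"
    using \<alpha> by (intro mult_strict_mono) (auto simp: inverse_less_1_iff)
  then have "wedge b b' = 0" using eig[of b "inverse \<alpha>" b'] N N' assms(3) by simp
  then have "wedge b' b = 0" by (simp add: wedge_def mult.commute)
  ultimately have ab: "a' = (wedge a' b / wedge a b) *\<^sub>R a" "b' = (wedge a b' / wedge a b) *\<^sub>R b"
    using wedge_basis[OF N(1), of a'] wedge_basis[OF N(1), of b'] by auto
  have nz: "a' \<noteq> 0" "b' \<noteq> 0" using N'(1) by (auto simp: wedge_def)
  show ?thesis
    by (rule that[OF _ _ ab]) (use ab nz in auto)
qed

lemma continuous_on_wedge [continuous_intros]: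
  "continuous_on S f \<Longrightarrow> continuous_on S g \<Longrightarrow> continuous_on S (\<lambda>x. wedge (f x) (g x))"
  unfolding wedge_def by (intro continuous_intros)

lemma continuous_map_TT_invariants:
  "continuous_map (AA_topology \<alpha> r) (discrete_topology UNIV) (\<lambda>((a, b, c), t). NN \<alpha> a b)"
  "continuous_map (AA_topology \<alpha> r) (discrete_topology UNIV) (\<lambda>((a, b, c), t). pp \<alpha> r a b c)"
  "continuous_map (AA_topology \<alpha> r) euclidean (\<lambda>((a, b, c), t). (a, b, t))"
proof -
  have *: "continuous_map (AA_topology \<alpha> r)
     (prod_topology (discrete_topology UNIV) (prod_topology (discrete_topology UNIV) euclidean))
     ((\<lambda>(a, b, c). (NN \<alpha> a b, pp \<alpha> r a b c, (a, b))) \<circ> fst)"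
    unfolding AA_topology_def TT_topology_def
    by (intro continuous_map_compose[OF continuous_map_fst] continuous_map_pullback[OF continuous_map_id, unfolded id_o])
  then show "continuous_map (AA_topology \<alpha> r) (discrete_topology UNIV) (\<lambda>((a, b, c), t). NN \<alpha> a b)"
    "continuous_map (AA_topology \<alpha> r) (discrete_topology UNIV) (\<lambda>((a, b, c), t). pp \<alpha> r a b c)"
    unfolding continuous_map_pairwise by (simp_all add: o_def case_prod_unfold)
  have 1: "continuous_map (AA_topology \<alpha> r) euclidean (\<lambda>((a, b, c), t). (a, b))"
    using * unfolding continuous_map_pairwise[of _ "discrete_topology UNIV"] by (simp add: o_def case_prod_unfold)
  have 2: "continuous_map (AA_topology \<alpha> r) euclidean (\<lambda>((a, b, c), t). a)"
    "continuous_map (AA_topology \<alpha> r) euclidean (\<lambda>((a, b, c), t). b)"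
  proof -
    have "continuous_map euclidean euclidean (fst :: (real^2) \<times> (real^2) \<Rightarrow> _)"
      "continuous_map euclidean euclidean (snd :: (real^2) \<times> (real^2) \<Rightarrow> _)"
      by (auto intro!: continuous_intros)
    from this[THEN continuous_map_compose[OF 1]]
    show "continuous_map (AA_topology \<alpha> r) euclidean (\<lambda>((a, b, c), t). a)"
      "continuous_map (AA_topology \<alpha> r) euclidean (\<lambda>((a, b, c), t). b)"
      by (simp_all add: o_def case_prod_unfold)
  qed
  have 3: "continuous_map (AA_topology \<alpha> r) euclidean (\<lambda>((a, b, c), t). t)"
    unfolding AA_topology_def using continuous_map_snd by (simp add: case_prod_unfold)
  show "continuous_map (AA_topology \<alpha> r) euclidean (\<lambda>((a, b, c), t). (a, b, t))"
    using continuous_map_pairedI[OF 2(1) continuous_map_pairedI[OF 2(2) 3]]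
    by (simp add: case_prod_unfold euclidean_product_topology)
qed

context
  fixes \<alpha> :: real and r :: nat
  assumes adm: "S_plus_admissible \<alpha>" and r: "r \<ge> 1"
begin

text \<open>The passages to classes and to orbits are merged, so that openness can be tested in the
  concrete space of \<open>AA_topology\<close>.\<close>

lemma openin_scriptQ:
  "openin (scriptQ_topology \<alpha> r) U \<longleftrightarrow>
     U \<subseteq> orb \<alpha> r ` topspace (scriptA_topology \<alpha> r) \<and>
     openin (AA_topology \<alpha> r) {x \<in> TT \<alpha> r \<times> UNIV. orb \<alpha> r (point_of r x) \<in> U}"
proof -
  have "{x \<in> topspace (AA_topology \<alpha> r). point_of r x \<in> {y \<in> topspace (scriptA_topology \<alpha> r). orb \<alpha> r y \<in> U}}
     = {x \<in> TT \<alpha> r \<times> UNIV. orb \<alpha> r (point_of r x) \<in> U}"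
    by (auto simp: topspace_AA scriptA_topology_def)
  moreover have "{y \<in> topspace (scriptA_topology \<alpha> r). orb \<alpha> r y \<in> U} \<subseteq> point_of r ` topspace (AA_topology \<alpha> r)"
    by (auto simp: scriptA_topology_def)
  ultimately show ?thesis
    unfolding scriptQ_topology_def openin_quotient_topology
    by (subst (2) scriptA_topology_def) (simp add: openin_quotient_topology)
qed

lemma continuous_map_orb_pt:
  assumes "(a, b) \<in> compatible_pairs \<alpha>" "e \<in> norm_C r (NN \<alpha> a b)"
  shows "continuous_map euclidean (scriptQ_topology \<alpha> r) (\<lambda>s. orb \<alpha> r (pt r a b e s))"
proof -
  let ?c = "wedge b a *\<^sub>R e + half_diag a b"
  have "(a, b, ?c) \<in> topspace (TT_topology \<alpha> r)"
    using assms CC_iff_norm_C[OF compatible_NN(2)[OF assms(1)]]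
    by (simp add: TT_topology_def topspace_pullback_topology TT_def)
  moreover have "continuous_map euclidean euclidean (\<lambda>s. complex_of_real (wedge b a) * s)"
    by (auto intro!: continuous_intros)
  ultimately have 1: "continuous_map euclidean (AA_topology \<alpha> r) (\<lambda>s. ((a, b, ?c), of_real (wedge b a) * s))"
    unfolding AA_topology_def by (intro continuous_map_pairedI) simp_all
  have 2: "continuous_map (AA_topology \<alpha> r) (scriptA_topology \<alpha> r) (point_of r)"
    unfolding scriptA_topology_def by (intro quotient_imp_continuous_map quotient_map_quotient_topology)
  have 3: "continuous_map (scriptA_topology \<alpha> r) (scriptQ_topology \<alpha> r) (orb \<alpha> r)"
    unfolding scriptQ_topology_def by (intro quotient_imp_continuous_map quotient_map_quotient_topology)
  show ?thesis
    using continuous_map_compose[OF continuous_map_compose[OF 1 2] 3] by (simp add: o_def pt_def)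
qed

text \<open>The preimage in \<open>AA_topology\<close> contains points over many pairs. Around one
  of them, \<open>x0\<close>, keeping the values of \<open>N\<close> and \<open>p\<close> leaves
  only rescalings of its pair, with the same \<open>e\<close>. What still varies is
  \<open>s\<close>, a continuous function of the pair and of \<open>t\<close>, and a group element
  relates it to the parameter over \<open>(a, b)\<close>.\<close>

lemma open_orb_pt:
  assumes ab: "(a, b) \<in> compatible_pairs \<alpha>" and e: "e \<in> norm_C r (NN \<alpha> a b)" and "open B"
  shows "openin (scriptQ_topology \<alpha> r) ((\<lambda>s. orb \<alpha> r (pt r a b e s)) ` B)"
  unfolding openin_scriptQ
proof
  let ?j = "\<lambda>s. orb \<alpha> r (pt r a b e s)"
  show "?j ` B \<subseteq> orb \<alpha> r ` topspace (scriptA_topology \<alpha> r)"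
    using pt_in_scriptA[OF ab e] by blast
  let ?V = "{x \<in> TT \<alpha> r \<times> UNIV. orb \<alpha> r (point_of r x) \<in> ?j ` B}"
  have "\<exists>W. openin (AA_topology \<alpha> r) W \<and> x0 \<in> W \<and> W \<subseteq> ?V" if "x0 \<in> ?V" for x0
  proof -
    obtain a0 b0 c0 t0 where x0: "x0 = ((a0, b0, c0), t0)" by (metis surj_pair)
    have c: "(a0, b0) \<in> compatible_pairs \<alpha>" "c0 \<in> CC \<alpha> r a0 b0"
      using that by (auto simp: x0 TT_def)
    note w0 = compatible_NN(2)[OF c(1)]
    obtain e0 where c0: "c0 = wedge b0 a0 *\<^sub>R e0 + half_diag a0 b0" using norm_form[OF w0] .
    then have e0: "e0 \<in> norm_C r (NN \<alpha> a0 b0)" using c(2) CC_iff_norm_C[OF w0] by simp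
    define s0 where "s0 = t0 / of_real (wedge b0 a0)"
    have "point_of r x0 = pt r a0 b0 e0 s0"
      unfolding x0 c0 s0_def by (rule point_of_norm_form[OF w0])
    then obtain s1 where s1: "s1 \<in> B" "orb \<alpha> r (pt r a b e s1) = orb \<alpha> r (pt r a0 b0 e0 s0)"
      using \<open>x0 \<in> ?V\<close> by force
    obtain g where g: "g \<in> carrier (calG \<alpha>)" "pt r a0 b0 e0 s0 = calG_act \<alpha> r g (pt r a b e s1)"
      using s1(2) orb_eq_iff[OF adm r pt_in_scriptA[OF ab e] pt_in_scriptA[OF c(1) e0]] by blast
    obtain \<mu> \<rho> K k where gd: "g = ((\<mu>, \<rho>), K, Zd_class \<alpha> k)" "\<mu> > 0" "\<rho> \<noteq> 0" "K \<in> GL2Z"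
      using g(1) unfolding carrier_calG by blast
    let ?\<epsilon> = "complex_of_int (det K)" and ?\<sigma> = "complex_of_real (shift_t \<alpha> a b k e)"
    have \<epsilon>: "?\<epsilon> * ?\<epsilon> = 1" using GL2Z_det[OF gd(4)] by auto
    note act = calG_act_pt[OF adm r ab e gd(2-4), of k, folded gd(1)]
    have a0: "a0 = \<mu> *\<^sub>R (rmat K *v a)" "b0 = \<rho> *\<^sub>R (rmat K *v b)"
      using arg_cong[OF g(2), of fst] arg_cong[OF g(2), of "\<lambda>x. fst (snd x)"] unfolding act fst_pt by auto
    obtain m n where mn: "e0 = trans_e \<alpha> a b K k e + (1 / real r) *\<^sub>R rvec m"
      "s0 = ?\<epsilon> * (s1 + ?\<sigma>) + of_int n / of_nat r"
      using g(2) unfolding act a0[symmetric] pt_eq_iff[OF w0] by blast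
    obtain p0 where p0: "norm_rel r (NN \<alpha> a0 b0) e0 p0" using e0 norm_C_iff by blast
    have pp0: "pp \<alpha> r a0 b0 c0 = p0" unfolding c0 by (rule pp_norm_form[OF w0 p0 r])
    \<comment> \<open>The first scaling factor in the group is positive, and a positive inner
      product with \<open>a0\<close> excludes the negative multiples of \<open>a0\<close>. The
      second condition keeps the divisor in \<open>f\<close> different from zero.\<close>
    define E0 where "E0 = {z :: (real^2) \<times> (real^2) \<times> complex. fst z \<bullet> a0 > 0 \<and> wedge (fst (snd z)) (fst z) \<noteq> 0}"
    \<comment> \<open>Up to a multiple of \<open>1 / r\<close>, \<open>g\<close> sends
      \<open>s1\<close> to \<open>s0\<close> with slope \<open>?\<epsilon>\<close>, which is its own
      inverse. So \<open>f\<close> pulls the normalised coordinate of a nearby point back along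
      \<open>g\<close> to a parameter near \<open>s1\<close>.\<close>
    define f where "f z = s1 + ?\<epsilon> * (snd (snd z) / of_real (wedge (fst (snd z)) (fst z)) - s0)"
      for z :: "(real^2) \<times> (real^2) \<times> complex"
    have "open E0"
      unfolding E0_def by (intro open_Collect_conj open_Collect_less open_Collect_neq continuous_intros)
    moreover have "continuous_on E0 f"
      unfolding f_def E0_def by (intro continuous_intros) auto
    ultimately have E: "open (E0 \<inter> f -` B)"
      using \<open>open B\<close> by (metis continuous_open_preimage)
    define W where "W = {x \<in> topspace (AA_topology \<alpha> r). (\<lambda>((a', b', c'), t'). NN \<alpha> a' b') x \<in> {NN \<alpha> a0 b0}}
      \<inter> {x \<in> topspace (AA_topology \<alpha> r). (\<lambda>((a', b', c'), t'). pp \<alpha> r a' b' c') x \<in> {p0}}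
      \<inter> {x \<in> topspace (AA_topology \<alpha> r). (\<lambda>((a', b', c'), t'). (a', b', t')) x \<in> E0 \<inter> f -` B}"
    have "openin (AA_topology \<alpha> r) W"
    proof -
      have "openin (discrete_topology UNIV) {NN \<alpha> a0 b0}" "openin (discrete_topology UNIV) {p0}" "openin euclidean (E0 \<inter> f -` B)"
        using E by simp_all
      note this[THEN openin_continuous_map_preimage[rotated]]
      from this(1)[OF continuous_map_TT_invariants(1)] this(2)[OF continuous_map_TT_invariants(2)]
        this(3)[OF continuous_map_TT_invariants(3)]
      show ?thesis unfolding W_def by (intro openin_Int) assumption+
    qed
    moreover have "x0 \<in> W"
    proof -
      have "a0 \<noteq> 0" using w0 by (auto simp: wedge_def)
      then have "(a0, b0, t0) \<in> E0" using w0 by (simp add: E0_def)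
      moreover have "f (a0, b0, t0) = s1" by (simp add: f_def s0_def)
      ultimately show ?thesis
        using that s1(1) pp0 by (simp add: W_def x0 topspace_AA)
    qed
    moreover have "W \<subseteq> ?V"
    proof
      fix x assume "x \<in> W"
      obtain a' b' c' t' where x: "x = ((a', b', c'), t')" by (metis surj_pair)
      have xT: "x \<in> TT \<alpha> r \<times> UNIV" using \<open>x \<in> W\<close> by (simp add: W_def topspace_AA)
      then have c': "(a', b') \<in> compatible_pairs \<alpha>" "c' \<in> CC \<alpha> r a' b'" by (auto simp: x TT_def)
      have N': "NN \<alpha> a0 b0 = NN \<alpha> a' b'" and p': "pp \<alpha> r a' b' c' = p0"
        and E': "(a', b', t') \<in> E0" and B': "f (a', b', t') \<in> B"
        using \<open>x \<in> W\<close> by (simp_all add: W_def x)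
      note w' = compatible_NN(2)[OF c'(1)]
      obtain e' where e': "c' = wedge b' a' *\<^sub>R e' + half_diag a' b'" using norm_form[OF w'] .
      then have "e' \<in> norm_C r (NN \<alpha> a' b')" using c'(2) CC_iff_norm_C[OF w'] by simp
      then have "norm_rel r (NN \<alpha> a' b') e' p0"
        using pp_norm_form[OF w' _ r] p' e' norm_C_iff by metis
      then have "e' = e0" using norm_rel_inj[OF c(1) adm] p0 N' by metis
      obtain \<nu> \<tau> where \<nu>: "\<nu> \<noteq> 0" "\<tau> \<noteq> 0" "a' = \<nu> *\<^sub>R a0" "b' = \<tau> *\<^sub>R b0"
        using same_NN_proportional[OF c(1) c'(1) N' adm] .
      have "\<nu> * (a0 \<bullet> a0) > 0" using E' by (simp add: E0_def \<nu>)
      then have "\<nu> > 0" by (metis inner_ge_zero not_less zero_less_mult_iff)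
      define s' where "s' = t' / of_real (wedge b' a')"
      define s2 where "s2 = s1 + ?\<epsilon> * (s' - s0)"
      have "s2 \<in> B" using B' by (simp add: f_def s2_def s'_def)
      have "point_of r x = pt r a' b' e0 s'"
        unfolding x e' s'_def \<open>e' = e0\<close>[symmetric] by (rule point_of_norm_form[OF w'])
      also have "\<dots> = calG_act \<alpha> r ((\<nu>, \<tau>), mat 1, Zd_class \<alpha> 0) (pt r a0 b0 e0 s')"
        using calG_act_pt[OF adm r c(1) e0 \<open>\<nu> > 0\<close> \<nu>(2) GL2Z_mat1, of 0] \<nu>(3,4)
        by (simp add: trans_e_def)
      finally have "orb \<alpha> r (point_of r x) = orb \<alpha> r (pt r a0 b0 e0 s')"
        using orb_act[OF adm r pt_in_scriptA[OF c(1) e0], of "((\<nu>, \<tau>), mat 1, Zd_class \<alpha> 0)"]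
          \<open>\<nu> > 0\<close> \<nu>(2) GL2Z_mat1 unfolding carrier_calG by metis
      moreover have "pt r a0 b0 e0 s' = calG_act \<alpha> r g (pt r a b e s2)"
        unfolding act a0[symmetric] pt_eq_iff[OF w0]
      proof
        show "\<exists>m. e0 = trans_e \<alpha> a b K k e + (1 / real r) *\<^sub>R rvec m" using mn(1) by blast
        have "?\<epsilon> * (s2 + ?\<sigma>) = ?\<epsilon> * (s1 + ?\<sigma>) + (?\<epsilon> * ?\<epsilon>) * (s' - s0)"
          by (simp add: s2_def algebra_simps)
        then have "s' = ?\<epsilon> * (s2 + ?\<sigma>) + of_int n / of_nat r"
          unfolding \<epsilon> using mn(2) by simp
        then show "\<exists>n::int. s' = ?\<epsilon> * (s2 + ?\<sigma>) + of_int n / of_nat r" by blast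
      qed
      ultimately have "orb \<alpha> r (point_of r x) = ?j s2"
        using orb_act[OF adm r pt_in_scriptA[OF ab e] g(1)] by metis
      then show "x \<in> ?V" using xT \<open>s2 \<in> B\<close> by blast
    qed
    ultimately show ?thesis by blast
  qed
  then show "openin (AA_topology \<alpha> r) ?V"
    by (subst openin_subopen) blast
qed

end

section \<open>The fibres of \<open>Phi\<close> and their connected components\<close>

lemma connected_components_of_open_partition:
  assumes "\<Union>\<U> = topspace X" "pairwise disjnt \<U>"
    and "\<And>U. U \<in> \<U> \<Longrightarrow> openin X U \<and> connectedin X U \<and> U \<noteq> {}"
  shows "connected_components_of X = \<U>"
proof -
  have comp: "connected_component_of_set X x = U" if "U \<in> \<U>" "x \<in> U" for U x
  proof
    let ?C = "connected_component_of_set X x"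
    show "U \<subseteq> ?C" using assms(3)[OF that(1)] that(2) by (simp add: connected_component_of_maximal)
    let ?V = "\<Union>(\<U> - {U})"
    have V: "openin X ?V" using assms(3) by blast
    have cover: "?C \<subseteq> U \<union> ?V"
      using connected_component_of_subset_topspace[of X x] unfolding assms(1)[symmetric] by blast
    have "U \<inter> ?V = {}"
      using assms(2) that(1) by (fastforce simp: pairwise_def disjnt_def)
    then have disj: "U \<inter> ?V \<inter> ?C = {}" by simp
    have "\<not> (\<exists>E1 E2. openin X E1 \<and> openin X E2 \<and> ?C \<subseteq> E1 \<union> E2 \<and> E1 \<inter> E2 \<inter> ?C = {} \<and>
        E1 \<inter> ?C \<noteq> {} \<and> E2 \<inter> ?C \<noteq> {})"
      using connectedin_connected_component_of[of X x] unfolding connectedin by (rule conjunct2)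
    then have "U \<inter> ?C = {} \<or> ?V \<inter> ?C = {}"
      using assms(3)[OF that(1)] V cover disj by metis
    moreover have "x \<in> U \<inter> ?C"
      using that \<open>U \<subseteq> ?C\<close> by blast
    ultimately show "?C \<subseteq> U" using cover by blast
  qed
  show ?thesis
  proof
    show "connected_components_of X \<subseteq> \<U>"
      unfolding connected_components_of_def assms(1)[symmetric] using comp by blast
    show "\<U> \<subseteq> connected_components_of X"
    proof
      fix U assume U: "U \<in> \<U>"
      then obtain x where "x \<in> U" using assms(3) by blast
      then show "U \<in> connected_components_of X"
        unfolding connected_components_of_def assms(1)[symmetric] using comp[OF U] U by blast
    qed
  qed
qed

abbreviation "cls r a b e \<equiv> c_class r a b (wedge b a *\<^sub>R e + half_diag a b)"

lemma pt_eq_tuple: "pt r a b e s = (a, b, cls r a b e, t_class r a b (of_real (wedge b a) * s))"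
  by (simp add: pt_def point_of_def)

lemma tuple_eq_pt:
  "wedge b a \<noteq> 0 \<Longrightarrow> (a, b, cls r a b e, t_class r a b t) = pt r a b e (t / of_real (wedge b a))"
  by (simp add: pt_eq_tuple)

context
  fixes \<alpha> :: real and r :: nat and a b :: "real^2"
  assumes adm: "S_plus_admissible \<alpha>" and r: "r \<ge> 1" and ab: "(a, b) \<in> compatible_pairs \<alpha>"
begin

lemma pair_act_fst:
  assumes "(a', b') \<in> compatible_pairs \<alpha>" "e \<in> norm_C r (NN \<alpha> a' b')" "g \<in> carrier (calG \<alpha>)"
  shows "pair_act g (a', b') = (fst (calG_act \<alpha> r g (pt r a' b' e s)), fst (snd (calG_act \<alpha> r g (pt r a' b' e s))))"
proof -
  obtain \<mu> \<rho> K k where g: "g = ((\<mu>, \<rho>), K, Zd_class \<alpha> k)" "\<mu> > 0" "\<rho> \<noteq> 0" "K \<in> GL2Z"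
    using assms(3) unfolding carrier_calG by blast
  show ?thesis unfolding g(1) calG_act_pt[OF adm r assms(1,2) g(2-4)] fst_pt by (simp add: pair_act_def)
qed

lemma calG_act_pt_stab:
  assumes "e \<in> norm_C r (NN \<alpha> a b)" "g \<in> carrier (stab_pair \<alpha> a b)"
  obtains K k where "K \<in> GL2Z" "trans_e \<alpha> a b K k e \<in> norm_C r (NN \<alpha> a b)"
    "\<And>s. calG_act \<alpha> r g (pt r a b e s)
      = pt r a b (trans_e \<alpha> a b K k e) (of_int (det K) * (s + of_real (shift_t \<alpha> a b k e)))"
proof -
  have g': "g \<in> carrier (calG \<alpha>)" "pair_act g (a, b) = (a, b)"
    using assms(2) by (auto simp: stab_pair_def stabilizer_def)
  obtain \<mu> \<rho> K k where g: "g = ((\<mu>, \<rho>), K, Zd_class \<alpha> k)" "\<mu> > 0" "\<rho> \<noteq> 0" "K \<in> GL2Z"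
    using g'(1) unfolding carrier_calG by blast
  have K: "\<mu> *\<^sub>R (rmat K *v a) = a" "\<rho> *\<^sub>R (rmat K *v b) = b"
    using g'(2) by (simp_all add: g(1) pair_act_def)
  have "\<mu> \<noteq> 0" using g by simp
  show ?thesis
    using calG_act_pt[OF adm r ab assms(1) g(2-4), of k] trans_e_norm_C[OF adm r ab assms(1) g(4) \<open>\<mu> \<noteq> 0\<close> g(3), of k]
    unfolding K g(1)[symmetric] by (intro that[OF g(4)])
qed

lemma stab_pairI:
  assumes "g \<in> carrier (calG \<alpha>)" "e \<in> norm_C r (NN \<alpha> a b)" "calG_act \<alpha> r g (pt r a b e s) = pt r a b e' s'"
  shows "g \<in> carrier (stab_pair \<alpha> a b)"
  using pair_act_fst[OF ab assms(2,1), of s] assms(1,3) by (simp add: stab_pair_def stabilizer_def fst_pt)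

text \<open>A group element that takes one point over \<open>e\<close> to one over \<open>e'\<close>
  does so for the whole parameter line, by an affine map of slope \<open>det K\<close>. This is why
  two images of the plane in the orbit space coincide as soon as they meet.\<close>

lemma calG_act_pt_shift:
  assumes "g \<in> carrier (calG \<alpha>)" "e \<in> norm_C r (NN \<alpha> a b)" "calG_act \<alpha> r g (pt r a b e s) = pt r a b e' s'"
  obtains \<epsilon> :: int where "\<epsilon> = 1 \<or> \<epsilon> = -1"
    "\<And>s2. calG_act \<alpha> r g (pt r a b e s2) = pt r a b e' (s' + of_int \<epsilon> * (s2 - s))"
proof -
  obtain K k where K: "K \<in> GL2Z" and act: "\<And>s. calG_act \<alpha> r g (pt r a b e s)
      = pt r a b (trans_e \<alpha> a b K k e) (of_int (det K) * (s + of_real (shift_t \<alpha> a b k e)))"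
    using calG_act_pt_stab[OF assms(2) stab_pairI[OF assms]] by metis
  note w = compatible_NN(2)[OF ab]
  obtain m n where m: "trans_e \<alpha> a b K k e = e' + (1 / real r) *\<^sub>R rvec m"
    and n: "of_int (det K) * (s + of_real (shift_t \<alpha> a b k e)) = s' + of_int n / of_nat r"
    using assms(3) unfolding act pt_eq_iff[OF w] by blast
  have eq: "of_int (det K) * (s2 + of_real (shift_t \<alpha> a b k e)) = s' + of_int (det K) * (s2 - s) + of_int n / of_nat r" for s2
    using n by (simp add: algebra_simps)
  show ?thesis
    by (rule that[OF GL2Z_det[OF K]], unfold act, rule pt_eqI[OF m eq])
qed

lemma orb_pt_range_eq:
  assumes "e \<in> norm_C r (NN \<alpha> a b)" "e' \<in> norm_C r (NN \<alpha> a b)"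
    and "orb \<alpha> r (pt r a b e s) = orb \<alpha> r (pt r a b e' s')"
  shows "range (\<lambda>s. orb \<alpha> r (pt r a b e s)) = range (\<lambda>s. orb \<alpha> r (pt r a b e' s))"
proof -
  have "range (\<lambda>s. orb \<alpha> r (pt r a b e s)) \<subseteq> range (\<lambda>s. orb \<alpha> r (pt r a b e' s))"
    if e: "e \<in> norm_C r (NN \<alpha> a b)" and e': "e' \<in> norm_C r (NN \<alpha> a b)"
      and eq: "orb \<alpha> r (pt r a b e s) = orb \<alpha> r (pt r a b e' s')" for e e' s s'
  proof -
    obtain g where g: "g \<in> carrier (calG \<alpha>)" "pt r a b e' s' = calG_act \<alpha> r g (pt r a b e s)"
      using eq orb_eq_iff[OF adm r pt_in_scriptA[OF ab e] pt_in_scriptA[OF ab e']] by blast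
    obtain \<epsilon> :: int where \<epsilon>: "\<And>s2. calG_act \<alpha> r g (pt r a b e s2) = pt r a b e' (s' + of_int \<epsilon> * (s2 - s))"
      using calG_act_pt_shift[OF g(1) e g(2)[symmetric]] by metis
    have "orb \<alpha> r (pt r a b e s2) = orb \<alpha> r (pt r a b e' (s' + of_int \<epsilon> * (s2 - s)))" for s2
      unfolding \<epsilon>[symmetric] using orb_act[OF adm r pt_in_scriptA[OF ab e] g(1)] by simp
    then show ?thesis by blast
  qed
  from this[OF assms] this[OF assms(2,1) assms(3)[symmetric]] show ?thesis by blast
qed

text \<open>\<open>c_act\<close> takes a common value over all \<open>t\<close>; the preceding
  affine description shows that the class of \<open>c\<close> obtained does not depend on
  \<open>t\<close>.\<close>

lemma c_act_cls:
  assumes "e \<in> norm_C r (NN \<alpha> a b)" "calG_act \<alpha> r g (pt r a b e s) = pt r a b e' s'" "g \<in> carrier (calG \<alpha>)"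
  shows "c_act \<alpha> r a b g (cls r a b e) = cls r a b e'"
proof -
  obtain \<epsilon> :: int where \<epsilon>: "\<And>s2. calG_act \<alpha> r g (pt r a b e s2) = pt r a b e' (s' + of_int \<epsilon> * (s2 - s))"
    using calG_act_pt_shift[OF assms(3,1,2)] by metis
  show ?thesis
    unfolding c_act_def tuple_eq_pt[OF compatible_NN(2)[OF ab]] \<epsilon> by (simp add: pt_eq_tuple)
qed

lemma orb_pt_eqE:
  assumes "e \<in> norm_C r (NN \<alpha> a b)" "e' \<in> norm_C r (NN \<alpha> a b)"
    and "orb \<alpha> r (pt r a b e s) = orb \<alpha> r (pt r a b e' s')"
  obtains g where "g \<in> carrier (stab_pair \<alpha> a b)" "calG_act \<alpha> r g (pt r a b e s) = pt r a b e' s'"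
proof -
  obtain g where "g \<in> carrier (calG \<alpha>)" "pt r a b e' s' = calG_act \<alpha> r g (pt r a b e s)"
    using assms(3) orb_eq_iff[OF adm r pt_in_scriptA[OF ab assms(1)] pt_in_scriptA[OF ab assms(2)]] by blast
  then show ?thesis using stab_pairI[OF _ assms(1)] that by metis
qed

text \<open>The orbit of a class under the stabiliser is recovered from a subset of the orbit space,
  without reference to group elements. This links orbits of classes with components in both
  directions.\<close>

lemma c_orbit_cls:
  assumes "e \<in> norm_C r (NN \<alpha> a b)"
  shows "c_orbit \<alpha> r a b (cls r a b e) = {cls r a b e' | e'. e' \<in> norm_C r (NN \<alpha> a b) \<and>
     (\<exists>s. orb \<alpha> r (pt r a b e' s) \<in> range (\<lambda>s. orb \<alpha> r (pt r a b e s)))}"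
proof (intro subset_antisym subsetI)
  fix X assume "X \<in> c_orbit \<alpha> r a b (cls r a b e)"
  then obtain g where g: "g \<in> carrier (stab_pair \<alpha> a b)" "X = c_act \<alpha> r a b g (cls r a b e)"
    unfolding c_orbit_def orbit_def by blast
  have g': "g \<in> carrier (calG \<alpha>)" using g(1) by (simp add: stab_pair_def stabilizer_def)
  obtain K k where e': "trans_e \<alpha> a b K k e \<in> norm_C r (NN \<alpha> a b)"
    and act: "calG_act \<alpha> r g (pt r a b e 0)
      = pt r a b (trans_e \<alpha> a b K k e) (of_int (det K) * (0 + of_real (shift_t \<alpha> a b k e)))"
    using calG_act_pt_stab[OF assms g(1)] by metis
  have "X = cls r a b (trans_e \<alpha> a b K k e)"
    unfolding g(2) by (rule c_act_cls[OF assms act g'])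
  moreover have "orb \<alpha> r (pt r a b (trans_e \<alpha> a b K k e) (of_int (det K) * (0 + of_real (shift_t \<alpha> a b k e)))) \<in>
      range (\<lambda>s. orb \<alpha> r (pt r a b e s))"
    unfolding act[symmetric] orb_act[OF adm r pt_in_scriptA[OF ab assms] g'] by blast
  ultimately show "X \<in> {cls r a b e' | e'. e' \<in> norm_C r (NN \<alpha> a b) \<and>
     (\<exists>s. orb \<alpha> r (pt r a b e' s) \<in> range (\<lambda>s. orb \<alpha> r (pt r a b e s)))}"
    using e' by blast
next
  fix X assume "X \<in> {cls r a b e' | e'. e' \<in> norm_C r (NN \<alpha> a b) \<and>
     (\<exists>s. orb \<alpha> r (pt r a b e' s) \<in> range (\<lambda>s. orb \<alpha> r (pt r a b e s)))}"
  then obtain e' s s' where e': "X = cls r a b e'" "e' \<in> norm_C r (NN \<alpha> a b)"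
    "orb \<alpha> r (pt r a b e s) = orb \<alpha> r (pt r a b e' s')" by auto
  obtain g where g: "g \<in> carrier (stab_pair \<alpha> a b)" "calG_act \<alpha> r g (pt r a b e s) = pt r a b e' s'"
    using orb_pt_eqE[OF assms e'(2,3)] .
  have g': "g \<in> carrier (calG \<alpha>)" using g(1) by (simp add: stab_pair_def stabilizer_def)
  have "X = c_act \<alpha> r a b g (cls r a b e)"
    unfolding e'(1) using c_act_cls[OF assms g(2) g'] by simp
  then show "X \<in> c_orbit \<alpha> r a b (cls r a b e)"
    unfolding c_orbit_def orbit_def using g(1) by blast
qed

lemma component_cls:
  assumes "e \<in> norm_C r (NN \<alpha> a b)"
  shows "component \<alpha> r a b (c_orbit \<alpha> r a b (cls r a b e)) = range (\<lambda>s. orb \<alpha> r (pt r a b e s))"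
proof (intro subset_antisym subsetI)
  note w = compatible_NN(2)[OF ab]
  fix \<omega> assume "\<omega> \<in> component \<alpha> r a b (c_orbit \<alpha> r a b (cls r a b e))"
  then obtain X t where X: "X \<in> c_orbit \<alpha> r a b (cls r a b e)" "\<omega> = orb \<alpha> r (a, b, X, t_class r a b t)"
    unfolding component_def by blast
  then obtain e' s where e': "X = cls r a b e'" "e' \<in> norm_C r (NN \<alpha> a b)"
     "orb \<alpha> r (pt r a b e' s) \<in> range (\<lambda>s. orb \<alpha> r (pt r a b e s))"
    unfolding c_orbit_cls[OF assms] by blast
  then have "range (\<lambda>s. orb \<alpha> r (pt r a b e s)) = range (\<lambda>s. orb \<alpha> r (pt r a b e' s))"
    using orb_pt_range_eq[OF assms e'(2)] by blast
  then show "\<omega> \<in> range (\<lambda>s. orb \<alpha> r (pt r a b e s))"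
    unfolding X(2) e'(1) tuple_eq_pt[OF w] by blast
next
  fix \<omega> assume "\<omega> \<in> range (\<lambda>s. orb \<alpha> r (pt r a b e s))"
  then obtain s where s: "\<omega> = orb \<alpha> r (pt r a b e s)" by blast
  moreover have "cls r a b e \<in> c_orbit \<alpha> r a b (cls r a b e)"
    unfolding c_orbit_cls[OF assms] using assms by blast
  ultimately show "\<omega> \<in> component \<alpha> r a b (c_orbit \<alpha> r a b (cls r a b e))"
    unfolding component_def pt_eq_tuple by blast
qed

lemma scriptC_eq: "scriptC \<alpha> r a b = cls r a b ` norm_C r (NN \<alpha> a b)"
proof -
  note w = compatible_NN(2)[OF ab]
  have "CC \<alpha> r a b = (\<lambda>e. wedge b a *\<^sub>R e + half_diag a b) ` norm_C r (NN \<alpha> a b)"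
  proof (intro subset_antisym subsetI)
    fix c assume c: "c \<in> CC \<alpha> r a b"
    obtain e where "c = wedge b a *\<^sub>R e + half_diag a b" using norm_form[OF w] .
    then show "c \<in> (\<lambda>e. wedge b a *\<^sub>R e + half_diag a b) ` norm_C r (NN \<alpha> a b)"
      using c CC_iff_norm_C[OF w] by blast
  qed (use CC_iff_norm_C[OF w] in blast)
  then show ?thesis unfolding scriptC_def by (simp add: image_image)
qed

text \<open>Projecting the orbit of a point to its first two entries gives the orbit of its pair.
  The projection depends on the orbit only, so all its members yield the same value in the
  definition of \<open>Phi\<close>.\<close>

lemma Phi_orb_pt:
  assumes "(a', b') \<in> compatible_pairs \<alpha>" "e \<in> norm_C r (NN \<alpha> a' b')"
  shows "Phi \<alpha> (orb \<alpha> r (pt r a' b' e s)) = orbit (calG \<alpha>) pair_act (a', b')"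
    "orbit (calG \<alpha>) pair_act (a', b') = (\<lambda>x. (fst x, fst (snd x))) ` orb \<alpha> r (pt r a' b' e s)"
proof -
  let ?f = "\<lambda>x. (fst x, fst (snd x))"
  have po: "orbit (calG \<alpha>) pair_act (a', b') = (\<lambda>x. (fst x, fst (snd x))) ` orb \<alpha> r (pt r a' b' e s)"
    if "(a', b') \<in> compatible_pairs \<alpha>" "e \<in> norm_C r (NN \<alpha> a' b')" for a' b' e s
    unfolding orbit_def setcompr_eq_image Collect_mem_eq image_image
    by (rule image_cong[OF refl], rule pair_act_fst[OF that])
  then show "orbit (calG \<alpha>) pair_act (a', b') = ?f ` orb \<alpha> r (pt r a' b' e s)" using assms by blast
  have x: "pt r a' b' e s \<in> topspace (scriptA_topology \<alpha> r)" using assms by (rule pt_in_scriptA)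
  have eq: "(case y of (a, b, X, T) \<Rightarrow> orbit (calG \<alpha>) pair_act (a, b)) = ?f ` orb \<alpha> r (pt r a' b' e s)"
    if y: "y \<in> orb \<alpha> r (pt r a' b' e s)" for y
  proof -
    obtain g where g: "g \<in> carrier (calG \<alpha>)" "y = calG_act \<alpha> r g (pt r a' b' e s)"
      using y unfolding orbit_def by blast
    have "y \<in> topspace (scriptA_topology \<alpha> r)" unfolding g(2) by (rule calG_act_closed[OF adm r g(1) x])
    then obtain a2 b2 e2 s2 where y: "y = pt r a2 b2 e2 s2" "(a2, b2) \<in> compatible_pairs \<alpha>" "e2 \<in> norm_C r (NN \<alpha> a2 b2)"
      by (rule scriptA_cases)
    have "orb \<alpha> r (pt r a2 b2 e2 s2) = orb \<alpha> r (pt r a' b' e s)"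
      using orb_act[OF adm r x g(1)] unfolding g(2)[symmetric] y(1) .
    then show ?thesis using po[OF y(2,3), of s2] unfolding y(1) by (simp add: pt_eq_tuple)
  qed
  have x': "pt r a' b' e s \<in> orb \<alpha> r (pt r a' b' e s)" using orb_refl[OF adm r x] .
  have "Phi \<alpha> (orb \<alpha> r (pt r a' b' e s)) = ?f ` orb \<alpha> r (pt r a' b' e s)"
    unfolding Phi_def using the_elem_image_unique[of "orb \<alpha> r (pt r a' b' e s)"] eq x' by (metis (no_types, lifting) empty_iff)
  then show "Phi \<alpha> (orb \<alpha> r (pt r a' b' e s)) = orbit (calG \<alpha>) pair_act (a', b')"
    using po[OF assms] by simp
qed

text \<open>A point of the fibre may be given over another pair of the same orbit; a group element
  moves it over \<open>(a, b)\<close> itself.\<close>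

lemma Phi_fibre_eq:
  "Phi_fibre \<alpha> r a b = (\<Union>e \<in> norm_C r (NN \<alpha> a b). range (\<lambda>s. orb \<alpha> r (pt r a b e s)))"
proof (intro subset_antisym subsetI)
  fix \<omega> assume \<omega>: "\<omega> \<in> Phi_fibre \<alpha> r a b"
  then obtain x where x: "x \<in> topspace (scriptA_topology \<alpha> r)" "\<omega> = orb \<alpha> r x"
    by (auto simp: Phi_fibre_def scriptQ_topology_def)
  from x(1) obtain a' b' e' s' where x': "x = pt r a' b' e' s'" "(a', b') \<in> compatible_pairs \<alpha>" "e' \<in> norm_C r (NN \<alpha> a' b')"
    by (rule scriptA_cases)
  have "pair_act ((1, 1), mat 1, Zd_class \<alpha> 0) (a, b) = (a, b)" by (simp add: pair_act_def)
  then have "(a, b) \<in> orbit (calG \<alpha>) pair_act (a, b)"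
    unfolding orbit_def using calG_unit[OF adm r] by (metis (mono_tags, lifting) CollectI)
  also have "orbit (calG \<alpha>) pair_act (a, b) = (\<lambda>x. (fst x, fst (snd x))) ` orb \<alpha> r (pt r a' b' e' s')"
    using \<omega> Phi_orb_pt[OF x'(2,3)] unfolding Phi_fibre_def x(2) x'(1) by auto
  finally obtain y where y: "y \<in> orb \<alpha> r x" "fst y = a" "fst (snd y) = b" unfolding x'(1) by auto
  then obtain g where g: "g \<in> carrier (calG \<alpha>)" "y = calG_act \<alpha> r g x" unfolding orbit_def by blast
  have "y \<in> topspace (scriptA_topology \<alpha> r)" unfolding g(2) by (rule calG_act_closed[OF adm r g(1) x(1)])
  then obtain a2 b2 e2 s2 where y2: "y = pt r a2 b2 e2 s2" "(a2, b2) \<in> compatible_pairs \<alpha>" "e2 \<in> norm_C r (NN \<alpha> a2 b2)"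
    by (rule scriptA_cases)
  have "a2 = a" "b2 = b" using y(2,3) unfolding y2(1) fst_pt by auto
  moreover have "\<omega> = orb \<alpha> r y" unfolding x(2) g(2) using orb_act[OF adm r x(1) g(1)] by simp
  ultimately show "\<omega> \<in> (\<Union>e \<in> norm_C r (NN \<alpha> a b). range (\<lambda>s. orb \<alpha> r (pt r a b e s)))"
    using y2 by blast
next
  fix \<omega> assume "\<omega> \<in> (\<Union>e \<in> norm_C r (NN \<alpha> a b). range (\<lambda>s. orb \<alpha> r (pt r a b e s)))"
  then obtain e s where e: "e \<in> norm_C r (NN \<alpha> a b)" "\<omega> = orb \<alpha> r (pt r a b e s)" by blast
  show "\<omega> \<in> Phi_fibre \<alpha> r a b"
    using Phi_orb_pt(1)[OF ab e(1)] pt_in_scriptA[OF ab e(1)]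
    unfolding Phi_fibre_def e(2) scriptQ_topology_def by simp
qed

text \<open>Each image of the plane is connected by continuity and open by
  \<open>open_orb_pt\<close>, and two of them are equal or disjoint by
  \<open>orb_pt_range_eq\<close>.\<close>

lemma connected_components_fibre:
  "connected_components_of (subtopology (scriptQ_topology \<alpha> r) (Phi_fibre \<alpha> r a b))
     = (\<lambda>e. range (\<lambda>s. orb \<alpha> r (pt r a b e s))) ` norm_C r (NN \<alpha> a b)"
proof (rule connected_components_of_open_partition)
  let ?Q = "scriptQ_topology \<alpha> r" and ?F = "Phi_fibre \<alpha> r a b"
  let ?R = "\<lambda>e. range (\<lambda>s. orb \<alpha> r (pt r a b e s))"
  have "?F \<subseteq> topspace ?Q" by (auto simp: Phi_fibre_def)
  then show "\<Union>(?R ` norm_C r (NN \<alpha> a b)) = topspace (subtopology ?Q ?F)"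
    using Phi_fibre_eq by auto
  show "pairwise disjnt (?R ` norm_C r (NN \<alpha> a b))"
  proof (rule pairwiseI)
    fix U V assume "U \<in> ?R ` norm_C r (NN \<alpha> a b)" "V \<in> ?R ` norm_C r (NN \<alpha> a b)" "U \<noteq> V"
    then obtain e e' where e: "U = ?R e" "V = ?R e'" "e \<in> norm_C r (NN \<alpha> a b)" "e' \<in> norm_C r (NN \<alpha> a b)" by blast
    show "disjnt U V"
      using orb_pt_range_eq[OF e(3,4)] \<open>U \<noteq> V\<close> unfolding e(1,2) disjnt_def by blast
  qed
  fix U assume "U \<in> ?R ` norm_C r (NN \<alpha> a b)"
  then obtain e where e: "U = ?R e" "e \<in> norm_C r (NN \<alpha> a b)" by blast
  have "U \<subseteq> ?F" using e Phi_fibre_eq by blast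
  have o: "openin ?Q U" unfolding e(1) by (rule open_orb_pt[OF adm r ab e(2) open_UNIV])
  have "connectedin ?Q U"
    unfolding e(1) using connectedin_continuous_map_image[OF continuous_map_orb_pt[OF adm r ab e(2)], of UNIV]
      connected_UNIV by simp
  then show "openin (subtopology ?Q ?F) U \<and> connectedin (subtopology ?Q ?F) U \<and> U \<noteq> {}"
    using o \<open>U \<subseteq> ?F\<close> e(1) by (auto simp: connectedin_subtopology openin_subtopology)
qed

text \<open>Injectivity is the content of \<open>c_orbit_cls\<close>: its right-hand side mentions
  the orbit of the class only through the component.\<close>

lemma bij_betw_component:
  "bij_betw (component \<alpha> r a b) (c_orbits \<alpha> r a b)
     (connected_components_of (subtopology (scriptQ_topology \<alpha> r) (Phi_fibre \<alpha> r a b)))"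
proof -
  have co: "c_orbits \<alpha> r a b = (\<lambda>e. c_orbit \<alpha> r a b (cls r a b e)) ` norm_C r (NN \<alpha> a b)"
    unfolding c_orbits_def orbits_def scriptC_eq c_orbit_def[symmetric] by blast
  show ?thesis
    unfolding bij_betw_def co connected_components_fibre
  proof
    show "inj_on (component \<alpha> r a b) ((\<lambda>e. c_orbit \<alpha> r a b (cls r a b e)) ` norm_C r (NN \<alpha> a b))"
    proof (rule inj_onI)
      fix U V assume "U \<in> (\<lambda>e. c_orbit \<alpha> r a b (cls r a b e)) ` norm_C r (NN \<alpha> a b)"
        "V \<in> (\<lambda>e. c_orbit \<alpha> r a b (cls r a b e)) ` norm_C r (NN \<alpha> a b)"
        and eq: "component \<alpha> r a b U = component \<alpha> r a b V"
      then obtain e e' where e: "U = c_orbit \<alpha> r a b (cls r a b e)" "e \<in> norm_C r (NN \<alpha> a b)"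
        and e': "V = c_orbit \<alpha> r a b (cls r a b e')" "e' \<in> norm_C r (NN \<alpha> a b)" by blast
      have "range (\<lambda>s. orb \<alpha> r (pt r a b e s)) = range (\<lambda>s. orb \<alpha> r (pt r a b e' s))"
        using eq unfolding e(1) e'(1) component_cls[OF e(2)] component_cls[OF e'(2)] .
      then show "U = V"
        unfolding e(1) e'(1) c_orbit_cls[OF e(2)] c_orbit_cls[OF e'(2)] by simp
    qed
    show "component \<alpha> r a b ` (\<lambda>e. c_orbit \<alpha> r a b (cls r a b e)) ` norm_C r (NN \<alpha> a b)
       = (\<lambda>e. range (\<lambda>s. orb \<alpha> r (pt r a b e s))) ` norm_C r (NN \<alpha> a b)"
      unfolding image_image using component_cls by simp
  qed
qed

end

section \<open>Surfaces uniformised by an entire function\<close>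

text \<open>At the image of a noncritical point of \<open>h\<close>, compose with a local inverse.
  Critical points are isolated and \<open>h\<close> is open, so around the image \<open>w\<close> of
  a critical point \<open>f\<close> is holomorphic except possibly at \<open>w\<close>, where
  continuity removes the singularity. The cosine needs the second case.\<close>

lemma holomorphic_descent:
  fixes f h :: "complex \<Rightarrow> complex"
  assumes h: "h holomorphic_on UNIV" "\<not> h constant_on UNIV"
    and V: "open V" "V \<subseteq> range h" and f: "continuous_on V f"
    and fh: "(f \<circ> h) holomorphic_on (h -` V)"
  shows "f holomorphic_on V"
proof -
  have S: "open (h -` V)"
    using h(1) V(1) by (metis holomorphic_on_imp_continuous_on continuous_open_preimage Int_UNIV_left open_UNIV)
  have diff: "f field_differentiable (at (h z))" if z: "h z \<in> V" "deriv h z \<noteq> 0" for z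
  proof -
    have hol: "h holomorphic_on h -` V" using h(1) holomorphic_on_subset by blast
    obtain \<rho> where \<rho>: "\<rho> > 0" "ball z \<rho> \<subseteq> h -` V" "open (h ` ball z \<rho>)" "inj_on h (ball z \<rho>)"
      using has_complex_derivative_locally_invertible[OF hol _ S z(2)] z(1) by auto
    have "h holomorphic_on ball z \<rho>" using h(1) holomorphic_on_subset by blast
    then obtain g where g: "g holomorphic_on h ` ball z \<rho>" "\<And>w. w \<in> ball z \<rho> \<Longrightarrow> g (h w) = w"
      using holomorphic_has_inverse[OF _ open_ball \<rho>(4)] by metis
    have "g ` (h ` ball z \<rho>) \<subseteq> h -` V" using g(2) \<rho>(2) by auto
    then have "((f \<circ> h) \<circ> g) holomorphic_on h ` ball z \<rho>"
      using holomorphic_on_compose_gen[OF g(1) fh] by blast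
    then have "f holomorphic_on h ` ball z \<rho>"
      by (rule holomorphic_transform) (auto simp: g(2))
    then show ?thesis
      using \<rho>(1,3) by (intro holomorphic_on_imp_differentiable_at[OF _ \<rho>(3)]) auto
  qed
  have "f field_differentiable (at w)" if w: "w \<in> V" for w
  proof -
    obtain z0 where z0: "h z0 = w" using w V(2) by blast
    have dh: "deriv h holomorphic_on UNIV" using h(1) by (simp add: holomorphic_deriv)
    have "\<exists>\<beta>. deriv h \<beta> \<noteq> 0"
    proof (rule ccontr)
      assume "\<nexists>\<beta>. deriv h \<beta> \<noteq> 0"
      then have "(h has_field_derivative 0) (at z)" for z
        using h(1) by (metis holomorphic_derivI UNIV_I open_UNIV)
      then have "h constant_on UNIV"
        using has_field_derivative_0_imp_constant_on[of UNIV h] by (metis connected_UNIV open_UNIV has_field_derivative_at_within)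
      then show False using h(2) by blast
    qed
    then obtain \<beta> where \<beta>: "deriv h \<beta> \<noteq> 0" by blast
    show ?thesis
    proof (cases "deriv h z0 = 0")
      case False
      then show ?thesis using diff[of z0] w z0 by simp
    next
      case True
      obtain \<epsilon> where \<epsilon>: "0 < \<epsilon>" "\<And>z. z \<in> ball z0 \<epsilon> - {z0} \<Longrightarrow> deriv h z \<noteq> 0"
        using isolated_zeros[OF dh open_UNIV connected_UNIV UNIV_I True UNIV_I \<beta>] by metis
      define B where "B = ball z0 \<epsilon> \<inter> h -` V"
      have B: "open B" "z0 \<in> B" using S \<epsilon>(1) w z0 by (auto simp: B_def)
      have T: "open (h ` B)"
        using open_mapping_thm[OF h(1) open_UNIV connected_UNIV B(1) _ h(2)] by simp
      have TV: "h ` B \<subseteq> V" by (auto simp: B_def)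
      have "f holomorphic_on h ` B - {w}"
      proof -
        have "f field_differentiable (at y)" if y: "y \<in> h ` B - {w}" for y
        proof -
          obtain x where x: "y = h x" "x \<in> B" "h x \<noteq> h z0" using y z0 by blast
          then have "deriv h x \<noteq> 0" using \<epsilon>(2)[of x] by (auto simp: B_def)
          then show ?thesis using diff x by (simp add: B_def)
        qed
        then show ?thesis by (simp add: holomorphic_on_def field_differentiable_at_within)
      qed
      then have "f holomorphic_on h ` B"
        using no_isolated_singularity[OF continuous_on_subset[OF f TV] _ T, of "{w}"] by simp
      moreover have "w \<in> h ` B" using B(2) z0 by blast
      ultimately show ?thesis using T holomorphic_on_imp_differentiable_at by blast
    qed
  qed
  then show ?thesis by (simp add: holomorphic_on_def field_differentiable_at_within)
qed

text \<open>Used to identify an abstract quotient of the plane with the range of an entire function,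
  and to see that the canonical map from the quotient of the cylinder to a component is a
  homeomorphism.\<close>

lemma homeomorphic_map_quotients:
  assumes f: "quotient_map Z Y f" and g: "quotient_map Z X g"
    and eq: "\<And>z z'. z \<in> topspace Z \<Longrightarrow> z' \<in> topspace Z \<Longrightarrow> f z = f z' \<longleftrightarrow> g z = g z'"
    and \<iota>: "\<And>z. z \<in> topspace Z \<Longrightarrow> \<iota> (f z) = g z"
  shows "homeomorphic_map Y X \<iota>"
proof -
  have "continuous_map Z X (\<iota> \<circ> f)"
    by (rule continuous_map_eq[OF quotient_imp_continuous_map[OF g]]) (simp add: \<iota>)
  then have c: "continuous_map Y X \<iota>"
    using f by (rule continuous_compose_quotient_map[rotated])
  have "quotient_map Z X (\<iota> \<circ> f)"
    by (rule quotient_map_eq[OF g]) (simp add: \<iota>)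
  then have "quotient_map Y X \<iota>"
    using quotient_map_from_composition[OF quotient_imp_continuous_map[OF f] c] by blast
  moreover have "inj_on \<iota> (topspace Y)"
  proof (rule inj_onI)
    fix x y assume "x \<in> topspace Y" "y \<in> topspace Y" "\<iota> x = \<iota> y"
    moreover have "topspace Y = f ` topspace Z" using f by (simp add: quotient_map_def)
    ultimately obtain z z' where z: "x = f z" "y = f z'" "z \<in> topspace Z" "z' \<in> topspace Z" by blast
    then show "x = y" using eq[OF z(3,4)] \<iota> \<open>\<iota> x = \<iota> y\<close> by simp
  qed
  ultimately show ?thesis by (simp add: homeomorphic_map_def)
qed

text \<open>Holomorphy is tested after pulling back to the plane, so \<open>j\<close> needs no local
  inverses and may be branched. The form is stable: a quotient or a transport replaces
  \<open>j\<close> by its composite with a further map.\<close>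

definition atlas_from :: "'a topology \<Rightarrow> (complex \<Rightarrow> 'a) \<Rightarrow> ('a set \<times> ('a \<Rightarrow> complex)) set" where
  "atlas_from X j = {(U, \<phi>). complex_chart X U \<phi> \<and> (\<phi> \<circ> j) holomorphic_on (j -` U)}"

definition surface_from :: "'a topology \<Rightarrow> (complex \<Rightarrow> 'a) \<Rightarrow> 'a surface" where
  "surface_from X j = \<lparr>underlying = X, charts = atlas_from X j\<rparr>"

lemma quotient_surface_plane:
  "quotient_surface (plane_surface UNIV) \<pi> = surface_from (quotient_topology euclidean \<pi>) \<pi>"
proof -
  have "inv_into UNIV (id :: complex \<Rightarrow> complex) = id" using inv_id by simp
  then show ?thesis
    by (simp add: quotient_surface_def plane_surface_def surface_from_def atlas_from_def vimage_def)
qed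

text \<open>A space uniformised by \<open>j\<close> is identified by \<open>H\<close> with the range of the entire function
  \<open>h = H \<circ> j\<close>, which may have critical points.\<close>

locale uniformised =
  fixes X :: "'a topology" and j :: "complex \<Rightarrow> 'a" and h :: "complex \<Rightarrow> complex" and H :: "'a \<Rightarrow> complex"
  assumes h: "h holomorphic_on UNIV" "\<not> h constant_on UNIV"
    and H: "homeomorphic_map X (top_of_set (range h)) H"
    and j: "\<And>z. j z \<in> topspace X" and Hj: "\<And>z. H (j z) = h z"
begin

abbreviation "G \<equiv> inv_into (topspace X) H"

lemma open_range: "open (range h)"
  using open_mapping_thm[OF h(1) open_UNIV connected_UNIV open_UNIV subset_UNIV h(2)] .

lemma H_inj: "inj_on H (topspace X)"
  using H by (rule homeomorphic_imp_injective_map)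

lemma H_image: "H ` topspace X = range h"
  using homeomorphic_imp_surjective_map[OF H] by simp

lemma G_H: "x \<in> topspace X \<Longrightarrow> G (H x) = x"
  using H_inj by simp

lemma H_G: "w \<in> range h \<Longrightarrow> H (G w) = w"
  by (simp add: f_inv_into_f H_image)

lemma G_in: "w \<in> range h \<Longrightarrow> G w \<in> topspace X"
  by (simp add: inv_into_into H_image)

lemma continuous_G: "continuous_map (top_of_set (range h)) X G"
proof -
  obtain g where "homeomorphic_maps X (top_of_set (range h)) H g"
    using H homeomorphic_map_maps by blast
  then have g: "continuous_map (top_of_set (range h)) X g" "\<And>w. w \<in> range h \<Longrightarrow> H (g w) = w"
    by (auto simp: homeomorphic_maps_def)
  have "g w = G w" if "w \<in> range h" for w
    using H_inj g that G_in H_G by (metis continuous_map_image_subset_topspace image_subset_iff inj_onD topspace_euclidean_subtopology)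
  then show ?thesis using continuous_map_eq[OF g(1)] by simp
qed

lemma open_H_image:
  assumes "openin X U" shows "open (H ` U)"
proof -
  have "openin (top_of_set (range h)) (H ` U)"
    using homeomorphic_imp_open_map[OF H] assms by (simp add: open_map_def)
  then show ?thesis using open_range openin_open_trans by blast
qed

text \<open>\<open>h\<close> and \<open>j\<close> have the same fibres, so a function holomorphic
  along \<open>j\<close> is one that descends along \<open>h\<close> to the coordinate
  \<open>H\<close>.\<close>

lemma holomorphic_on_image:
  assumes U: "openin X U" and f: "continuous_on (H ` U) (f \<circ> G)" "(f \<circ> j) holomorphic_on (j -` U)"
  shows "(f \<circ> G) holomorphic_on H ` U"
proof (rule holomorphic_descent[OF h open_H_image[OF U]])
  have US: "U \<subseteq> topspace X" using U by (rule openin_subset)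
  then show "H ` U \<subseteq> range h" using H_image by blast
  have "h -` (H ` U) = j -` U"
    using US H_inj j Hj by (auto simp: inj_on_def) (metis image_eqI subset_eq)+
  then show "(f \<circ> G \<circ> h) holomorphic_on h -` (H ` U)"
    using f(2) by (auto simp: Hj[symmetric] G_H j o_def)
qed (use f in blast)

text \<open>Every chart is compared with the global coordinate \<open>H\<close>. One direction is
  descent along \<open>h\<close>; the other follows because an injective holomorphic function has a
  holomorphic inverse.\<close>

lemma chart_facts:
  assumes "(U, \<phi>) \<in> atlas_from X j"
  shows "U \<subseteq> topspace X" "inj_on \<phi> U" "open (\<phi> ` U)" "openin X U"
    and "(\<phi> \<circ> G) holomorphic_on H ` U" "(H \<circ> inv_into U \<phi>) holomorphic_on \<phi> ` U"
proof -
  have c: "openin X U" "open (\<phi> ` U)" "homeomorphic_map (subtopology X U) (top_of_set (\<phi> ` U)) \<phi>"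
    "(\<phi> \<circ> j) holomorphic_on (j -` U)"
    using assms by (auto simp: atlas_from_def complex_chart_def)
  show US: "U \<subseteq> topspace X" using c(1) by (rule openin_subset)
  show inj: "inj_on \<phi> U" using homeomorphic_imp_injective_map[OF c(3)] US by (simp add: inf.absorb2)
  show "open (\<phi> ` U)" "openin X U" using c by auto
  have HU: "H ` U \<subseteq> range h" using US H_image by blast
  have "continuous_map (top_of_set (H ` U)) (subtopology X U) G"
    using continuous_map_from_subtopology_mono[OF continuous_G HU] US G_H
    by (auto simp: continuous_map_in_subtopology)
  then have "continuous_map (top_of_set (H ` U)) (top_of_set (\<phi> ` U)) (\<phi> \<circ> G)"
    using homeomorphic_imp_continuous_map[OF c(3)] by (rule continuous_map_compose)
  then have "continuous_on (H ` U) (\<phi> \<circ> G)"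
    by (simp add: continuous_map_in_subtopology)
  then show hol: "(\<phi> \<circ> G) holomorphic_on H ` U"
    using holomorphic_on_image[OF c(1) _ c(4)] by blast
  have "inj_on (\<phi> \<circ> G) (H ` U)"
    using inj US G_H by (auto simp: inj_on_def subset_eq)
  then obtain g where g: "g holomorphic_on ((\<phi> \<circ> G) ` H ` U)" "\<And>w. w \<in> H ` U \<Longrightarrow> g ((\<phi> \<circ> G) w) = w"
    using holomorphic_has_inverse[OF hol open_H_image[OF c(1)]] by metis
  have "(\<phi> \<circ> G) ` H ` U = \<phi> ` U" using US G_H by (force simp: image_image)
  then have "g holomorphic_on \<phi> ` U" using g(1) by simp
  then show "(H \<circ> inv_into U \<phi>) holomorphic_on \<phi> ` U"
  proof (rule holomorphic_transform)
    fix y assume "y \<in> \<phi> ` U"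
    then obtain x where x: "x \<in> U" "y = \<phi> x" by blast
    then have "inv_into U \<phi> y = x" using inj by simp
    moreover have "g y = H x" using g(2)[of "H x"] x US G_H by (auto simp: subset_eq)
    ultimately show "g y = (H \<circ> inv_into U \<phi>) y" by simp
  qed
qed

lemma global_chart: "(topspace X, H) \<in> atlas_from X j"
proof -
  have "H \<circ> j = h" using Hj by auto
  moreover have "j -` topspace X = UNIV" using j by auto
  ultimately show ?thesis
    using h(1) H open_range by (simp add: atlas_from_def complex_chart_def H_image)
qed

lemma riemann_surface_from: "riemann_surface (surface_from X j)"
proof -
  have "X homeomorphic_space top_of_set (range h)"
    using H by (rule homeomorphic_map_imp_homeomorphic_space)
  moreover have "connected (range h)"
    using h(1) by (intro connected_continuous_image holomorphic_on_imp_continuous_on connected_UNIV)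
  ultimately have "Hausdorff_space X" "connected_space X"
    using homeomorphic_Hausdorff_space homeomorphic_connected_space Hausdorff_space_euclidean Hausdorff_space_subtopology
      connected_space_subtopology connectedin_iff_connected by (blast, metis)
  moreover have "\<Union>(fst ` atlas_from X j) = topspace X"
    using global_chart chart_facts(1) by force
  moreover have "(\<psi> \<circ> inv_into U \<phi>) holomorphic_on \<phi> ` (U \<inter> V)"
    if c: "(U, \<phi>) \<in> atlas_from X j" "(V, \<psi>) \<in> atlas_from X j" for U \<phi> V \<psi>
  proof -
    note u = chart_facts[OF c(1)] and v = chart_facts[OF c(2)]
    have "(H \<circ> inv_into U \<phi>) holomorphic_on \<phi> ` (U \<inter> V)"
      using u(6) by (rule holomorphic_on_subset) auto
    moreover have "(H \<circ> inv_into U \<phi>) ` (\<phi> ` (U \<inter> V)) \<subseteq> H ` V"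
      using u(2) by auto
    ultimately have "((\<psi> \<circ> G) \<circ> (H \<circ> inv_into U \<phi>)) holomorphic_on \<phi> ` (U \<inter> V)"
      using v(5) holomorphic_on_compose_gen by blast
    then show ?thesis
      by (rule holomorphic_transform) (use u(1,2) G_H in auto)
  qed
  ultimately show ?thesis
    unfolding riemann_surface_def surface_from_def by (auto simp: atlas_from_def)
qed

lemma riemann_surface_plane_range: "riemann_surface (plane_surface (range h))"
proof -
  have "connected (range h)"
    using h(1) by (intro connected_continuous_image holomorphic_on_imp_continuous_on connected_UNIV)
  moreover have "(id \<circ> inv_into (range h) id) holomorphic_on range h"
    by (rule holomorphic_transform[OF holomorphic_on_id]) (auto simp: inv_into_f_f[of id, simplified])
  ultimately show ?thesis
    using open_range
    by (auto simp: riemann_surface_def plane_surface_def complex_chart_def connected_space_subtopology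
        Hausdorff_space_subtopology connectedin_iff_connected homeomorphic_map_id subtopology_subtopology)
qed

lemma biholomorphic_range: "biholomorphic (surface_from X j) (plane_surface (range h))"
proof -
  have inv: "inv_into (range h) id w = w" if "w \<in> range h" for w
    using inv_into_f_f[of id "range h" w] that by simp
  have "holomorphic_map (surface_from X j) (plane_surface (range h)) H"
    unfolding holomorphic_map_def
  proof
    show "continuous_map (underlying (surface_from X j)) (underlying (plane_surface (range h))) H"
      using H by (simp add: surface_from_def plane_surface_def homeomorphic_imp_continuous_map)
    show "\<forall>(U, \<phi>) \<in> charts (surface_from X j). \<forall>(V, \<psi>) \<in> charts (plane_surface (range h)).
        (\<psi> \<circ> H \<circ> inv_into U \<phi>) holomorphic_on \<phi> ` {x \<in> U. H x \<in> V}"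
    proof -
      have "(H \<circ> inv_into U \<phi>) holomorphic_on \<phi> ` {x \<in> U. H x \<in> range h}" if "(U, \<phi>) \<in> atlas_from X j" for U \<phi>
        using chart_facts(6)[OF that] by (rule holomorphic_on_subset) auto
      then show ?thesis by (auto simp: surface_from_def plane_surface_def)
    qed
  qed
  moreover have "holomorphic_map (plane_surface (range h)) (surface_from X j) G"
    unfolding holomorphic_map_def
  proof
    show "continuous_map (underlying (plane_surface (range h))) (underlying (surface_from X j)) G"
      using continuous_G by (simp add: surface_from_def plane_surface_def)
    have "(\<phi> \<circ> G \<circ> inv_into (range h) id) holomorphic_on {w \<in> range h. G w \<in> U}"
      if "(U, \<phi>) \<in> atlas_from X j" for U \<phi>
    proof (rule holomorphic_transform)
      show "(\<phi> \<circ> G) holomorphic_on {w \<in> range h. G w \<in> U}"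
        using chart_facts(5)[OF that] by (rule holomorphic_on_subset) (metis (mono_tags, lifting) H_G imageI mem_Collect_eq subsetI)
    qed (use inv in auto)
    then show "\<forall>(U, \<phi>) \<in> charts (plane_surface (range h)). \<forall>(V, \<psi>) \<in> charts (surface_from X j).
        (\<psi> \<circ> G \<circ> inv_into U \<phi>) holomorphic_on \<phi> ` {x \<in> U. G x \<in> V}"
      by (auto simp: surface_from_def plane_surface_def)
  qed
  ultimately show ?thesis
    unfolding biholomorphic_def
    using riemann_surface_from riemann_surface_plane_range G_H H_G
    by (auto simp: surface_from_def plane_surface_def intro!: exI[of _ H] exI[of _ G])
qed

text \<open>One direction evaluates the condition of \<open>quotient_surface\<close> at the global
  chart \<open>H\<close> and composes with \<open>h\<close>. The converse descends along
  \<open>h\<close>; the continuity required for this comes from the chart of the quotient being a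
  homeomorphism.\<close>

lemma quotient_surface_from:
  "quotient_surface (surface_from X j) \<pi> = surface_from (quotient_topology X \<pi>) (\<pi> \<circ> j)"
proof -
  have "(\<forall>(V, \<psi>) \<in> atlas_from X j. (\<phi> \<circ> \<pi> \<circ> inv_into V \<psi>) holomorphic_on \<psi> ` {x \<in> V. \<pi> x \<in> U})
     \<longleftrightarrow> (\<phi> \<circ> (\<pi> \<circ> j)) holomorphic_on (\<pi> \<circ> j) -` U"
    if c: "complex_chart (quotient_topology X \<pi>) U \<phi>" for U \<phi>
  proof
    let ?U = "{x \<in> topspace X. \<pi> x \<in> U}"
    assume "\<forall>(V, \<psi>) \<in> atlas_from X j. (\<phi> \<circ> \<pi> \<circ> inv_into V \<psi>) holomorphic_on \<psi> ` {x \<in> V. \<pi> x \<in> U}"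
    then have 1: "(\<phi> \<circ> \<pi> \<circ> G) holomorphic_on H ` ?U" using global_chart by fast
    have "h holomorphic_on (\<pi> \<circ> j) -` U" using h(1) holomorphic_on_subset by blast
    moreover have "h ` ((\<pi> \<circ> j) -` U) \<subseteq> H ` ?U" using j Hj by (force simp: image_iff)
    ultimately have "((\<phi> \<circ> \<pi> \<circ> G) \<circ> h) holomorphic_on (\<pi> \<circ> j) -` U"
      using 1 holomorphic_on_compose_gen by blast
    then show "(\<phi> \<circ> (\<pi> \<circ> j)) holomorphic_on (\<pi> \<circ> j) -` U"
      by (rule holomorphic_transform) (simp add: Hj[symmetric] G_H j)
  next
    let ?U = "{x \<in> topspace X. \<pi> x \<in> U}"
    assume hol: "(\<phi> \<circ> (\<pi> \<circ> j)) holomorphic_on (\<pi> \<circ> j) -` U"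
    have cU: "openin (quotient_topology X \<pi>) U" "homeomorphic_map (subtopology (quotient_topology X \<pi>) U) (top_of_set (\<phi> ` U)) \<phi>"
      using c by (auto simp: complex_chart_def)
    have U: "openin X ?U" using cU(1) by (simp add: openin_quotient_topology)
    have HU: "H ` ?U \<subseteq> range h" using H_image by blast
    have "continuous_map (top_of_set (H ` ?U)) (quotient_topology X \<pi>) (\<pi> \<circ> G)"
      using continuous_map_from_subtopology_mono[OF continuous_G HU]
        quotient_imp_continuous_map[OF quotient_map_quotient_topology] by (rule continuous_map_compose)
    then have "continuous_map (top_of_set (H ` ?U)) (subtopology (quotient_topology X \<pi>) U) (\<pi> \<circ> G)"
      using G_H by (auto simp: continuous_map_in_subtopology)
    then have "continuous_map (top_of_set (H ` ?U)) (top_of_set (\<phi> ` U)) (\<phi> \<circ> (\<pi> \<circ> G))"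
      using homeomorphic_imp_continuous_map[OF cU(2)] by (rule continuous_map_compose)
    then have "continuous_on (H ` ?U) ((\<phi> \<circ> \<pi>) \<circ> G)"
      by (simp add: continuous_map_in_subtopology o_assoc)
    moreover have "j -` ?U = (\<pi> \<circ> j) -` U" using j by auto
    ultimately have 2: "((\<phi> \<circ> \<pi>) \<circ> G) holomorphic_on H ` ?U"
      using holomorphic_on_image[OF U, of "\<phi> \<circ> \<pi>"] hol by (simp add: o_assoc)
    show "\<forall>(V, \<psi>) \<in> atlas_from X j. (\<phi> \<circ> \<pi> \<circ> inv_into V \<psi>) holomorphic_on \<psi> ` {x \<in> V. \<pi> x \<in> U}"
    proof safe
      fix V \<psi> assume V: "(V, \<psi>) \<in> atlas_from X j"
      note v = chart_facts[OF V]
      have "(H \<circ> inv_into V \<psi>) holomorphic_on \<psi> ` {x \<in> V. \<pi> x \<in> U}"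
        using v(6) by (rule holomorphic_on_subset) auto
      moreover have "(H \<circ> inv_into V \<psi>) ` (\<psi> ` {x \<in> V. \<pi> x \<in> U}) \<subseteq> H ` ?U"
        using v(1,2) by auto
      ultimately have "(((\<phi> \<circ> \<pi>) \<circ> G) \<circ> (H \<circ> inv_into V \<psi>)) holomorphic_on \<psi> ` {x \<in> V. \<pi> x \<in> U}"
        using 2 holomorphic_on_compose_gen by blast
      then show "(\<phi> \<circ> \<pi> \<circ> inv_into V \<psi>) holomorphic_on \<psi> ` {x \<in> V. \<pi> x \<in> U}"
        by (rule holomorphic_transform) (use v(1,2) G_H in auto)
    qed
  qed
  note eq = this
  show ?thesis
    unfolding quotient_surface_def surface_from_def atlas_from_def[of "quotient_topology X \<pi>"]
    by (simp add: eq cong: conj_cong)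
qed

end

lemma transport_surface_from:
  assumes \<iota>: "homeomorphic_map Y X \<iota>" and j: "\<And>z. j z \<in> topspace Y"
  shows "transport_surface (surface_from Y j) \<iota> X = surface_from X (\<iota> \<circ> j)"
proof -
  have surj: "\<iota> ` topspace Y = topspace X" using \<iota> by (rule homeomorphic_imp_surjective_map)
  have "({x \<in> topspace Y. \<iota> x \<in> U}, \<phi> \<circ> \<iota>) \<in> atlas_from Y j \<longleftrightarrow> (U, \<phi>) \<in> atlas_from X (\<iota> \<circ> j)"
    if U: "U \<subseteq> topspace X" for U \<phi>
  proof -
    let ?U = "{x \<in> topspace Y. \<iota> x \<in> U}"
    have im: "\<iota> ` ?U = U" using U surj by auto
    then have im': "(\<phi> \<circ> \<iota>) ` ?U = \<phi> ` U" by (metis image_comp)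
    have "openin Y ?U \<longleftrightarrow> openin X U"
      using \<iota> U by (simp add: homeomorphic_map_def quotient_map_def)
    moreover have hU: "homeomorphic_map (subtopology Y ?U) (subtopology X U) \<iota>"
      using homeomorphic_map_subtopologies[OF \<iota>, of ?U U] U im by (auto simp: inf.absorb2 surj)
    have "homeomorphic_map (subtopology Y ?U) (top_of_set (\<phi> ` U)) (\<phi> \<circ> \<iota>)
       \<longleftrightarrow> homeomorphic_map (subtopology X U) (top_of_set (\<phi> ` U)) \<phi>"
    proof
      assume a: "homeomorphic_map (subtopology Y ?U) (top_of_set (\<phi> ` U)) (\<phi> \<circ> \<iota>)"
      obtain k where k: "homeomorphic_maps (subtopology Y ?U) (subtopology X U) \<iota> k"
        using hU homeomorphic_map_maps by blast
      then have "homeomorphic_map (subtopology X U) (subtopology Y ?U) k"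
        by (simp add: homeomorphic_maps_map)
      then have "homeomorphic_map (subtopology X U) (top_of_set (\<phi> ` U)) ((\<phi> \<circ> \<iota>) \<circ> k)"
        using a by (rule homeomorphic_map_compose)
      then show "homeomorphic_map (subtopology X U) (top_of_set (\<phi> ` U)) \<phi>"
        by (rule homeomorphic_map_eq) (use k in \<open>auto simp: homeomorphic_maps_def\<close>)
    qed (rule homeomorphic_map_compose[OF hU])
    moreover have "j -` ?U = (\<iota> \<circ> j) -` U" using j by auto
    ultimately show ?thesis
      unfolding atlas_from_def complex_chart_def mem_Collect_eq prod.case im' o_assoc by (simp only:)
  qed
  moreover have "U \<subseteq> topspace X" if "(U, \<phi>) \<in> atlas_from X (\<iota> \<circ> j)" for U \<phi>
    using that openin_subset by (auto simp: atlas_from_def complex_chart_def)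
  ultimately have "(U \<subseteq> topspace X \<and> ({x \<in> topspace Y. \<iota> x \<in> U}, \<phi> \<circ> \<iota>) \<in> atlas_from Y j)
      \<longleftrightarrow> (U, \<phi>) \<in> atlas_from X (\<iota> \<circ> j)" for U \<phi>
    by blast
  then show ?thesis
    by (simp add: transport_surface_def surface_from_def)
qed

text \<open>A nonconstant entire function is open, hence a quotient map onto its range. So
  \<open>X\<close> and the range of \<open>h\<close> are the same quotient of the plane once the
  fibres agree.\<close>

lemma uniformised_from_quotient:
  fixes h :: "complex \<Rightarrow> complex"
  assumes "h holomorphic_on UNIV" "\<not> h constant_on UNIV" "quotient_map euclidean X j"
    and "\<And>z z'. j z = j z' \<longleftrightarrow> h z = h z'"
  obtains H where "uniformised X j h H"
proof -
  have "open_map euclidean (top_of_set (range h)) h"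
    unfolding open_map_def using open_mapping_thm[OF assms(1) open_UNIV connected_UNIV _ subset_UNIV assms(2)]
    by (auto intro: open_subset)
  moreover have "continuous_map euclidean (top_of_set (range h)) h"
    using assms(1) holomorphic_on_imp_continuous_on by (auto simp: continuous_map_in_subtopology)
  ultimately have q: "quotient_map euclidean (top_of_set (range h)) h"
    by (intro continuous_open_imp_quotient_map) auto
  define H where "H x = h (SOME z. j z = x)" for x
  have Hj: "H (j z) = h z" for z
    unfolding H_def using assms(4) by (metis (mono_tags, lifting) someI_ex)
  have "homeomorphic_map X (top_of_set (range h)) H"
    by (rule homeomorphic_map_quotients[OF assms(3) q]) (use assms(4) Hj in auto)
  moreover have "j z \<in> topspace X" for z
    using assms(3) by (auto simp: quotient_map_def)
  ultimately show ?thesis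
    using assms(1,2) Hj by (intro that[of H]) (simp add: uniformised_def)
qed

section \<open>The deck group of a component\<close>

text \<open>The distinction is topological: the plane is simply connected and the punctured plane is
  not. That the alternatives exclude each other turns the construction of the two uniformisations
  into an equivalence.\<close>

lemma not_biholomorphic_plane_and_punctured:
  assumes "biholomorphic S (plane_surface UNIV)" "biholomorphic S (plane_surface (UNIV - {0}))"
  shows False
proof -
  obtain f g where fg: "continuous_map (underlying S) (top_of_set UNIV) f" "continuous_map (top_of_set UNIV) (underlying S) g"
    "\<And>x. x \<in> topspace (underlying S) \<Longrightarrow> g (f x) = x" "\<And>y::complex. f (g y) = y"
    using assms(1) by (auto simp: biholomorphic_def holomorphic_map_def plane_surface_def)
  obtain h k where hk: "continuous_map (underlying S) (top_of_set (UNIV - {0::complex})) h"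
    "continuous_map (top_of_set (UNIV - {0})) (underlying S) k"
    "\<And>x. x \<in> topspace (underlying S) \<Longrightarrow> k (h x) = x" "\<And>y. y \<noteq> 0 \<Longrightarrow> h (k y) = y"
    using assms(2) by (auto simp: biholomorphic_def holomorphic_map_def plane_surface_def)
  have in_S: "g y \<in> topspace (underlying S)" "z \<noteq> 0 \<Longrightarrow> k z \<in> topspace (underlying S)" for y z
    using continuous_map_image_subset_topspace[OF fg(2)] continuous_map_image_subset_topspace[OF hk(2)] by auto
  have c1: "continuous_map (top_of_set UNIV) (top_of_set (UNIV - {0})) (h \<circ> g)"
    using fg(2) hk(1) by (rule continuous_map_compose)
  have c2: "continuous_map (top_of_set (UNIV - {0})) (top_of_set UNIV) (f \<circ> k)"
    using hk(2) fg(1) by (rule continuous_map_compose)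
  have "homeomorphism UNIV (UNIV - {0::complex}) (h \<circ> g) (f \<circ> k)"
    unfolding homeomorphism_def
  proof (intro conjI ballI)
    show "continuous_on UNIV (h \<circ> g)" "continuous_on (UNIV - {0}) (f \<circ> k)"
      using c1 c2 by (simp_all add: continuous_map_in_subtopology)
    have sub: "(h \<circ> g) ` UNIV \<subseteq> UNIV - {0}"
      using continuous_map_image_subset_topspace[OF c1] by auto
    show 1: "(f \<circ> k) ((h \<circ> g) y) = y" for y using fg hk in_S by simp
    show 2: "(h \<circ> g) ((f \<circ> k) y) = y" if "y \<in> UNIV - {0}" for y
      using that fg hk in_S by simp
    show "(h \<circ> g) ` UNIV = UNIV - {0}"
      using sub 2 by (metis rangeI subsetI subset_antisym)
    show "(f \<circ> k) ` (UNIV - {0}) = UNIV"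
      using sub 1 by (metis UNIV_eq_I image_eqI image_subset_iff rangeI)
  qed
  then have "simply_connected (UNIV - {0::complex})"
    using homeomorphic_simply_connected[of "UNIV :: complex set"] convex_imp_simply_connected[OF convex_UNIV]
    unfolding homeomorphic_def by blast
  then show False
    using simply_connected_punctured_universe_eq[of "0::complex"] by (simp add: Compl_eq_Diff_UNIV)
qed

text \<open>The least positive element exists because all elements are multiples of
  \<open>1 / M\<close>. It generates by division with remainder, as a nonzero remainder would be a
  smaller positive element.\<close>

lemma discrete_subgroup_of_reals:
  fixes \<Lambda> :: "real set" and M :: nat
  assumes add: "\<And>u v. u \<in> \<Lambda> \<Longrightarrow> v \<in> \<Lambda> \<Longrightarrow> u + v \<in> \<Lambda>" and neg: "\<And>u. u \<in> \<Lambda> \<Longrightarrow> - u \<in> \<Lambda>"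
    and M: "M > 0" "\<And>u. u \<in> \<Lambda> \<Longrightarrow> \<exists>m::int. u = of_int m / real M"
    and u: "u \<in> \<Lambda>" "u > 0"
  obtains l :: real where "l > 0" "\<Lambda> = {of_int n * l | n. True}"
proof -
  define P where "P n \<longleftrightarrow> n > 0 \<and> real n / real M \<in> \<Lambda>" for n :: nat
  obtain m :: int where m: "u = of_int m / real M" using M(2)[OF u(1)] by blast
  then have "m > 0" using u(2) M(1) by (simp add: zero_less_divide_iff)
  then have "P (nat m)" using u(1) m by (simp add: P_def)
  then have P: "P (LEAST n. P n)" by (rule LeastI)
  define n0 where "n0 = (LEAST n. P n)"
  define l where "l = real n0 / real M"
  have l: "l > 0" "l \<in> \<Lambda>" using P M(1) by (simp_all add: P_def n0_def l_def)
  have "0 \<in> \<Lambda>" using add[OF u(1) neg[OF u(1)]] by simp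
  then have nat: "of_nat n * l \<in> \<Lambda>" for n
    by (induction n) (use add l(2) in \<open>auto simp: distrib_right\<close>)
  have int: "of_int n * l \<in> \<Lambda>" for n
    using nat[of "nat n"] neg[OF nat[of "nat (- n)"]] by (cases "n \<ge> 0") auto
  have "\<exists>n. v = of_int n * l" if v: "v \<in> \<Lambda>" for v
  proof -
    obtain k :: int where k: "v = of_int k / real M" using M(2)[OF v] by blast
    define q where "q = k div int n0"
    define i where "i = k mod int n0"
    have n0: "n0 > 0" using P by (simp add: P_def n0_def)
    have "k = int n0 * q + i" by (simp add: q_def i_def)
    then have "real_of_int k = of_int (int n0 * q + i)" by simp
    then have "v + - (of_int q * l) = of_int i / real M"
      unfolding k l_def by (simp add: add_divide_distrib mult.commute)
    then have "of_int i / real M \<in> \<Lambda>" using add[OF v neg[OF int[of q]]] by simp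
    moreover have "0 \<le> i" "i < int n0" using n0 by (simp_all add: i_def)
    ultimately have "i = 0"
      using not_less_Least[of "nat i" P] unfolding P_def n0_def[unfolded P_def, symmetric] by fastforce
    then show ?thesis using \<open>k = int n0 * q + i\<close> unfolding k l_def by (intro exI[of _ q]) simp
  qed
  then have "\<Lambda> = {of_int n * l | n. True}" using int by blast
  with l(1) show ?thesis by (rule that)
qed

context
  fixes \<alpha> :: real and r :: nat and a b e :: "real^2"
  assumes adm: "S_plus_admissible \<alpha>" and r: "r \<ge> 1" and ab: "(a, b) \<in> compatible_pairs \<alpha>"
    and e: "e \<in> norm_C r (NN \<alpha> a b)"
begin

text \<open>Every term of \<open>shift_t\<close> becomes an integer after multiplication by
  \<open>2 r d\<close>. For the term in \<open>e\<close> this follows by solving the equation of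
  \<open>p\<close>. For the quadratic term, \<open>d (\<alpha> + 1) / (1 - \<alpha>)\<close> equals
  \<open>- (\<alpha> - inverse \<alpha>)\<close>, and this difference of eigenvalues turns the
  product of \<open>k a\<close> and \<open>k b\<close> into an integer multiple of
  \<open>wedge b a\<close>.\<close>

lemma shift_t_discrete:
  obtains m :: int where "shift_t \<alpha> a b k e = of_int m / of_int (2 * int r * dd \<alpha>)"
proof -
  let ?N = "NN \<alpha> a b"
  note N = compatible_NN[OF ab] and dt = compatible_NN_det_trace[OF ab adm] and al = S_plus_admissible_facts[OF adm]
  have d: "real_of_int (dd \<alpha>) = \<alpha> + inverse \<alpha> - 2" using al(2) by (simp add: dd_def)
  have d0: "dd \<alpha> > 0" using al(3) by (simp add: dd_def)
  obtain p where p: "norm_rel r ?N e p" using e norm_C_iff by blast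
  have tr: "?N $ 1 $ 1 + ?N $ 2 $ 2 = dd \<alpha> + 2" using dt(2) by (simp add: dd_def)
  define x where "x = (1 / 2) *\<^sub>R row_prods ?N + (1 / real r) *\<^sub>R rvec p"
  have x: "rmat (mat 1 - ?N) *v e = x" using p by (simp add: norm_rel_def x_def)
  have dN: "real_of_int (?N $ 1 $ 1) * of_int (?N $ 2 $ 2) - of_int (?N $ 1 $ 2) * of_int (?N $ 2 $ 1) = 1"
    using arg_cong[OF dt(1), of real_of_int] by (simp add: det_2)
  have trr: "real_of_int (?N $ 1 $ 1) + of_int (?N $ 2 $ 2) = of_int (dd \<alpha>) + 2"
    using arg_cong[OF tr, of real_of_int] by simp
  \<comment> \<open>The adjugate of \<open>1 - N\<close> is applied to \<open>x\<close>; the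
    determinant of \<open>1 - N\<close> is \<open>- d\<close>.\<close>
  have de: "of_int (dd \<alpha>) * e $ 1 = - ((1 - of_int (?N $ 2 $ 2)) * x $ 1 + of_int (?N $ 1 $ 2) * x $ 2)"
    "of_int (dd \<alpha>) * e $ 2 = - (of_int (?N $ 2 $ 1) * x $ 1 + (1 - of_int (?N $ 1 $ 1)) * x $ 2)"
  proof -
    have D: "real_of_int (dd \<alpha>) = of_int (?N $ 1 $ 1) + of_int (?N $ 2 $ 2) - 1
       - (real_of_int (?N $ 1 $ 1) * of_int (?N $ 2 $ 2) - of_int (?N $ 1 $ 2) * of_int (?N $ 2 $ 1))"
      unfolding dN trr by simp
    show "of_int (dd \<alpha>) * e $ 1 = - ((1 - of_int (?N $ 2 $ 2)) * x $ 1 + of_int (?N $ 1 $ 2) * x $ 2)"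
      "of_int (dd \<alpha>) * e $ 2 = - (of_int (?N $ 2 $ 1) * x $ 1 + (1 - of_int (?N $ 1 $ 1)) * x $ 2)"
      unfolding D x[symmetric] by (simp_all add: coords2 algebra_simps)
  qed
  define y :: "int^2" where "y = vector [int r * (?N $ 1 $ 1 * ?N $ 1 $ 2) + 2 * p $ 1, int r * (?N $ 2 $ 1 * ?N $ 2 $ 2) + 2 * p $ 2]"
  have y: "2 * real r * x $ 1 = of_int (y $ 1)" "2 * real r * x $ 2 = of_int (y $ 2)"
    using r by (simp_all add: x_def y_def row_prods_def field_simps)
  define E :: "int^2" where "E = vector [- ((1 - ?N $ 2 $ 2) * y $ 1 + ?N $ 1 $ 2 * y $ 2), - (?N $ 2 $ 1 * y $ 1 + (1 - ?N $ 1 $ 1) * y $ 2)]"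
  have E: "2 * real r * (of_int (dd \<alpha>) * e $ i) = of_int (E $ i)" if "i = 1 \<or> i = 2" for i
  proof -
    have "2 * real r * (of_int (dd \<alpha>) * e $ 1) = - ((1 - of_int (?N $ 2 $ 2)) * (2 * real r * x $ 1) + of_int (?N $ 1 $ 2) * (2 * real r * x $ 2))"
      "2 * real r * (of_int (dd \<alpha>) * e $ 2) = - (of_int (?N $ 2 $ 1) * (2 * real r * x $ 1) + (1 - of_int (?N $ 1 $ 1)) * (2 * real r * x $ 2))"
      unfolding de by (simp_all add: algebra_simps)
    then show ?thesis using that unfolding y by (auto simp: E_def)
  qed
  \<comment> \<open>The determinant with rows \<open>k v* N\<close> and \<open>k\<close>. It arises
    because \<open>N\<close> acts on the two factors \<open>k a\<close> and \<open>k b\<close> by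
    the two eigenvalues.\<close>
  define j where "j = (k v* ?N) $ 1 * k $ 2 - (k v* ?N) $ 2 * k $ 1"
  define T where "T = (\<alpha> + 1) * (rvec k \<bullet> a) * (rvec k \<bullet> b) / 2 / ((1 - \<alpha>) * wedge b a)"
  have T: "2 * of_int (dd \<alpha>) * T = of_int j"
  proof -
    have "(\<alpha> - inverse \<alpha>) * ((rvec k \<bullet> a) * (rvec k \<bullet> b)) =
        (rvec k \<bullet> (rmat ?N *v a)) * (rvec k \<bullet> b) - (rvec k \<bullet> a) * (rvec k \<bullet> (rmat ?N *v b))"
      unfolding N(3,4) by (simp add: algebra_simps)
    also have "\<dots> = - (of_int j * wedge b a)"
      unfolding rvec_vec_mat[symmetric] j_def by (simp add: inner2 wedge_def algebra_simps)
    finally have 1: "(\<alpha> - inverse \<alpha>) * ((rvec k \<bullet> a) * (rvec k \<bullet> b)) = - (of_int j * wedge b a)" .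
    have f: "(\<alpha> + inverse \<alpha> - 2) * (\<alpha> + 1) = - ((1 - \<alpha>) * (\<alpha> - inverse \<alpha>))"
      using al(1) by (simp add: field_simps)
    have "(\<alpha> + inverse \<alpha> - 2) * ((\<alpha> + 1) * ((rvec k \<bullet> a) * (rvec k \<bullet> b)))
        = - ((1 - \<alpha>) * ((\<alpha> - inverse \<alpha>) * ((rvec k \<bullet> a) * (rvec k \<bullet> b))))"
      using arg_cong[OF f, of "\<lambda>x. x * ((rvec k \<bullet> a) * (rvec k \<bullet> b))"] by (simp only: mult.assoc mult_minus_left)
    then have "of_int (dd \<alpha>) * ((\<alpha> + 1) * ((rvec k \<bullet> a) * (rvec k \<bullet> b))) = of_int j * ((1 - \<alpha>) * wedge b a)"
      unfolding 1 d by (simp add: algebra_simps)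
    moreover have "(1 - \<alpha>) * wedge b a \<noteq> 0" using al(1) N(2) by simp
    moreover have "2 * of_int (dd \<alpha>) * T = of_int (dd \<alpha>) * ((\<alpha> + 1) * ((rvec k \<bullet> a) * (rvec k \<bullet> b))) / ((1 - \<alpha>) * wedge b a)"
      by (simp add: T_def mult.assoc)
    ultimately show ?thesis by simp
  qed
  have "2 * real r * of_int (dd \<alpha>) * shift_t \<alpha> a b k e
    = real r * (2 * of_int (dd \<alpha>) * T) + of_int (k $ 1) * (2 * real r * (of_int (dd \<alpha>) * e $ 1))
      + of_int (k $ 2) * (2 * real r * (of_int (dd \<alpha>) * e $ 2)) + real r * of_int (dd \<alpha>) * of_int (k $ 1 * k $ 2)"
    unfolding shift_t_def T_def[symmetric] by (simp add: inner2 algebra_simps)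
  also have "\<dots> = of_int (int r * j + k $ 1 * E $ 1 + k $ 2 * E $ 2 + int r * dd \<alpha> * (k $ 1 * k $ 2))"
    unfolding T using E[of 1] E[of 2] by simp
  finally show ?thesis
    using r d0 by (intro that[of "int r * j + k $ 1 * E $ 1 + k $ 2 * E $ 2 + int r * dd \<alpha> * (k $ 1 * k $ 2)"])
      (simp add: field_simps)
qed

text \<open>The translations (\<open>\<epsilon> = 1\<close>) and point reflections
  (\<open>\<epsilon> = -1\<close>) of the parameter line induced by group elements returning to the
  same pair and the same class of \<open>e\<close>. Demanding the equation for all complex
  \<open>s\<close> ties \<open>\<epsilon>\<close> to the determinant. As \<open>s\<close> counts
  modulo \<open>1 / r\<close>, both sets are invariant under adding \<open>1 / r\<close>.\<close>

definition deck :: "int \<Rightarrow> real set" where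
  "deck \<epsilon> = {u. \<exists>g \<in> carrier (calG \<alpha>). \<forall>s. calG_act \<alpha> r g (pt r a b e s) = pt r a b e (of_int \<epsilon> * s + of_real u)}"

lemma pt_e_in: "pt r a b e s \<in> topspace (scriptA_topology \<alpha> r)"
  using ab e by (rule pt_in_scriptA)

lemma orb_eq_iff_deck:
  "orb \<alpha> r (pt r a b e s) = orb \<alpha> r (pt r a b e s') \<longleftrightarrow>
     (\<exists>\<epsilon> u. (\<epsilon> = 1 \<or> \<epsilon> = -1) \<and> u \<in> deck \<epsilon> \<and> s' = of_int \<epsilon> * s + of_real u)"
proof
  assume "orb \<alpha> r (pt r a b e s) = orb \<alpha> r (pt r a b e s')"
  then obtain g where g: "g \<in> carrier (stab_pair \<alpha> a b)" "calG_act \<alpha> r g (pt r a b e s) = pt r a b e s'"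
    using orb_pt_eqE[OF adm r ab e e] by metis
  obtain K k where K: "K \<in> GL2Z" "\<And>s. calG_act \<alpha> r g (pt r a b e s)
      = pt r a b (trans_e \<alpha> a b K k e) (of_int (det K) * (s + of_real (shift_t \<alpha> a b k e)))"
    using calG_act_pt_stab[OF adm r ab e g(1)] by metis
  obtain m n where m: "trans_e \<alpha> a b K k e = e + (1 / real r) *\<^sub>R rvec m"
    and n: "of_int (det K) * (s + of_real (shift_t \<alpha> a b k e)) = s' + of_int n / of_nat r"
    using g(2) unfolding K(2) pt_eq_iff[OF compatible_NN(2)[OF ab]] by blast
  \<comment> \<open>The ambiguity by a multiple of \<open>1 / r\<close> is moved into
    \<open>u\<close>, so that \<open>s'\<close> is obtained exactly and not only up to its
    class.\<close>
  define u where "u = of_int (det K) * shift_t \<alpha> a b k e - of_int n / real r"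
  have "calG_act \<alpha> r g (pt r a b e s2) = pt r a b e (of_int (det K) * s2 + of_real u)" for s2
    unfolding K(2) by (rule pt_eqI[OF m, where n = n]) (simp add: u_def distrib_left)
  then have "u \<in> deck (det K)"
    using g(1) by (auto simp: deck_def stab_pair_def stabilizer_def)
  moreover have "s' = of_int (det K) * s + of_real u"
    using n by (simp add: u_def algebra_simps)
  ultimately show "\<exists>\<epsilon> u. (\<epsilon> = 1 \<or> \<epsilon> = -1) \<and> u \<in> deck \<epsilon> \<and> s' = of_int \<epsilon> * s + of_real u"
    using GL2Z_det[OF K(1)] by blast
next
  assume "\<exists>\<epsilon> u. (\<epsilon> = 1 \<or> \<epsilon> = -1) \<and> u \<in> deck \<epsilon> \<and> s' = of_int \<epsilon> * s + of_real u"
  then obtain g where "g \<in> carrier (calG \<alpha>)" "calG_act \<alpha> r g (pt r a b e s) = pt r a b e s'"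
    unfolding deck_def by blast
  then show "orb \<alpha> r (pt r a b e s) = orb \<alpha> r (pt r a b e s')"
    using orb_act[OF adm r pt_e_in] by metis
qed

lemma deck_compose:
  assumes "u \<in> deck \<epsilon>" "v \<in> deck \<epsilon>'"
  shows "of_int \<epsilon> * v + u \<in> deck (\<epsilon> * \<epsilon>')"
proof -
  obtain g where g: "g \<in> carrier (calG \<alpha>)" "\<And>s. calG_act \<alpha> r g (pt r a b e s) = pt r a b e (of_int \<epsilon> * s + of_real u)"
    using assms(1) unfolding deck_def by blast
  obtain h where h: "h \<in> carrier (calG \<alpha>)" "\<And>s. calG_act \<alpha> r h (pt r a b e s) = pt r a b e (of_int \<epsilon>' * s + of_real v)"
    using assms(2) unfolding deck_def by blast
  obtain gh where gh: "gh \<in> carrier (calG \<alpha>)"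
    "\<And>x. x \<in> topspace (scriptA_topology \<alpha> r) \<Longrightarrow> calG_act \<alpha> r g (calG_act \<alpha> r h x) = calG_act \<alpha> r gh x"
    using calG_act_trans[OF adm r g(1) h(1)] by metis
  have "calG_act \<alpha> r gh (pt r a b e s) = pt r a b e (of_int (\<epsilon> * \<epsilon>') * s + of_real (of_int \<epsilon> * v + u))" for s
    unfolding gh(2)[OF pt_e_in, symmetric] h(2) g(2) by (simp add: algebra_simps)
  then show ?thesis unfolding deck_def using gh(1) by blast
qed

lemma deck_uminus: "u \<in> deck 1 \<Longrightarrow> - u \<in> deck 1"
proof -
  assume "u \<in> deck 1"
  then obtain g where g: "g \<in> carrier (calG \<alpha>)" "\<And>s. calG_act \<alpha> r g (pt r a b e s) = pt r a b e (s + of_real u)"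
    unfolding deck_def by auto
  obtain h where h: "h \<in> carrier (calG \<alpha>)" "\<And>x. x \<in> topspace (scriptA_topology \<alpha> r) \<Longrightarrow> calG_act \<alpha> r h (calG_act \<alpha> r g x) = x"
    using calG_act_inverse[OF adm r g(1)] by metis
  have "calG_act \<alpha> r h (pt r a b e s) = pt r a b e (s - of_real u)" for s
    using h(2)[OF pt_e_in, of "s - of_real u"] unfolding g(2) by simp
  then show "- u \<in> deck 1" unfolding deck_def using h(1) by auto
qed

text \<open>Realised by the unit element, because \<open>s\<close> counts modulo
  \<open>1 / r\<close>. It supplies the positive element needed for a generator of the
  translations.\<close>

lemma deck_lattice: "1 / real r \<in> deck 1"
proof -
  have "pt r a b e s = pt r a b e (of_int 1 * s + of_real (1 / real r))" for s
    by (rule sym, rule pt_eqI[of _ _ _ 0 _ _ 1]) (simp_all add: vec2_eq_iff)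
  then show ?thesis
    unfolding deck_def mem_Collect_eq
    by (intro bexI[OF _ calG_unit[OF adm r]] allI) (simp only: calG_act_unit[OF adm r pt_e_in])
qed

lemma deck_discrete:
  assumes "u \<in> deck \<epsilon>"
  shows "\<exists>m::int. u = of_int m / real (2 * r * nat (dd \<alpha>))"
proof -
  have d0: "dd \<alpha> > 0" using S_plus_admissible_facts(3)[OF adm] by (simp add: dd_def)
  obtain g where g: "g \<in> carrier (calG \<alpha>)" "calG_act \<alpha> r g (pt r a b e 0) = pt r a b e (of_int \<epsilon> * 0 + of_real u)"
    using assms unfolding deck_def by blast
  obtain K k where K: "K \<in> GL2Z" "\<And>s. calG_act \<alpha> r g (pt r a b e s)
      = pt r a b (trans_e \<alpha> a b K k e) (of_int (det K) * (s + of_real (shift_t \<alpha> a b k e)))"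
    using calG_act_pt_stab[OF adm r ab e stab_pairI[OF adm r ab g(1) e g(2)]] by metis
  obtain n :: int where "of_int (det K) * (0 + of_real (shift_t \<alpha> a b k e)) = of_int \<epsilon> * 0 + of_real u + complex_of_int n / of_nat r"
    using g(2) unfolding K(2) pt_eq_iff[OF compatible_NN(2)[OF ab]] by blast
  then have "complex_of_real (of_int (det K) * shift_t \<alpha> a b k e) = of_real (u + of_int n / real r)" by simp
  then have u: "u = of_int (det K) * shift_t \<alpha> a b k e - of_int n / real r"
    unfolding of_real_eq_iff by simp
  obtain m :: int where m: "shift_t \<alpha> a b k e = of_int m / of_int (2 * int r * dd \<alpha>)"
    by (rule shift_t_discrete)
  have "u = of_int (det K * m - 2 * dd \<alpha> * n) / real (2 * r * nat (dd \<alpha>))"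
    using r d0 unfolding u m by (simp add: field_simps)
  then show ?thesis by blast
qed

lemma deck_1:
  obtains l where "l > 0" "deck 1 = {of_int n * l | n. True}"
proof -
  have M: "2 * r * nat (dd \<alpha>) > 0" using r S_plus_admissible_facts(3)[OF adm] by (simp add: dd_def)
  have add: "u + v \<in> deck 1" if "u \<in> deck 1" "v \<in> deck 1" for u v
    using deck_compose[OF that(2,1)] by simp
  show ?thesis
    by (rule discrete_subgroup_of_reals[OF add deck_uminus M deck_discrete deck_lattice])
      (use r in \<open>auto intro: that\<close>)
qed

text \<open>Two reflections compose to a translation, and a translation with a reflection gives a
  reflection.\<close>

lemma deck_minus_1:
  assumes "u0 \<in> deck (-1)"
  shows "u \<in> deck (-1) \<longleftrightarrow> u - u0 \<in> deck 1"
proof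
  assume "u \<in> deck (-1)"
  from deck_compose[OF this assms] show "u - u0 \<in> deck 1" by simp
next
  assume "u - u0 \<in> deck 1"
  from deck_compose[OF this assms] show "u \<in> deck (-1)" by simp
qed

end

section \<open>The positive centraliser and the criterion for a reflection\<close>

lemma pos_centraliser_eigen:
  assumes "S_plus_admissible \<alpha>" "(a, b) \<in> compatible_pairs \<alpha>" "L \<in> pos_centraliser (NN \<alpha> a b) a"
  obtains \<mu> \<rho> where "\<mu> > 0" "\<rho> \<noteq> 0" "\<mu> *\<^sub>R (rmat L *v a) = a" "\<rho> *\<^sub>R (rmat L *v b) = b"
proof -
  let ?N = "NN \<alpha> a b"
  obtain \<mu> where L: "L \<in> GL2Z" "L ** ?N = ?N ** L" and \<mu>: "\<mu> > 0" "rmat L *v a = \<mu> *\<^sub>R a"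
    using assms(3) by (auto simp: pos_centraliser_def)
  obtain L' where L': "L ** L' = mat 1" using L(1) by (rule GL2Z_inverse)
  have c: "(rmat L *v a, rmat L *v b) \<in> compatible_pairs \<alpha>"
    and "NN \<alpha> (rmat L *v a) (rmat L *v b) ** L = L ** ?N"
    using compatible_pairs_act[OF assms(2) L(1), of 1 1] by simp_all
  then have "NN \<alpha> (rmat L *v a) (rmat L *v b) ** L ** L' = ?N ** L ** L'" using L(2) by simp
  then have "?N = NN \<alpha> (rmat L *v a) (rmat L *v b)"
    by (simp add: L' flip: matrix_mul_assoc)
  then obtain \<mu>' \<rho> where "\<rho> \<noteq> 0" "rmat L *v b = \<rho> *\<^sub>R b"
    using same_NN_proportional[OF assms(2) c _ assms(1)] by metis
  then show ?thesis using \<mu> by (intro that[of "1 / \<mu>" "1 / \<rho>"]) auto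
qed

text \<open>Fixing the pair fixes \<open>N\<close>, so the intertwining relation becomes
  commutation. With the preceding lemma, the positive centraliser consists exactly of the matrix
  components of the stabiliser of \<open>(a, b)\<close>.\<close>

lemma stabiliser_pos_centraliser:
  assumes "S_plus_admissible \<alpha>" "(a, b) \<in> compatible_pairs \<alpha>" "K \<in> GL2Z" "\<mu> > 0" "\<rho> \<noteq> 0"
    "\<mu> *\<^sub>R (rmat K *v a) = a" "\<rho> *\<^sub>R (rmat K *v b) = b"
  shows "K \<in> pos_centraliser (NN \<alpha> a b) a"
proof -
  have "\<mu> \<noteq> 0" using assms(4) by simp
  from compatible_pairs_act(2)[OF assms(2,3) this assms(5)] have "NN \<alpha> a b ** K = K ** NN \<alpha> a b"
    unfolding assms(6,7) .
  moreover have "rmat K *v a = (1 / \<mu>) *\<^sub>R (\<mu> *\<^sub>R (rmat K *v a))" using assms(4) by simp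
  then have "rmat K *v a = (1 / \<mu>) *\<^sub>R a" unfolding assms(6) .
  ultimately show ?thesis using assms(3,4) unfolding pos_centraliser_def
    by (auto intro!: exI[of _ "1 / \<mu>"])
qed

lemma norm_rel_shift:
  assumes "norm_rel r N e p" "r \<ge> 1"
  shows "norm_rel r N (e + (1 / real r) *\<^sub>R rvec m) (p + (mat 1 - N) *v m)"
proof -
  have "rmat (mat 1 - N) *v rvec m = rvec ((mat 1 - N) *v m)"
    by (simp add: vec2_eq_iff mat_vec_nth2)
  then show ?thesis
    using assms(1) unfolding norm_rel_def matrix_vector_right_distrib matrix_vector_mult_scaleR
      rvec_add scaleR_add_right by simp
qed

context
  fixes \<alpha> :: real and r :: nat and a b e :: "real^2"
  assumes adm: "S_plus_admissible \<alpha>" and r: "r \<ge> 1" and ab: "(a, b) \<in> compatible_pairs \<alpha>"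
    and e: "e \<in> norm_C r (NN \<alpha> a b)"
begin

lemma deck_minus_1_iff:
  assumes p: "norm_rel r (NN \<alpha> a b) e p"
  shows "deck \<alpha> r a b e (-1) \<noteq> {} \<longleftrightarrow>
    (\<exists>L \<in> pos_centraliser (NN \<alpha> a b) a. det L = -1 \<and>
       (\<exists>m n :: int^2. (mat 1 - mat (det L) ** L) *v p = int r *s m + (mat 1 - NN \<alpha> a b) *v n))"
proof -
  let ?N = "NN \<alpha> a b"
  note N = compatible_NN[OF ab]
  have sh: "rmat (mat 1 - ?N) *v shift \<alpha> a b k = rvec (vector [- k $ 2, k $ 1])" for k
    using shift_eq[OF S_plus_admissible_facts(1)[OF adm] N(1,3,4)] .
  have tr: "\<exists>w. \<forall>k. norm_rel r ?N (trans_e \<alpha> a b K k e) (det K *s (K *v (p + int r *s vector [- k $ 2, k $ 1])) + int r *s w)"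
    if "K \<in> pos_centraliser ?N a" for K
  proof -
    have K: "K \<in> GL2Z" "?N ** K = K ** ?N" using that by (auto simp: pos_centraliser_def)
    obtain w where "\<And>e p v q. norm_rel r ?N e p \<Longrightarrow> rmat (mat 1 - ?N) *v v = rvec q \<Longrightarrow> r \<ge> 1 \<Longrightarrow>
       norm_rel r ?N (of_int (det K) *\<^sub>R (rmat K *v (e + v) + (1 / 2) *\<^sub>R row_prods K))
         (det K *s (K *v (p + int r *s q)) + int r *s w)"
      using norm_rel_act[OF K(1) compatible_NN_det_trace(1)[OF ab adm] K(2)] by metis
    from this[OF p sh r] show ?thesis unfolding trans_e_def by blast
  qed
  have det: "mat (det K) ** K *v q = det K *s (K *v q)" for K :: "int^2^2" and q
    by (simp add: coords2 algebra_simps)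
  have lin: "(mat 1 - M) *v q = q - M *v q" for M :: "int^2^2" and q
    by (simp add: coords2 algebra_simps)
  show ?thesis
  proof
    assume "deck \<alpha> r a b e (-1) \<noteq> {}"
    then obtain u g where g: "g \<in> carrier (calG \<alpha>)"
      "\<And>s. calG_act \<alpha> r g (pt r a b e s) = pt r a b e (of_int (-1) * s + of_real u)"
      by (auto simp: deck_def[OF adm r ab e])
    obtain \<mu> \<rho> K k where gd: "g = ((\<mu>, \<rho>), K, Zd_class \<alpha> k)" "\<mu> > 0" "\<rho> \<noteq> 0" "K \<in> GL2Z"
      using g(1) unfolding carrier_calG by blast
    note act = calG_act_pt[OF adm r ab e gd(2-4), of k, folded gd(1)]
    have K: "\<mu> *\<^sub>R (rmat K *v a) = a" "\<rho> *\<^sub>R (rmat K *v b) = b"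
      using arg_cong[OF g(2)[of 0], of fst] arg_cong[OF g(2)[of 0], of "\<lambda>x. fst (snd x)"]
      unfolding act fst_pt by auto
    have KZ: "K \<in> pos_centraliser ?N a"
      using stabiliser_pos_centraliser[OF adm ab gd(4,2,3) K] .
    have eq: "(\<exists>m. trans_e \<alpha> a b K k e = e + (1 / real r) *\<^sub>R rvec m) \<and>
       (\<exists>n::int. of_int (det K) * (s + of_real (shift_t \<alpha> a b k e)) = of_int (-1) * s + of_real u + of_int n / of_nat r)" for s :: complex
      using g(2)[of s] unfolding act K pt_eq_iff[OF N(2)] .
    \<comment> \<open>The choice \<open>s = \<i>\<close> separates the slope from the real
      translation: comparing imaginary parts yields \<open>det K\<close>.\<close>
    obtain n n' :: int where "of_int (det K) * (\<i> + of_real (shift_t \<alpha> a b k e)) = of_int (-1) * \<i> + of_real u + of_int n / of_nat r"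
      using eq[of \<i>] by blast
    then have "Im (of_int (det K) * (\<i> + of_real (shift_t \<alpha> a b k e))) = Im (of_int (-1) * \<i> + of_real (u + of_int n / real r))"
      by simp
    then have dK: "det K = -1" by simp
    obtain m where m: "trans_e \<alpha> a b K k e = e + (1 / real r) *\<^sub>R rvec m" using eq by blast
    obtain w where "norm_rel r ?N (trans_e \<alpha> a b K k e) (det K *s (K *v (p + int r *s vector [- k $ 2, k $ 1])) + int r *s w)"
      using tr[OF KZ] by blast
    then have "det K *s (K *v (p + int r *s vector [- k $ 2, k $ 1])) + int r *s w = p + (mat 1 - ?N) *v m"
      using norm_rel_unique norm_rel_shift[OF p r, of m] r unfolding m by blast
    then have "(mat 1 - mat (det K) ** K) *v p
      = int r *s (det K *s (K *v vector [- k $ 2, k $ 1]) + w) + (mat 1 - ?N) *v (- m)"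
      unfolding lin det by (simp add: vec2_eq_iff mat_vec_nth2 algebra_simps)
    then show "\<exists>L \<in> pos_centraliser ?N a. det L = -1 \<and>
       (\<exists>m n :: int^2. (mat 1 - mat (det L) ** L) *v p = int r *s m + (mat 1 - ?N) *v n)"
      using KZ dK by blast
  next
    assume "\<exists>L \<in> pos_centraliser ?N a. det L = -1 \<and>
       (\<exists>m n :: int^2. (mat 1 - mat (det L) ** L) *v p = int r *s m + (mat 1 - ?N) *v n)"
    then obtain L m n where L: "L \<in> pos_centraliser ?N a" "det L = -1"
      and mn: "(mat 1 - mat (det L) ** L) *v p = int r *s m + (mat 1 - ?N) *v n" by blast
    have LG: "L \<in> GL2Z" using L(1) by (simp add: pos_centraliser_def)
    obtain L' where L': "L ** L' = mat 1" using LG by (rule GL2Z_inverse)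
    obtain w where w: "\<And>k. norm_rel r ?N (trans_e \<alpha> a b L k e) (det L *s (L *v (p + int r *s vector [- k $ 2, k $ 1])) + int r *s w)"
      using tr[OF L(1)] by blast
    \<comment> \<open>Acting by \<open>k\<close> adds \<open>r v\<close> to \<open>p\<close> before
      \<open>L\<close> is applied. Solving \<open>L *v v = w - m\<close> cancels the correction
      \<open>w\<close> and puts the prescribed \<open>m\<close> in its place, as
      \<open>det L = -1\<close>; the vector \<open>k\<close> is \<open>v\<close> rotated
      back.\<close>
    define v where "v = L' *v (w - m)"
    define k where "k = (vector [v $ 2, - v $ 1] :: int^2)"
    have kv: "vector [- k $ 2, k $ 1] = v" by (simp add: k_def vec2_eq_iff)
    have Lv: "L *v v = w - m" by (simp add: v_def matrix_vector_mul_assoc L')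
    have "norm_rel r ?N (trans_e \<alpha> a b L k e) (det L *s (L *v (p + int r *s v)) + int r *s w)"
      using w[of k] unfolding kv .
    also have "L *v (p + int r *s v) = L *v p + int r *s (L *v v)"
      by (simp add: vec2_eq_iff mat_vec_nth2 algebra_simps)
    also have "det L *s (L *v p + int r *s (L *v v)) + int r *s w = det L *s (L *v p) + int r *s m"
      unfolding Lv L(2) by (simp add: vec2_eq_iff algebra_simps)
    also have "\<dots> = p + (mat 1 - ?N) *v (- n)"
      using mn unfolding lin det by (simp add: vec2_eq_iff mat_vec_nth2 algebra_simps)
    \<comment> \<open>Both points satisfy the equation with the same integer vector, and this vector
      determines the point.\<close>
    finally have te: "trans_e \<alpha> a b L k e = e + (1 / real r) *\<^sub>R rvec (- n)"
      using norm_rel_inj[OF ab adm] norm_rel_shift[OF p r] by blast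
    obtain \<mu> \<rho> where \<mu>: "\<mu> > 0" "\<rho> \<noteq> 0" "\<mu> *\<^sub>R (rmat L *v a) = a" "\<rho> *\<^sub>R (rmat L *v b) = b"
      using pos_centraliser_eigen[OF adm ab L(1)] .
    let ?g = "((\<mu>, \<rho>), L, Zd_class \<alpha> k)"
    have "calG_act \<alpha> r ?g (pt r a b e s) = pt r a b e (of_int (-1) * s + of_real (- shift_t \<alpha> a b k e))" for s
      unfolding calG_act_pt[OF adm r ab e \<mu>(1,2) LG] \<mu>(3,4) L(2)
      by (rule pt_eqI[OF te, where n = 0]) simp
    moreover have "?g \<in> carrier (calG \<alpha>)" unfolding carrier_calG using \<mu> LG by blast
    ultimately have "- shift_t \<alpha> a b k e \<in> deck \<alpha> r a b e (-1)"
      unfolding deck_def[OF adm r ab e] by blast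
    then show "deck \<alpha> r a b e (-1) \<noteq> {}" by blast
  qed
qed

section \<open>Uniformisation of the components\<close>

lemma cylinder_uniformised:
  obtains h H where "uniformised (quotient_topology euclidean (t_class r a b)) (t_class r a b) h H"
proof -
  have w: "wedge b a \<noteq> 0" using ab by (rule compatible_NN)
  define l where "l = complex_of_real (wedge b a / real r)"
  have l: "l \<noteq> 0" using w r by (simp add: l_def)
  \<comment> \<open>The periods of this exponential are the integer multiples of \<open>l\<close>,
    which are the differences inside a class. With it the cylinder is uniformised and
    \<open>quotient_surface_from\<close> can compute the second quotient.\<close>
  define h where "h t = exp (2 * of_real pi * \<i> * t / l)" for t
  have hol: "h holomorphic_on UNIV" unfolding h_def using l by (intro holomorphic_intros) auto
  have eq: "t_class r a b z = t_class r a b z' \<longleftrightarrow> h z = h z'" for z z'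
  proof -
    have "h z = h z' \<longleftrightarrow> (\<exists>n::int. 2 * of_real pi * \<i> * z / l = 2 * of_real pi * \<i> * z' / l + (of_int (2 * n) * pi) * \<i>)"
      unfolding h_def by (rule exp_eq)
    also have "\<dots> \<longleftrightarrow> (\<exists>n::int. z = z' + l * of_int n)"
    proof (intro ex_cong1)
      fix n :: int
      have "2 * of_real pi * \<i> * z' / l + (of_int (2 * n) * pi) * \<i> = 2 * of_real pi * \<i> * (z' + l * of_int n) / l"
        using l by (simp add: field_simps)
      then show "2 * of_real pi * \<i> * z / l = 2 * of_real pi * \<i> * z' / l + (of_int (2 * n) * pi) * \<i>
         \<longleftrightarrow> z = z' + l * of_int n"
        using l by simp
    qed
    also have "\<dots> \<longleftrightarrow> t_class r a b z = t_class r a b z'"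
      unfolding t_class_eq_iff l_def ..
    finally show ?thesis by blast
  qed
  have "\<not> h constant_on UNIV"
  proof
    assume "h constant_on UNIV"
    then have "h (l / 2) = h 0" unfolding constant_on_def by (metis UNIV_I)
    then show False using l by (simp add: h_def exp_pi_i)
  qed
  then show ?thesis
    using uniformised_from_quotient[OF hol _ quotient_map_quotient_topology eq] that by metis
qed

text \<open>The two quotients and the transport in the definition collapse to one map from the
  plane, and the component carries the quotient topology of that map. Both follow once the orbits of
  the stabiliser on the cylinder are known to be the fibres of this map.\<close>

lemma component_surface_eq:
  "component_surface \<alpha> r a b (cls r a b e) =
     surface_from (subtopology (scriptQ_topology \<alpha> r) (component \<alpha> r a b (c_orbit \<alpha> r a b (cls r a b e))))
       (\<lambda>t. orb \<alpha> r (pt r a b e (t / of_real (wedge b a))))"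
  and component_quotient_map:
  "quotient_map euclidean (subtopology (scriptQ_topology \<alpha> r) (component \<alpha> r a b (c_orbit \<alpha> r a b (cls r a b e))))
       (\<lambda>t. orb \<alpha> r (pt r a b e (t / of_real (wedge b a))))"
proof -
  let ?Q = "scriptQ_topology \<alpha> r" and ?X = "cls r a b e" and ?tc = "t_class r a b"
  let ?C = "component \<alpha> r a b (c_orbit \<alpha> r a b ?X)"
  let ?\<pi> = "orbit (stab_c \<alpha> r a b ?X) (t_act \<alpha> r a b ?X)"
  let ?\<iota> = "\<lambda>\<tau>. the_elem ((\<lambda>T. orb \<alpha> r (a, b, ?X, T)) ` \<tau>)"
  let ?j = "\<lambda>t. orb \<alpha> r (pt r a b e (t / of_real (wedge b a)))"
  have w: "wedge b a \<noteq> 0" using ab by (rule compatible_NN)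
  have tup: "(a, b, ?X, ?tc t) = pt r a b e (t / of_real (wedge b a))" for t
    using w by (rule tuple_eq_pt)
  have Q: "openin ?Q (?j ` B)" if "open B" for B
  proof -
    have "open ((\<lambda>s. of_real (wedge b a) * s) -` B)"
      using that by (intro open_vimage continuous_intros)
    from open_orb_pt[OF adm r ab e this]
    have "openin ?Q ((\<lambda>s. orb \<alpha> r (pt r a b e s)) ` ((\<lambda>s. of_real (wedge b a) * s) -` B))" .
    also have "(\<lambda>s. orb \<alpha> r (pt r a b e s)) ` ((\<lambda>s. of_real (wedge b a) * s) -` B) = ?j ` B"
    proof -
      have "(\<lambda>s. complex_of_real (wedge b a) * s) -` B = (\<lambda>t. t / of_real (wedge b a)) ` B"
        using w by (force simp: image_iff field_simps)
      then show ?thesis by (simp add: image_image)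
    qed
    finally show ?thesis .
  qed
  have ran: "range ?j = ?C"
  proof -
    have "range ?j = (\<lambda>s. orb \<alpha> r (pt r a b e s)) ` range (\<lambda>t. t / complex_of_real (wedge b a))"
      by (simp add: image_image)
    also have "range (\<lambda>t. t / complex_of_real (wedge b a)) = UNIV"
      using w by (intro surjI[of _ "\<lambda>s. s * of_real (wedge b a)"]) simp
    finally show ?thesis unfolding component_cls[OF adm r ab e] .
  qed
  have cont: "continuous_map euclidean ?Q ?j"
  proof -
    have "continuous_map euclidean euclidean (\<lambda>t. t / complex_of_real (wedge b a))"
      using w by (auto intro!: continuous_intros)
    from continuous_map_compose[OF this continuous_map_orb_pt[OF adm r ab e]] show ?thesis by (simp add: o_def)
  qed
  have top: "topspace (subtopology ?Q ?C) = ?C"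
    using Q[OF open_UNIV] openin_subset unfolding ran by fastforce
  show quo: "quotient_map euclidean (subtopology ?Q ?C) ?j"
  proof (rule continuous_open_imp_quotient_map)
    show "continuous_map euclidean (subtopology ?Q ?C) ?j"
      using cont ran by (auto simp: continuous_map_in_subtopology)
    show "open_map euclidean (subtopology ?Q ?C) ?j"
      unfolding open_map_def
    proof (intro allI impI)
      fix B :: "complex set" assume "openin euclidean B"
      then have "openin ?Q (?j ` B)" using Q by simp
      moreover have "?j ` B \<subseteq> ?C" using ran by blast
      ultimately show "openin (subtopology ?Q ?C) (?j ` B)"
        by (auto simp: openin_subtopology)
    qed
    show "?j ` topspace euclidean = topspace (subtopology ?Q ?C)" using ran top by simp
  qed
  \<comment> \<open>A group element taking one point over the pair and the class of \<open>c\<close>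
    to another such point stabilises both. So equality in the big orbit space is equality under the
    stabiliser of the class.\<close>
  have pi: "?\<pi> (?tc t) = {?tc t' | t'. ?j t' = ?j t}" for t
  proof (intro subset_antisym subsetI)
    fix T assume "T \<in> ?\<pi> (?tc t)"
    then obtain g where g: "g \<in> carrier (stab_pair \<alpha> a b)" "c_act \<alpha> r a b g ?X = ?X" "T = t_act \<alpha> r a b ?X g (?tc t)"
      by (auto simp: orbit_def stab_c_def stabilizer_def)
    have g': "g \<in> carrier (calG \<alpha>)" using g(1) by (simp add: stab_pair_def stabilizer_def)
    obtain K k where act: "\<And>s. calG_act \<alpha> r g (pt r a b e s)
        = pt r a b (trans_e \<alpha> a b K k e) (of_int (det K) * (s + of_real (shift_t \<alpha> a b k e)))"
      using calG_act_pt_stab[OF adm r ab e g(1)] by metis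
    have X: "cls r a b (trans_e \<alpha> a b K k e) = ?X"
      using c_act_cls[OF adm r ab e act g'] g(2) by simp
    let ?t' = "complex_of_real (wedge b a) * (of_int (det K) * (t / of_real (wedge b a) + of_real (shift_t \<alpha> a b k e)))"
    have eq: "calG_act \<alpha> r g (a, b, ?X, ?tc t) = (a, b, ?X, ?tc ?t')"
      unfolding tup act by (simp add: pt_eq_tuple X)
    then have "T = ?tc ?t'" by (simp add: g(3) t_act_def)
    moreover have "?j ?t' = ?j t"
      using orb_act[OF adm r pt_in_scriptA[OF ab e] g'] eq unfolding tup by metis
    ultimately show "T \<in> {?tc t' | t'. ?j t' = ?j t}" by blast
  next
    fix T assume "T \<in> {?tc t' | t'. ?j t' = ?j t}"
    then obtain t' where t': "T = ?tc t'" "?j t = ?j t'" by auto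
    obtain g where g: "g \<in> carrier (stab_pair \<alpha> a b)"
      "calG_act \<alpha> r g (pt r a b e (t / of_real (wedge b a))) = pt r a b e (t' / of_real (wedge b a))"
      using orb_pt_eqE[OF adm r ab e e t'(2)] .
    have g': "g \<in> carrier (calG \<alpha>)" using g(1) by (simp add: stab_pair_def stabilizer_def)
    have "g \<in> carrier (stab_c \<alpha> r a b ?X)"
      using g(1) c_act_cls[OF adm r ab e g(2) g'] by (simp add: stab_c_def stabilizer_def)
    moreover have "t_act \<alpha> r a b ?X g (?tc t) = T"
      using g(2) unfolding tup[symmetric] by (simp add: t_act_def t'(1))
    ultimately show "T \<in> ?\<pi> (?tc t)" unfolding orbit_def by blast
  qed
  have \<iota>: "?\<iota> (?\<pi> (?tc t)) = ?j t" for t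
  proof -
    have mem: "?tc t \<in> ?\<pi> (?tc t)" unfolding pi by blast
    have eq: "orb \<alpha> r (a, b, ?X, T) = ?j t" if T: "T \<in> ?\<pi> (?tc t)" for T
    proof -
      obtain t' where t': "T = ?tc t'" "?j t' = ?j t" using T unfolding pi by blast
      show ?thesis unfolding t'(1) tup by (rule t'(2))
    qed
    have "?\<iota> (?\<pi> (?tc t)) = orb \<alpha> r (a, b, ?X, ?tc t)"
    proof (rule the_elem_image_unique)
      show "?\<pi> (?tc t) \<noteq> {}" using mem by blast
      show "orb \<alpha> r (a, b, ?X, T) = orb \<alpha> r (a, b, ?X, ?tc t)" if "T \<in> ?\<pi> (?tc t)" for T
        using eq[OF that] eq[OF mem] by simp
    qed
    then show ?thesis unfolding eq[OF mem] .
  qed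
  have \<pi>_eq: "?\<pi> (?tc t) = ?\<pi> (?tc t') \<longleftrightarrow> ?j t = ?j t'" for t t'
  proof
    assume "?\<pi> (?tc t) = ?\<pi> (?tc t')"
    from arg_cong[OF this, of ?\<iota>] show "?j t = ?j t'" unfolding \<iota> .
  next
    assume "?j t = ?j t'"
    then show "?\<pi> (?tc t) = ?\<pi> (?tc t')" unfolding pi by simp
  qed
  let ?Z = "quotient_topology euclidean ?tc"
  let ?Y = "quotient_topology ?Z ?\<pi>"
  have q: "quotient_map euclidean ?Y (?\<pi> \<circ> ?tc)"
    by (rule quotient_map_compose[OF quotient_map_quotient_topology quotient_map_quotient_topology])
  have hom: "homeomorphic_map ?Y (subtopology ?Q ?C) ?\<iota>"
    by (rule homeomorphic_map_quotients[OF q quo]) (simp_all only: o_apply \<pi>_eq \<iota>)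
  obtain h H where u: "uniformised ?Z ?tc h H" by (rule cylinder_uniformised)
  have "component_surface \<alpha> r a b ?X = transport_surface (surface_from ?Y (?\<pi> \<circ> ?tc)) ?\<iota> (subtopology ?Q ?C)"
    unfolding component_surface_def cylinder_def quotient_surface_plane uniformised.quotient_surface_from[OF u] ..
  also have "\<dots> = surface_from (subtopology ?Q ?C) (?\<iota> \<circ> (?\<pi> \<circ> ?tc))"
    by (rule transport_surface_from[OF hom]) auto
  also have "?\<iota> \<circ> (?\<pi> \<circ> ?tc) = ?j" by (rule ext) (simp only: o_apply \<iota>)
  finally show "component_surface \<alpha> r a b ?X = surface_from (subtopology ?Q ?C) ?j" .
qed

text \<open>The complex structure is defined with \<open>t\<close>, the deck group with
  \<open>s\<close>; composing \<open>h\<close> with the division by \<open>wedge b a\<close> leaves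
  its range unchanged.\<close>

lemma component_biholomorphic:
  assumes "h holomorphic_on UNIV" "\<not> h constant_on UNIV"
    and "\<And>s s'. orb \<alpha> r (pt r a b e s) = orb \<alpha> r (pt r a b e s') \<longleftrightarrow> h s = h s'"
  shows "biholomorphic (component_surface \<alpha> r a b (cls r a b e)) (plane_surface (range h))"
proof -
  have w: "wedge b a \<noteq> 0" using ab by (rule compatible_NN)
  let ?f = "\<lambda>t. t / complex_of_real (wedge b a)"
  have f: "range ?f = UNIV"
    using w by (intro surjI[of _ "\<lambda>s. s * of_real (wedge b a)"]) simp
  have 1: "(h \<circ> ?f) holomorphic_on UNIV"
    using w by (intro holomorphic_on_compose holomorphic_intros holomorphic_on_subset[OF assms(1)]) auto
  have 2: "\<not> (h \<circ> ?f) constant_on UNIV"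
  proof
    assume "(h \<circ> ?f) constant_on UNIV"
    then obtain c where "\<And>t. h (?f t) = c" unfolding constant_on_def by auto
    then have "h s = c" for s using f by (metis rangeE UNIV_I)
    then show False using assms(2) unfolding constant_on_def by blast
  qed
  obtain H where "uniformised (subtopology (scriptQ_topology \<alpha> r) (component \<alpha> r a b (c_orbit \<alpha> r a b (cls r a b e))))
       (\<lambda>t. orb \<alpha> r (pt r a b e (?f t))) (h \<circ> ?f) H"
    using uniformised_from_quotient[OF 1 2 component_quotient_map] assms(3) by auto
  then have "biholomorphic (component_surface \<alpha> r a b (cls r a b e)) (plane_surface (range (h \<circ> ?f)))"
    unfolding component_surface_eq by (rule uniformised.biholomorphic_range)
  moreover have "range (h \<circ> ?f) = range h" by (metis f image_comp)
  ultimately show ?thesis by simp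
qed

lemma orb_eq_iff_deck':
  "orb \<alpha> r (pt r a b e s) = orb \<alpha> r (pt r a b e s') \<longleftrightarrow>
     (\<exists>u \<in> deck \<alpha> r a b e 1. s' = s + of_real u) \<or> (\<exists>u \<in> deck \<alpha> r a b e (-1). s' = - s + of_real u)"
proof -
  have "(\<exists>\<epsilon> u. (\<epsilon> = 1 \<or> \<epsilon> = -1) \<and> P \<epsilon> u) \<longleftrightarrow> (\<exists>u. P 1 u) \<or> (\<exists>u. P (-1) u)" for P :: "int \<Rightarrow> real \<Rightarrow> bool"
    by blast
  then show ?thesis unfolding orb_eq_iff_deck[OF adm r ab e] by (simp add: Bex_def)
qed

lemma component_punctured_plane:
  assumes "deck \<alpha> r a b e (-1) = {}"
  shows "biholomorphic (component_surface \<alpha> r a b (cls r a b e)) (plane_surface (UNIV - {0}))"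
proof -
  obtain l where l: "l > 0" "deck \<alpha> r a b e 1 = {of_int n * l | n. True}"
    using deck_1[OF adm r ab e] .
  define h where "h s = exp (2 * of_real pi * \<i> * s / of_real l)" for s
  have hol: "h holomorphic_on UNIV" unfolding h_def using l by (intro holomorphic_intros) auto
  have "\<not> h constant_on UNIV"
  proof
    assume "h constant_on UNIV"
    then have "h (of_real l / 2) = h 0" unfolding constant_on_def by (metis UNIV_I)
    then show False using l by (simp add: h_def exp_pi_i)
  qed
  moreover have "orb \<alpha> r (pt r a b e s) = orb \<alpha> r (pt r a b e s') \<longleftrightarrow> h s = h s'" for s s'
  proof -
    have "h s' = h s \<longleftrightarrow> (\<exists>n::int. 2 * of_real pi * \<i> * s' / of_real l = 2 * of_real pi * \<i> * s / of_real l + (of_int (2 * n) * pi) * \<i>)"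
      unfolding h_def by (rule exp_eq)
    also have "\<dots> \<longleftrightarrow> (\<exists>n::int. s' = s + of_real (of_int n * l))"
    proof (intro ex_cong1)
      fix n :: int
      have "2 * of_real pi * \<i> * s / of_real l + (of_int (2 * n) * pi) * \<i> = 2 * of_real pi * \<i> * (s + of_real (of_int n * l)) / of_real l"
        using l by (simp add: field_simps)
      then show "2 * of_real pi * \<i> * s' / of_real l = 2 * of_real pi * \<i> * s / of_real l + (of_int (2 * n) * pi) * \<i>
         \<longleftrightarrow> s' = s + of_real (of_int n * l)"
        using l by simp
    qed
    also have "\<dots> \<longleftrightarrow> orb \<alpha> r (pt r a b e s) = orb \<alpha> r (pt r a b e s')"
      unfolding orb_eq_iff_deck' assms l(2) by blast
    finally show ?thesis by auto
  qed
  ultimately have "biholomorphic (component_surface \<alpha> r a b (cls r a b e)) (plane_surface (range h))"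
    by (rule component_biholomorphic[OF hol])
  moreover have "range h = UNIV - {0}"
  proof -
    have "y \<in> range h" if "y \<noteq> 0" for y
    proof
      show "y = h (Ln y * of_real l / (2 * of_real pi * \<i>))" using that l by (simp add: h_def)
    qed simp
    then show ?thesis by (auto simp: h_def)
  qed
  ultimately show ?thesis by simp
qed

lemma component_plane:
  assumes "u0 \<in> deck \<alpha> r a b e (-1)"
  shows "biholomorphic (component_surface \<alpha> r a b (cls r a b e)) (plane_surface UNIV)"
proof -
  obtain l where l: "l > 0" "deck \<alpha> r a b e 1 = {of_int n * l | n. True}"
    using deck_1[OF adm r ab e] .
  \<comment> \<open>\<open>u0 / 2\<close> is the fixed point of \<open>s \<mapsto> u0 - s\<close>.
    Centring there turns the reflection into a change of sign, under which the cosine is invariant,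
    and the scaling makes \<open>l\<close> correspond to the period of the cosine.\<close>
  define f where "f s = 2 * of_real pi * (s - of_real (u0 / 2)) / of_real l" for s :: complex
  define h where "h s = cos (f s)" for s
  have hol: "h holomorphic_on UNIV" unfolding h_def f_def using l by (intro holomorphic_intros) auto
  have surj: "range h = UNIV"
  proof -
    have "y \<in> range h" for y
    proof
      show "y = h (Arccos y * of_real l / (2 * of_real pi) + of_real (u0 / 2))" using l by (simp add: h_def f_def)
    qed simp
    then show ?thesis by auto
  qed
  have "\<not> h constant_on UNIV"
  proof
    assume "h constant_on UNIV"
    then obtain c where "range h \<subseteq> {c}" unfolding constant_on_def by auto
    then show False using surj by (metis UNIV_I singletonD subsetD zero_neq_one)
  qed
  moreover have "orb \<alpha> r (pt r a b e s) = orb \<alpha> r (pt r a b e s') \<longleftrightarrow> h s = h s'" for s s'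
  proof -
    have inj: "f x = f y \<longleftrightarrow> x = y" for x y
      using l by (simp add: f_def)
    have p: "f s' = f s + of_real (2 * of_int n * pi) \<longleftrightarrow> s' = s + of_real (of_int n * l)" for n :: int
    proof -
      have shifted: "f s + of_real (2 * of_int n * pi) = f (s + of_real (of_int n * l))"
        using l by (simp add: f_def field_simps)
      show ?thesis unfolding shifted inj ..
    qed
    have m: "f s' = - f s + of_real (2 * of_int n * pi) \<longleftrightarrow> s' = - s + of_real (u0 + of_int n * l)" for n :: int
    proof -
      have shifted: "- f s + of_real (2 * of_int n * pi) = f (- s + of_real (u0 + of_int n * l))"
        using l by (simp add: f_def field_simps)
      show ?thesis unfolding shifted inj ..
    qed
    have "h s' = h s \<longleftrightarrow> (\<exists>n::int. f s' = f s + of_real (2 * of_int n * pi) \<or> f s' = - f s + of_real (2 * of_int n * pi))"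
      unfolding h_def complex_cos_eq Ints_def by simp
    also have "\<dots> \<longleftrightarrow> orb \<alpha> r (pt r a b e s) = orb \<alpha> r (pt r a b e s')"
    proof -
      have "u \<in> deck \<alpha> r a b e (-1) \<longleftrightarrow> (\<exists>n. u = u0 + of_int n * l)" for u
        unfolding deck_minus_1[OF adm r ab e assms] l(2) by (auto simp: algebra_simps)
      then have d: "deck \<alpha> r a b e (-1) = {u0 + of_int n * l | n. True}" by auto
      show ?thesis unfolding orb_eq_iff_deck' p m l(2) d by blast
    qed
    finally show ?thesis by auto
  qed
  ultimately show ?thesis using component_biholomorphic[OF hol] surj by simp
qed

end

theorem corollary4p39:
  fixes \<alpha> :: real and a b :: "real^2" and r :: nat
  assumes "S_plus_admissible \<alpha>" and "(a, b) \<in> compatible_pairs \<alpha>" and "r \<ge> 1"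
  shows
    "bij_betw (component \<alpha> r a b) (c_orbits \<alpha> r a b)
       (connected_components_of (subtopology (scriptQ_topology \<alpha> r) (Phi_fibre \<alpha> r a b))) \<and>
     (\<forall>c \<in> CC \<alpha> r a b.
        (let S = component_surface \<alpha> r a b (c_class r a b c);
             N = NN \<alpha> a b;
             p = pp \<alpha> r a b c
         in (biholomorphic S (plane_surface (UNIV - {0})) \<or>
             biholomorphic S (plane_surface UNIV)) \<and>
            (biholomorphic S (plane_surface UNIV) \<longleftrightarrow>
             (\<exists>L \<in> pos_centraliser N a. det L = -1 \<and>
                (\<exists>m n :: int^2.
                   (mat 1 - mat (det L) ** L) *v p = int r *s m + (mat 1 - N) *v n)))))"
proof (intro conjI ballI)
  show "bij_betw (component \<alpha> r a b) (c_orbits \<alpha> r a b)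
       (connected_components_of (subtopology (scriptQ_topology \<alpha> r) (Phi_fibre \<alpha> r a b)))"
    using assms(1,3,2) by (rule bij_betw_component)
  fix c assume c: "c \<in> CC \<alpha> r a b"
  have w: "wedge b a \<noteq> 0" using assms(2) by (rule compatible_NN)
  obtain e where ce: "c = wedge b a *\<^sub>R e + half_diag a b" using norm_form[OF w] .
  then have e: "e \<in> norm_C r (NN \<alpha> a b)" using c CC_iff_norm_C[OF w] by simp
  then obtain p where p: "norm_rel r (NN \<alpha> a b) e p" using norm_C_iff by blast
  have pp: "pp \<alpha> r a b c = p" unfolding ce by (rule pp_norm_form[OF w p assms(3)])
  note deck = deck_minus_1_iff[OF assms(1,3,2) e p]
  note plane = component_plane[OF assms(1,3,2) e]
  note punctured = component_punctured_plane[OF assms(1,3,2) e]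
  show "let S = component_surface \<alpha> r a b (c_class r a b c); N = NN \<alpha> a b; p = pp \<alpha> r a b c
         in (biholomorphic S (plane_surface (UNIV - {0})) \<or> biholomorphic S (plane_surface UNIV)) \<and>
            (biholomorphic S (plane_surface UNIV) \<longleftrightarrow>
             (\<exists>L \<in> pos_centraliser N a. det L = -1 \<and>
                (\<exists>m n :: int^2. (mat 1 - mat (det L) ** L) *v p = int r *s m + (mat 1 - N) *v n)))"
    \<comment> \<open>The criterion now says that a reflection exists. This decides which
      uniformisation applies, and the exclusion of the other one gives the converse.\<close>
    unfolding Let_def pp deck[symmetric] unfolding ce
    using plane punctured not_biholomorphic_plane_and_punctured by blast
qed

end
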